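(* Let $n\ge 1$. On each of the following seven Catalan families, the map $h$ of that family sends the first pair of statistics to the second; that is, for every object $t$ of size $n$, if the pairs are $(a,b)$ and $(a',b')$, then $a'(h(t))=a(t)$ and $b'(h(t))=b(t)$ (and $h$ is an involution preserving size, so the two pairs have the same joint distribution on objects of size $n$): (1) Dyck paths: $(\mathrm{comp},\mathrm{peak})$ to $(\mathrm{rcomp},\mathrm{nonpeak})$; (2) triangulations: $(\mathrm{comp},\mathrm{tr})$ to $(\mathrm{rcomp},\mathrm{nontr})$; (3) $231$-avoiding permutations: $(\mathrm{comp},\mathrm{rmin})$ to $(\mathrm{rmax},\mathrm{nonrmin})$; (4) $321$-avoiding permutations: $(\mathrm{comp},\mathrm{rmin})$ to $(\mathrm{rcomp},\mathrm{nonrmin})$; (5) binary trees: $(\mathrm{comp},\mathrm{redge})$ to $(\mathrm{rcomp},\mathrm{ledge})$; (6) $2\times n$ standard Young tableaux: $(\mathrm{comp},\mathrm{noncons})$ to $(\mathrm{rcomp},\mathrm{cons})$; (7) non-crossing partitions: $(\mathrm{comp},\mathrm{blocks})$ to $(\mathrm{rcomp},\mathrm{nonmin})$.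
   Context: A Catalan structure is a quadruple $(C,e,\lambda,\oplus)$ where $C=\bigsqcup_{n\ge 0}C_n$ with $C_0=\{e\}$ ($|t|=n$ for $t\in C_n$), $\lambda\colon C_n\to C_{n+1}$, $\oplus\colon C_m\times C_n\to C_{m+n}$, $\oplus$ is associative with two-sided identity $e$, and every $t\in C$ can be written uniquely in exactly one of three forms: $t=e$; $t=\lambda(s)$ (indecomposable); $t=u\oplus v$ with $u$ indecomposable and $v\neq e$ (decomposable). Every nonempty $t$ is then uniquely $\lambda(u)\oplus v$. Put $\gamma(t)=t\oplus\lambda(e)$ and define $\ominus$ by $e\ominus v=v$, $\lambda(u)\ominus v=\lambda(u\ominus v)$, $(t\oplus u)\ominus v=t\oplus(u\ominus v)$ for $t,u\ne e$. The map $h$ is defined by $h(e)=e$, $h(\lambda(u)\oplus v)=h(v)\ominus\gamma(h(u))$. Each family below is a Catalan structure with the stated $e,\lambda,\oplus$. (1) Dyck paths of semilength $n$ as words in $u,d$: $e=\epsilon$, $\lambda(w)=uwd$, $w_1\oplus w_2=w_1w_2$. comp = number of returns to the $x$-axis; rcomp = length of the final run of $d$'s; peak = number of factors $ud$; nonpeak = $1$ + number of factors $uu$. (2) Triangulations of the convex $(n+2)$-gon with vertices labeled $1,\dots,n+2$ clockwise (size $n$; size $0$ is the single edge $(1,2)$, which is $e$). $\lambda(T)$: relabel $i\mapsto i+1$ in $T$ (size $n$) and add a new vertex $1$ adjacent to $2$ and $n+3$. $T_1\oplus T_2$ (with $|T_1|=n_1$): identify the edge $(1,n_1+2)$ of $T_1$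 with the edge $(1,2)$ of $T_2$, so vertex $1$ of $T_2$ stays $1$ and vertex $j\ge 2$ of $T_2$ becomes $n_1+j$. Edges include boundary edges. comp = (number of edges incident to $1$) $-1$; rcomp = (number of edges incident to $n+2$) $-1$; tr = number of $i\in\{2,\dots,n+1\}$ such that some $j<i$ is adjacent to both $i$ and $i+1$; nontr $=n+1-\mathrm{tr}$. (3) $231$-avoiding permutations of $[n]$: $e=\epsilon$, $\lambda(\pi)=(n+1)\pi$ (prepend a new maximum), $\oplus$ = direct sum ($\pi_1\oplus\pi_2=\pi_1\pi_2'$ with $\pi_2'(i)=\pi_2(i)+|\pi_1|$). comp = number of direct-sum components; rmax = number of right-to-left maxima; rmin = number of right-to-left minima; nonrmin = $1$ + number of entries that are not right-to-left minima. (4) $321$-avoiding permutations of $[n]$: $e=\epsilon$, $\oplus$ = direct sum, $\lambda(\epsilon)=1$, and for $n\ge 1$, $\lambda(\pi)$ is obtained as follows: let $i$ be the position of $1$ in $\pi$; box the positions to the right of $i$ that are left-to-right maxima but not right-to-left minima of $\pi$; insert $n+1$ at position $i$ (shifting later entries, and boxes, one place right) and box this position too; then cyclically shift the values at the boxed positions one step to the left (each boxed value moves to the previous boxed position, the first wraps to the last). comp = number of direct-sum components; rcomp $=n-\pi(n)+1$; rmin, nonrmin as in (3). (5) Binary trees with $n$ nodes: either $\varnothing$ or $(L,R)$ with $L,R$ binary trees. $e=\varnothing$, $\lambda(T)=(T,\varnothing)$, $\varnothing\oplus B=B$, $(T,B_1)\oplus B_2=(T,B_1\oplus B_2)$. The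 right spine is the maximal sequence of nodes reached from the root along right edges. comp = number of nodes on the right spine; rcomp = number of iterations needed to reach $\varnothing$ when repeatedly replacing the tree by the left subtree of the last node of its right spine; redge = $1$ + number of edges from a node to a nonempty right child; ledge $=n+1-\mathrm{redge}$. (6) $2\times n$ standard Young tableaux: $e$ = empty tableau; $\lambda(T)$ ($T$ of size $n$): increase all entries by $1$, prepend $1$ to the top row and append $2n+2$ to the bottom row; $T_1\oplus T_2$: add $2|T_1|$ to all entries of $T_2$ and adjoin its columns to the right of $T_1$. comp = number of $k\in\{1,\dots,n\}$ such that the first $k$ columns contain exactly $\{1,\dots,2k\}$; rcomp = largest $k$ such that the last $k$ bottom-row entries, read right to left, are $2n,2n-1,\dots,2n-k+1$; cons = $1$ + number of top-row entries $i$ with $i+1$ in the top row; noncons = number of top-row entries $i$ with $i+1$ in the bottom row. (7) Non-crossing partitions of $[n]$: $e$ = empty partition; $\lambda(P)$: add $n+1$ to the block containing $1$ (and $\lambda(e)=\{\{1\}\}$); $P_1\oplus P_2=P_1\cup(P_2+|P_1|)$. comp = number of indecomposable summands (equivalently, number of $k\in\{1,\dots,n\}$ such that $[k]$ is a union of blocks); rcomp = number of right-to-left maxima of the flattened form, i.e. the word listing each block in decreasing order, with blocks sorted by minimal element; blocks = number of blocks; nonmin $=n+1-\mathrm{blocks}$. *)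

theory Defs
  imports "HOL-Combinatorics.Multiset_Permutations" "HOL-Library.Disjoint_Sets"
begin

section \<open>Catalan structures and the map h\<close>

locale catalan_data =
  fixes C :: "nat \<Rightarrow> 'a set"
    and e :: 'a
    and lam :: "'a \<Rightarrow> 'a"
    and oplus :: "'a \<Rightarrow> 'a \<Rightarrow> 'a"  (infixl "\<oplus>" 65)
begin

definition carrier :: "'a set" where
  "carrier = (\<Union>n. C n)"

definition indecomposable :: "'a \<Rightarrow> bool" where
  "indecomposable t \<longleftrightarrow> (\<exists>s\<in>carrier. t = lam s)"

definition decomposable :: "'a \<Rightarrow> bool" where
  "decomposable t \<longleftrightarrow> (\<exists>u v. indecomposable u \<and> v \<in> carrier \<and> v \<noteq> e \<and> t = u \<oplus> v)"

definition gamma :: "'a \<Rightarrow> 'a" where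
  "gamma t = t \<oplus> lam e"

(* The operations ominus and h are defined by overlapping clauses rather than by recursion on
   a datatype, so they are introduced as graphs.  That the graphs are functional, and hence that
   the clauses hold as equations, is proved in the locale catalan_structure. *)

inductive ominus_rel :: "'a \<Rightarrow> 'a \<Rightarrow> 'a \<Rightarrow> bool" where
  ominus_rel_e: "v \<in> carrier \<Longrightarrow> ominus_rel e v v"
| ominus_rel_lam: "u \<in> carrier \<Longrightarrow> ominus_rel u v w \<Longrightarrow> ominus_rel (lam u) v (lam w)"
| ominus_rel_oplus: "t \<in> carrier \<Longrightarrow> u \<in> carrier \<Longrightarrow> t \<noteq> e \<Longrightarrow> u \<noteq> e \<Longrightarrow> ominus_rel u v w
    \<Longrightarrow> ominus_rel (t \<oplus> u) v (t \<oplus> w)"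

definition ominus :: "'a \<Rightarrow> 'a \<Rightarrow> 'a"  (infixl "\<ominus>" 65) where
  "u \<ominus> v = (THE w. ominus_rel u v w)"

inductive h_rel :: "'a \<Rightarrow> 'a \<Rightarrow> bool" where
  h_rel_e: "h_rel e e"
| h_rel_lam: "u \<in> carrier \<Longrightarrow> v \<in> carrier \<Longrightarrow> h_rel u u' \<Longrightarrow> h_rel v v'
    \<Longrightarrow> h_rel (lam u \<oplus> v) (v' \<ominus> gamma u')"

definition h :: "'a \<Rightarrow> 'a" where
  "h t = (THE w. h_rel t w)"

definition num_summands :: "'a \<Rightarrow> nat" where
  "num_summands t =
    (THE k. \<exists>us. length us = k \<and> (\<forall>u\<in>set us. indecomposable u) \<and> foldr (\<oplus>) us e = t)"

definition h_sends ::
  "nat \<Rightarrow> ('a \<Rightarrow> nat) \<times> ('a \<Rightarrow> nat) \<Rightarrow> ('a \<Rightarrow> nat) \<times> ('a \<Rightarrow> nat) \<Rightarrow> bool" where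
  "h_sends n = (\<lambda>(a, b) (a', b').
     (\<forall>t\<in>C n. h t \<in> C n \<and> h (h t) = t \<and> a' (h t) = a t \<and> b' (h t) = b t) \<and>
     (\<forall>i j. card {t \<in> C n. a t = i \<and> b t = j} = card {t \<in> C n. a' t = i \<and> b' t = j}))"

end

locale catalan_structure = catalan_data +
  assumes C_disjoint: "disjoint_family C"
    and C_0: "C 0 = {e}"
    and lam_closed: "s \<in> C n \<Longrightarrow> lam s \<in> C (Suc n)"
    and oplus_closed: "s \<in> C m \<Longrightarrow> t \<in> C n \<Longrightarrow> s \<oplus> t \<in> C (m + n)"
    and oplus_assoc: "s \<in> carrier \<Longrightarrow> t \<in> carrier \<Longrightarrow> u \<in> carrier
      \<Longrightarrow> (s \<oplus> t) \<oplus> u = s \<oplus> (t \<oplus> u)"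
    and oplus_e_left: "t \<in> carrier \<Longrightarrow> e \<oplus> t = t"
    and oplus_e_right: "t \<in> carrier \<Longrightarrow> t \<oplus> e = t"
    and three_forms: "t \<in> carrier \<Longrightarrow> t = e \<or> indecomposable t \<or> decomposable t"
    and e_not_indecomposable: "\<not> indecomposable e"
    and e_not_decomposable: "\<not> decomposable e"
    and indecomposable_not_decomposable: "indecomposable t \<Longrightarrow> \<not> decomposable t"
    and lam_inj: "inj_on lam carrier"
    and decomposition_unique:
      "indecomposable u \<Longrightarrow> indecomposable u' \<Longrightarrow> v \<in> carrier \<Longrightarrow> v' \<in> carrier
        \<Longrightarrow> v \<noteq> e \<Longrightarrow> v' \<noteq> e \<Longrightarrow> u \<oplus> v = u' \<oplus> v' \<Longrightarrow> u = u' \<and> v = v'"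
begin

lemma e_carrier: "e \<in> carrier"
  using C_0 by (auto simp: carrier_def)

lemma lam_carrier: "s \<in> carrier \<Longrightarrow> lam s \<in> carrier"
  using lam_closed by (auto simp: carrier_def)

lemma oplus_carrier: "s \<in> carrier \<Longrightarrow> t \<in> carrier \<Longrightarrow> s \<oplus> t \<in> carrier"
  using oplus_closed unfolding carrier_def by blast

lemma C_carrier: "t \<in> C n \<Longrightarrow> t \<in> carrier"
  by (auto simp: carrier_def)

lemma size_unique: "t \<in> C m \<Longrightarrow> t \<in> C n \<Longrightarrow> m = n"
  using C_disjoint by (auto simp: disjoint_family_on_def)

lemma lam_not_e: "s \<in> carrier \<Longrightarrow> lam s \<noteq> e"
  using e_not_indecomposable by (metis indecomposable_def)

lemma lam_oplus_not_e:
  assumes "u \<in> carrier" "v \<in> carrier" shows "lam u \<oplus> v \<noteq> e"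
proof (cases "v = e")
  case True
  then show ?thesis using assms lam_not_e oplus_e_right lam_carrier by simp
next
  case False
  then show ?thesis using assms e_not_decomposable
    unfolding decomposable_def indecomposable_def by metis
qed

lemma lam_oplus_inj:
  assumes "u \<in> carrier" "v \<in> carrier" "u' \<in> carrier" "v' \<in> carrier"
    and eq: "lam u \<oplus> v = lam u' \<oplus> v'"
  shows "u = u' \<and> v = v'"
proof -
  have i: "indecomposable (lam u)" "indecomposable (lam u')"
    using assms by (auto simp: indecomposable_def)
  have d: "v \<noteq> e \<Longrightarrow> decomposable (lam u \<oplus> v)" "v' \<noteq> e \<Longrightarrow> decomposable (lam u' \<oplus> v')"
    using assms i unfolding decomposable_def by blast+
  have "v = e \<longleftrightarrow> v' = e"
    using d i eq indecomposable_not_decomposable oplus_e_right lam_carrier assms by metis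
  then have "lam u = lam u' \<and> v = v'"
    using decomposition_unique[OF i assms(2,4)] eq oplus_e_right lam_carrier assms by metis
  then show ?thesis
    using lam_inj assms by (auto dest: inj_onD)
qed

lemma nonempty_form:
  assumes "t \<in> carrier" "t \<noteq> e"
  obtains u v where "u \<in> carrier" "v \<in> carrier" "t = lam u \<oplus> v"
proof -
  consider "indecomposable t" | "decomposable t" using three_forms assms by blast
  then show thesis
  proof cases
    case 1
    then obtain s where "s \<in> carrier" "t = lam s" by (auto simp: indecomposable_def)
    then show thesis using that[of s e] e_carrier oplus_e_right lam_carrier by simp
  next
    case 2
    then show thesis using that by (auto simp: decomposable_def indecomposable_def)
  qed
qed

lemma carrier_induct [consumes 1, case_names e lam_oplus]:
  assumes "t \<in> carrier" and "P e"
    and step: "\<And>u v. u \<in> carrier \<Longrightarrow> v \<in> carrier \<Longrightarrow> P u \<Longrightarrow> P v \<Longrightarrow> P (lam u \<oplus> v)"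
  shows "P t"
proof -
  have "\<forall>t\<in>C n. P t" for n
  proof (induction n rule: less_induct)
    case (less n)
    show ?case
    proof
      fix t assume t: "t \<in> C n"
      show "P t"
      proof (cases "t = e")
        case False
        then obtain u v where uv: "u \<in> carrier" "v \<in> carrier" "t = lam u \<oplus> v"
          using nonempty_form C_carrier[OF t] by blast
        then obtain k l where kl: "u \<in> C k" "v \<in> C l" by (auto simp: carrier_def)
        then have "t \<in> C (Suc k + l)" using uv lam_closed oplus_closed by blast
        then have "n = Suc k + l" using t size_unique by blast
        then show ?thesis using less.IH[of k] less.IH[of l] kl uv step by auto
      qed (simp add: assms)
    qed
  qed
  then show ?thesis using assms(1) by (auto simp: carrier_def)
qed

lemma finite_C: "finite (C n)"
proof (induction n rule: less_induct)
  case (less n)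
  show ?case
  proof (cases n)
    case 0
    then show ?thesis using C_0 by simp
  next
    case (Suc m)
    have "C n \<subseteq> (\<Union>k\<in>{..<n}. \<Union>l\<in>{..<n}. (\<lambda>(u, v). lam u \<oplus> v) ` (C k \<times> C l))"
    proof
      fix t assume t: "t \<in> C n"
      then have "t \<noteq> e" using C_0 size_unique[of e 0 n] Suc by auto
      then obtain u v where uv: "u \<in> carrier" "v \<in> carrier" "t = lam u \<oplus> v"
        using nonempty_form C_carrier[OF t] by blast
      then obtain k l where kl: "u \<in> C k" "v \<in> C l" by (auto simp: carrier_def)
      then have "t \<in> C (Suc k + l)" using uv lam_closed oplus_closed by blast
      then have "n = Suc k + l" using t size_unique by blast
      then show "t \<in> (\<Union>k\<in>{..<n}. \<Union>l\<in>{..<n}. (\<lambda>(u, v). lam u \<oplus> v) ` (C k \<times> C l))"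
        using kl uv by (intro UN_I[of k] UN_I[of l]) auto
    qed
    moreover have "finite (\<Union>k\<in>{..<n}. \<Union>l\<in>{..<n}. (\<lambda>(u, v). lam u \<oplus> v) ` (C k \<times> C l))"
      using less.IH by (intro finite_UN_I finite_imageI finite_cartesian_product) auto
    ultimately show ?thesis by (rule finite_subset)
  qed
qed

lemma ominus_rel_canonical:
  assumes "ominus_rel x v w" "x = lam a \<oplus> y" "a \<in> carrier" "y \<in> carrier"
  shows "if y = e then \<exists>w'. ominus_rel a v w' \<and> w = lam w'
         else \<exists>w'. ominus_rel y v w' \<and> w = lam a \<oplus> w'"
  using assms
proof (cases rule: ominus_rel.cases)
  case (ominus_rel_e)
  then show ?thesis using lam_oplus_not_e assms by metis
next
  case (ominus_rel_lam u w')
  then have "lam u \<oplus> e = lam a \<oplus> y" using assms oplus_e_right lam_carrier by simp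
  then have "u = a" "y = e"
    using lam_oplus_inj[of u e a y] ominus_rel_lam assms e_carrier by auto
  then show ?thesis using ominus_rel_lam by auto
next
  case (ominus_rel_oplus t u w')
  obtain c b where cb: "c \<in> carrier" "b \<in> carrier" "t = lam c \<oplus> b"
    using nonempty_form ominus_rel_oplus by metis
  have eq: "lam c \<oplus> (b \<oplus> u) = lam a \<oplus> y"
    using cb ominus_rel_oplus assms oplus_assoc lam_carrier by simp
  then have ca: "c = a" "y = b \<oplus> u"
    using lam_oplus_inj[of c "b \<oplus> u" a y] cb ominus_rel_oplus assms oplus_carrier by auto
  have w'_carrier: "w' \<in> carrier"
    using \<open>ominus_rel u v w'\<close>
    by (induction rule: ominus_rel.induct) (auto intro: lam_carrier oplus_carrier)
  show ?thesis
  proof (cases "b = e")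
    case True
    then have "y = u" "w = lam a \<oplus> w'" using ca cb ominus_rel_oplus oplus_e_left oplus_e_right lam_carrier
      by auto
    then show ?thesis using ominus_rel_oplus by auto
  next
    case False
    have "ominus_rel y v (b \<oplus> w')" using ca cb False ominus_rel_oplus
      by (auto intro: ominus_rel.ominus_rel_oplus)
    moreover have "w = lam a \<oplus> (b \<oplus> w')"
      using ca cb ominus_rel_oplus oplus_assoc lam_carrier w'_carrier by simp
    moreover have "y \<noteq> e"
    proof -
      obtain c' b' where "c' \<in> carrier" "b' \<in> carrier" "b = lam c' \<oplus> b'"
        using nonempty_form cb False by metis
      then show ?thesis
        using ca ominus_rel_oplus oplus_assoc lam_carrier oplus_carrier lam_oplus_not_e by metis
    qed
    ultimately show ?thesis by auto
  qed
qed

lemma ominus_rel_ex1: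
  assumes "t \<in> carrier" "v \<in> carrier" shows "\<exists>!w. ominus_rel t v w"
  using assms(1)
proof (induction rule: carrier_induct)
  case e
  have "w = v" if "ominus_rel e v w" for w
    using that
  proof (cases rule: ominus_rel.cases)
    case (ominus_rel_lam u w')
    then show ?thesis using lam_not_e by metis
  next
    case (ominus_rel_oplus t u w')
    then obtain c b where "c \<in> carrier" "b \<in> carrier" "t = lam c \<oplus> b"
      using nonempty_form by metis
    then show ?thesis
      using ominus_rel_oplus oplus_assoc lam_carrier oplus_carrier lam_oplus_not_e by metis
  qed auto
  then show ?case using assms ominus_rel_e by blast
next
  case (lam_oplus a y)
  show ?case
  proof (cases "y = e")
    case True
    obtain w where w: "ominus_rel a v w" using lam_oplus by blast
    have "ominus_rel (lam a \<oplus> y) v (lam w)"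
      using True w lam_oplus oplus_e_right lam_carrier ominus_rel_lam by simp
    moreover have "w' = lam w" if "ominus_rel (lam a \<oplus> y) v w'" for w'
      using ominus_rel_canonical[OF that refl] True w lam_oplus by auto
    ultimately show ?thesis by blast
  next
    case False
    obtain w where w: "ominus_rel y v w" using lam_oplus by blast
    have "ominus_rel (lam a \<oplus> y) v (lam a \<oplus> w)"
      using False w lam_oplus lam_carrier lam_not_e by (intro ominus_rel_oplus) auto
    moreover have "w' = lam a \<oplus> w" if "ominus_rel (lam a \<oplus> y) v w'" for w'
      using ominus_rel_canonical[OF that refl] False w lam_oplus by auto
    ultimately show ?thesis by blast
  qed
qed

lemma ominus_eq: "t \<in> carrier \<Longrightarrow> v \<in> carrier \<Longrightarrow> ominus_rel t v w \<Longrightarrow> t \<ominus> v = w"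
  unfolding ominus_def using ominus_rel_ex1 by (blast intro: the1_equality)

lemma ominus_rel_ominus: "t \<in> carrier \<Longrightarrow> v \<in> carrier \<Longrightarrow> ominus_rel t v (t \<ominus> v)"
  unfolding ominus_def by (rule theI') (rule ominus_rel_ex1)

lemma e_ominus: "v \<in> carrier \<Longrightarrow> e \<ominus> v = v"
  using ominus_eq ominus_rel_e e_carrier by simp

lemma lam_ominus: "u \<in> carrier \<Longrightarrow> v \<in> carrier \<Longrightarrow> lam u \<ominus> v = lam (u \<ominus> v)"
  using ominus_eq ominus_rel_lam ominus_rel_ominus lam_carrier by simp

lemma oplus_ominus:
  "t \<in> carrier \<Longrightarrow> u \<in> carrier \<Longrightarrow> v \<in> carrier \<Longrightarrow> t \<noteq> e \<Longrightarrow> u \<noteq> e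
    \<Longrightarrow> (t \<oplus> u) \<ominus> v = t \<oplus> (u \<ominus> v)"
  using ominus_eq ominus_rel_oplus ominus_rel_ominus oplus_carrier by simp

lemma h_rel_ex1:
  assumes "t \<in> carrier" shows "\<exists>!w. h_rel t w"
  using assms
proof (induction rule: carrier_induct)
  case e
  have "w = e" if "h_rel e w" for w
    using that by (cases rule: h_rel.cases) (auto dest: lam_oplus_not_e)
  then show ?case using h_rel_e by blast
next
  case (lam_oplus u v)
  then obtain u' v' where w: "h_rel u u'" "h_rel v v'" by blast
  have "w = v' \<ominus> gamma u'" if "h_rel (lam u \<oplus> v) w" for w
    using that
  proof (cases rule: h_rel.cases)
    case h_rel_e
    then show ?thesis using lam_oplus lam_oplus_not_e by metis
  next
    case (h_rel_lam u1 v1 u1' v1')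
    then have "u1 = u \<and> v1 = v" using lam_oplus_inj lam_oplus by metis
    then show ?thesis using h_rel_lam lam_oplus w by blast
  qed
  then show ?case using h_rel_lam[OF lam_oplus(1,2) w] by blast
qed

lemma h_e: "h e = e"
  unfolding h_def using h_rel_ex1[OF e_carrier] h_rel_e by (blast intro: the1_equality)

lemma h_lam_oplus:
  assumes "u \<in> carrier" "v \<in> carrier" shows "h (lam u \<oplus> v) = h v \<ominus> gamma (h u)"
proof -
  have r: "h_rel t (h t)" if "t \<in> carrier" for t
    unfolding h_def using h_rel_ex1[OF that] by (rule theI')
  have "h_rel (lam u \<oplus> v) (h v \<ominus> gamma (h u))" using assms r by (intro h_rel_lam)
  then show ?thesis
    using h_rel_ex1[OF oplus_carrier[OF lam_carrier]] r oplus_carrier lam_carrier assms by metis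
qed

lemma summands_carrier:
  "\<forall>u\<in>set us. indecomposable u \<Longrightarrow> foldr (\<oplus>) us e \<in> carrier"
  by (induction us) (auto simp: indecomposable_def intro: e_carrier oplus_carrier lam_carrier)

lemma summands_unique:
  assumes "\<forall>u\<in>set us. indecomposable u" "\<forall>u\<in>set vs. indecomposable u"
    and "foldr (\<oplus>) us e = foldr (\<oplus>) vs e"
  shows "us = vs"
  using assms
proof (induction us arbitrary: vs)
  case Nil
  show ?case
  proof (cases vs)
    case (Cons y ys)
    then obtain b where "b \<in> carrier" "y = lam b" using Nil by (auto simp: indecomposable_def)
    then show ?thesis using Nil Cons lam_oplus_not_e[of b] summands_carrier[of ys] by fastforce
  qed simp
next
  case (Cons x xs)
  obtain a where a: "a \<in> carrier" "x = lam a" using Cons.prems by (auto simp: indecomposable_def)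
  have xs: "foldr (\<oplus>) xs e \<in> carrier" using Cons.prems summands_carrier by simp
  show ?case
  proof (cases vs)
    case Nil
    then show ?thesis using Cons.prems a lam_oplus_not_e[OF a(1) xs] by simp
  next
    case (Cons y ys)
    obtain b where b: "b \<in> carrier" "y = lam b"
      using Cons.prems Cons by (auto simp: indecomposable_def)
    have ys: "foldr (\<oplus>) ys e \<in> carrier" using Cons.prems Cons summands_carrier by simp
    have "a = b \<and> foldr (\<oplus>) xs e = foldr (\<oplus>) ys e"
      using lam_oplus_inj[OF a(1) xs b(1) ys] a b Cons Cons.prems by simp
    then show ?thesis using Cons.IH[of ys] Cons.prems Cons a b by simp
  qed
qed

lemma num_summands_foldr:
  "\<forall>u\<in>set us. indecomposable u \<Longrightarrow> num_summands (foldr (\<oplus>) us e) = length us"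
  unfolding num_summands_def using summands_unique by (intro the_equality) blast+

end


section \<open>Dyck paths\<close>

datatype step = U | D

definition dyck_paths :: "nat \<Rightarrow> step list set" where
  "dyck_paths n = {w. count_list w U = n \<and> count_list w D = n \<and>
     (\<forall>k\<le>length w. count_list (take k w) D \<le> count_list (take k w) U)}"

definition dyck_lam :: "step list \<Rightarrow> step list" where
  "dyck_lam w = U # w @ [D]"

definition dyck_comp :: "step list \<Rightarrow> nat" where
  "dyck_comp w = card {k \<in> {1..length w}. count_list (take k w) U = count_list (take k w) D}"

definition dyck_rcomp :: "step list \<Rightarrow> nat" where
  "dyck_rcomp w = length (takeWhile (\<lambda>s. s = D) (rev w))"

definition dyck_peak :: "step list \<Rightarrow> nat" where
  "dyck_peak w = card {i. Suc i < length w \<and> w ! i = U \<and> w ! Suc i = D}"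

definition dyck_nonpeak :: "step list \<Rightarrow> nat" where
  "dyck_nonpeak w = 1 + card {i. Suc i < length w \<and> w ! i = U \<and> w ! Suc i = U}"


section \<open>Triangulations\<close>

(* A triangulation is represented by its set of edges (i, j), i < j, boundary edges included;
   it is a maximal set of pairwise non-crossing chords of the polygon.  The digon has the
   single edge (1, 2). *)

definition polygon_chords :: "nat \<Rightarrow> (nat \<times> nat) set" where
  "polygon_chords n = {(i, j). 1 \<le> i \<and> i < j \<and> j \<le> n + 2}"

definition crossing :: "nat \<times> nat \<Rightarrow> nat \<times> nat \<Rightarrow> bool" where
  "crossing = (\<lambda>(a, b) (c, d). (a < c \<and> c < b \<and> b < d) \<or> (c < a \<and> a < d \<and> d < b))"

definition noncrossing_chords :: "nat \<Rightarrow> (nat \<times> nat) set \<Rightarrow> bool" where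
  "noncrossing_chords n T \<longleftrightarrow> T \<subseteq> polygon_chords n \<and> (\<forall>x\<in>T. \<forall>y\<in>T. \<not> crossing x y)"

definition triangulations :: "nat \<Rightarrow> (nat \<times> nat) set set" where
  "triangulations n =
    {T. noncrossing_chords n T \<and> (\<forall>T'. noncrossing_chords n T' \<and> T \<subseteq> T' \<longrightarrow> T' = T)}"

definition tri_size :: "(nat \<times> nat) set \<Rightarrow> nat" where
  "tri_size T = Max (snd ` T) - 2"

definition tri_e :: "(nat \<times> nat) set" where
  "tri_e = {(1, 2)}"

definition tri_lam :: "(nat \<times> nat) set \<Rightarrow> (nat \<times> nat) set" where
  "tri_lam T = map_prod Suc Suc ` T \<union> {(1, 2), (1, tri_size T + 3)}"

definition tri_relabel :: "nat \<Rightarrow> nat \<Rightarrow> nat" where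
  "tri_relabel n1 j = (if j = 1 then 1 else n1 + j)"

definition tri_oplus :: "(nat \<times> nat) set \<Rightarrow> (nat \<times> nat) set \<Rightarrow> (nat \<times> nat) set" where
  "tri_oplus T1 T2 =
    T1 \<union> map_prod (tri_relabel (tri_size T1)) (tri_relabel (tri_size T1)) ` T2"

definition tri_degree :: "(nat \<times> nat) set \<Rightarrow> nat \<Rightarrow> nat" where
  "tri_degree T i = card {x \<in> T. fst x = i \<or> snd x = i}"

definition tri_comp :: "(nat \<times> nat) set \<Rightarrow> nat" where
  "tri_comp T = tri_degree T 1 - 1"

definition tri_rcomp :: "(nat \<times> nat) set \<Rightarrow> nat" where
  "tri_rcomp T = tri_degree T (tri_size T + 2) - 1"

definition tri_tr :: "(nat \<times> nat) set \<Rightarrow> nat" where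
  "tri_tr T = card {i \<in> {2..tri_size T + 1}. \<exists>j<i. (j, i) \<in> T \<and> (j, i + 1) \<in> T}"

definition tri_nontr :: "(nat \<times> nat) set \<Rightarrow> nat" where
  "tri_nontr T = tri_size T + 1 - tri_tr T"


section \<open>Permutations in one-line notation\<close>

definition perms :: "nat \<Rightarrow> nat list set" where
  "perms n = permutations_of_set {1..n}"

definition perms_231 :: "nat \<Rightarrow> nat list set" where
  "perms_231 n = {p \<in> perms n.
     \<not> (\<exists>i j k. i < j \<and> j < k \<and> k < length p \<and> p ! k < p ! i \<and> p ! i < p ! j)}"

definition perms_321 :: "nat \<Rightarrow> nat list set" where
  "perms_321 n = {p \<in> perms n.
     \<not> (\<exists>i j k. i < j \<and> j < k \<and> k < length p \<and> p ! k < p ! j \<and> p ! j < p ! i)}"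

definition perm_oplus :: "nat list \<Rightarrow> nat list \<Rightarrow> nat list" where
  "perm_oplus p q = p @ map (\<lambda>x. x + length p) q"

definition sum_indecomposable :: "nat list \<Rightarrow> bool" where
  "sum_indecomposable p \<longleftrightarrow> p \<in> perms (length p) \<and> p \<noteq> [] \<and>
     \<not> (\<exists>q r. q \<in> perms (length q) \<and> r \<in> perms (length r) \<and> q \<noteq> [] \<and> r \<noteq> [] \<and>
             p = perm_oplus q r)"

definition perm_comp :: "nat list \<Rightarrow> nat" where
  "perm_comp p =
    (THE k. \<exists>qs. length qs = k \<and> (\<forall>q\<in>set qs. sum_indecomposable q) \<and> foldr perm_oplus qs [] = p)"

definition is_ltr_max :: "nat list \<Rightarrow> nat \<Rightarrow> bool" where
  "is_ltr_max p i \<longleftrightarrow> (\<forall>j<i. p ! j < p ! i)"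

definition is_rtl_max :: "nat list \<Rightarrow> nat \<Rightarrow> bool" where
  "is_rtl_max p i \<longleftrightarrow> (\<forall>j. i < j \<and> j < length p \<longrightarrow> p ! j < p ! i)"

definition is_rtl_min :: "nat list \<Rightarrow> nat \<Rightarrow> bool" where
  "is_rtl_min p i \<longleftrightarrow> (\<forall>j. i < j \<and> j < length p \<longrightarrow> p ! i < p ! j)"

definition perm_rmax :: "nat list \<Rightarrow> nat" where
  "perm_rmax p = card {i. i < length p \<and> is_rtl_max p i}"

definition perm_rmin :: "nat list \<Rightarrow> nat" where
  "perm_rmin p = card {i. i < length p \<and> is_rtl_min p i}"

definition perm_nonrmin :: "nat list \<Rightarrow> nat" where
  "perm_nonrmin p = 1 + card {i. i < length p \<and> \<not> is_rtl_min p i}"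

definition perm_rcomp :: "nat list \<Rightarrow> nat" where
  "perm_rcomp p = length p - last p + 1"

definition lam_231 :: "nat list \<Rightarrow> nat list" where
  "lam_231 p = (length p + 1) # p"

(* All list positions are 0-based. *)

definition pos_of_1 :: "nat list \<Rightarrow> nat" where
  "pos_of_1 p = (THE i. i < length p \<and> p ! i = 1)"

definition boxed_positions :: "nat list \<Rightarrow> nat set" where
  "boxed_positions p =
    {j. pos_of_1 p < j \<and> j < length p \<and> is_ltr_max p j \<and> \<not> is_rtl_min p j}"

definition insert_at :: "nat \<Rightarrow> 'b \<Rightarrow> 'b list \<Rightarrow> 'b list" where
  "insert_at i x xs = take i xs @ x # drop i xs"

definition cyclic_shift_left :: "nat set \<Rightarrow> 'b list \<Rightarrow> 'b list" where
  "cyclic_shift_left B xs = (let ps = sorted_list_of_set B in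
     fold (\<lambda>(p, x) ys. ys[p := x]) (zip ps (rotate1 (map ((!) xs) ps))) xs)"

definition lam_321 :: "nat list \<Rightarrow> nat list" where
  "lam_321 p = (if p = [] then [1] else
     cyclic_shift_left (insert (pos_of_1 p) (Suc ` boxed_positions p))
       (insert_at (pos_of_1 p) (length p + 1) p))"


section \<open>Binary trees\<close>

datatype btree = Empty | Node btree btree

primrec nodes :: "btree \<Rightarrow> nat" where
  "nodes Empty = 0"
| "nodes (Node l r) = nodes l + nodes r + 1"

definition btrees :: "nat \<Rightarrow> btree set" where
  "btrees n = {t. nodes t = n}"

definition btree_lam :: "btree \<Rightarrow> btree" where
  "btree_lam t = Node t Empty"

primrec btree_oplus :: "btree \<Rightarrow> btree \<Rightarrow> btree" where
  "btree_oplus Empty b = b"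
| "btree_oplus (Node t b1) b = Node t (btree_oplus b1 b)"

primrec btree_comp :: "btree \<Rightarrow> nat" where
  "btree_comp Empty = 0"
| "btree_comp (Node l r) = 1 + btree_comp r"

(* The left subtree of the last node of the right spine. *)
primrec last_spine_left :: "btree \<Rightarrow> btree" where
  "last_spine_left Empty = Empty"
| "last_spine_left (Node l r) = (if r = Empty then l else last_spine_left r)"

definition btree_rcomp :: "btree \<Rightarrow> nat" where
  "btree_rcomp t = (LEAST k. (last_spine_left ^^ k) t = Empty)"

primrec right_edges :: "btree \<Rightarrow> nat" where
  "right_edges Empty = 0"
| "right_edges (Node l r) = right_edges l + right_edges r + (if r = Empty then 0 else 1)"

definition btree_redge :: "btree \<Rightarrow> nat" where
  "btree_redge t = 1 + right_edges t"

definition btree_ledge :: "btree \<Rightarrow> nat" where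
  "btree_ledge t = nodes t + 1 - btree_redge t"


section \<open>Standard Young tableaux with two rows of equal length\<close>

(* A tableau is the pair of its top row and its bottom row. *)

definition syts :: "nat \<Rightarrow> (nat list \<times> nat list) set" where
  "syts n = {(a, b). length a = n \<and> length b = n \<and> set a \<union> set b = {1..2 * n} \<and>
     sorted_wrt (<) a \<and> sorted_wrt (<) b \<and> (\<forall>i<n. a ! i < b ! i)}"

definition syt_lam :: "nat list \<times> nat list \<Rightarrow> nat list \<times> nat list" where
  "syt_lam = (\<lambda>(a, b). (1 # map Suc a, map Suc b @ [2 * length a + 2]))"

definition syt_oplus ::
  "nat list \<times> nat list \<Rightarrow> nat list \<times> nat list \<Rightarrow> nat list \<times> nat list" where
  "syt_oplus = (\<lambda>(a, b) (c, d).
     (a @ map (\<lambda>x. x + 2 * length a) c, b @ map (\<lambda>x. x + 2 * length a) d))"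

definition syt_comp :: "nat list \<times> nat list \<Rightarrow> nat" where
  "syt_comp = (\<lambda>(a, b).
     card {k \<in> {1..length a}. set (take k a) \<union> set (take k b) = {1..2 * k}})"

definition syt_rcomp :: "nat list \<times> nat list \<Rightarrow> nat" where
  "syt_rcomp = (\<lambda>(a, b).
     Max {k. k \<le> length b \<and> (\<forall>j<k. rev b ! j = 2 * length b - j)})"

definition syt_cons :: "nat list \<times> nat list \<Rightarrow> nat" where
  "syt_cons = (\<lambda>(a, b). 1 + card {i \<in> set a. i + 1 \<in> set a})"

definition syt_noncons :: "nat list \<times> nat list \<Rightarrow> nat" where
  "syt_noncons = (\<lambda>(a, b). card {i \<in> set a. i + 1 \<in> set b})"


section \<open>Non-crossing partitions\<close>

definition nc_partitions :: "nat \<Rightarrow> nat set set set" where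
  "nc_partitions n = {P. partition_on {1..n} P \<and>
     \<not> (\<exists>A\<in>P. \<exists>B\<in>P. A \<noteq> B \<and>
         (\<exists>a\<in>A. \<exists>b\<in>B. \<exists>c\<in>A. \<exists>d\<in>B. a < b \<and> b < c \<and> c < d))}"

definition ncp_size :: "nat set set \<Rightarrow> nat" where
  "ncp_size P = card (\<Union>P)"

definition ncp_lam :: "nat set set \<Rightarrow> nat set set" where
  "ncp_lam P = (if P = {} then {{1}}
     else (\<lambda>B. if 1 \<in> B then insert (ncp_size P + 1) B else B) ` P)"

definition ncp_oplus :: "nat set set \<Rightarrow> nat set set \<Rightarrow> nat set set" where
  "ncp_oplus P Q = P \<union> (\<lambda>B. (\<lambda>x. x + ncp_size P) ` B) ` Q"

definition ncp_comp :: "nat set set \<Rightarrow> nat" where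
  "ncp_comp = catalan_data.num_summands nc_partitions {} ncp_lam ncp_oplus"

definition ncp_flatten :: "nat set set \<Rightarrow> nat list" where
  "ncp_flatten P = concat (map (\<lambda>B. rev (sorted_list_of_set B)) (sorted_key_list_of_set Min P))"

definition ncp_rcomp :: "nat set set \<Rightarrow> nat" where
  "ncp_rcomp P = perm_rmax (ncp_flatten P)"

definition ncp_blocks :: "nat set set \<Rightarrow> nat" where
  "ncp_blocks P = card P"

definition ncp_nonmin :: "nat set set \<Rightarrow> nat" where
  "ncp_nonmin P = ncp_size P + 1 - ncp_blocks P"

end

theory Submission
  imports Defs
begin

text \<open>In every Catalan structure \<open>h\<close> exchanges \<open>\<oplus>\<close> with the opposite of \<open>\<ominus>\<close> and \<open>lam\<close> with
  \<open>gamma\<close>, so it is an involution.  The number of summands, the number of iterated last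
  summands, and the number \<open>p\<close> of occurrences of \<open>lam e\<close> (\<open>1\<close> plus the number of right edges
  of the corresponding binary tree) obey recursions in \<open>lam\<close> and \<open>\<oplus>\<close>; induction shows that
  \<open>h\<close> turns the first into the second and \<open>p\<close> into \<open>n + 1 - p\<close>.  It remains to check
  that each family is a Catalan structure and that its statistics obey these recursions.  Tableaux and
  321-avoiding permutations are embedded into Dyck paths, which makes the decomposition axioms and
  most of the recursions automatic.\<close>

section \<open>Catalan structures\<close>

text \<open>The exchange laws for \<open>h\<close> rest on the mixed law
  \<open>(t \<oplus> u) \<ominus> v = t \<oplus> (u \<ominus> v)\<close>, which is false for
  \<open>u = e\<close>; this is the source of the nonemptiness conditions everywhere. For nonempty
  \<open>u\<close> and \<open>v\<close>, \<open>u \<ominus> v\<close> replaces the \<open>e\<close>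
  at the end of the chain of last summands of \<open>u\<close> by \<open>v\<close> and so destroys
  one occurrence of \<open>lam e\<close>. Hence \<open>p\<close> is additive on
  \<open>\<oplus>\<close> but loses one on \<open>\<ominus>\<close>, and this loss is what produces
  \<open>n + 1 - p\<close>. The detour through Dyck paths is made because their factorization is
  visible as the first return to the axis, whereas for 321-avoiders the cyclic shift inside
  \<open>lam_321\<close> would have to be undone. An injective homomorphism replaces that inverse.
  Its word records the minima of the suffixes, and \<open>lam_321\<close> changes these only by an
  offset of one position. The remaining families are factored by hand: at the root of the tree, at
  the first entry of the 231-avoider, at the maximum of the block of 1, at the triangle on the side
  \<open>(1, 2)\<close>.\<close>

text \<open>Admitting \<open>v = e\<close> merges the indecomposable and the decomposable form into
  \<open>oplus (lam u) v\<close>. One cancellation hypothesis then yields exclusivity, injectivity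
  of \<open>lam\<close> and uniqueness, by putting \<open>e\<close> for \<open>v\<close> or
  \<open>v'\<close>.\<close>

lemma catalan_structureI:
  fixes C :: "nat \<Rightarrow> 'a set"
  assumes disj: "\<And>m n t. t \<in> C m \<Longrightarrow> t \<in> C n \<Longrightarrow> m = n"
    and C_0: "C 0 = {e}"
    and lam: "\<And>n s. s \<in> C n \<Longrightarrow> lam s \<in> C (Suc n)"
    and oplus: "\<And>m n s t. s \<in> C m \<Longrightarrow> t \<in> C n \<Longrightarrow> oplus s t \<in> C (m + n)"
    and assoc: "\<And>k m n s t u. s \<in> C k \<Longrightarrow> t \<in> C m \<Longrightarrow> u \<in> C n
      \<Longrightarrow> oplus (oplus s t) u = oplus s (oplus t u)"
    and e_left: "\<And>n t. t \<in> C n \<Longrightarrow> oplus e t = t"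
    and e_right: "\<And>n t. t \<in> C n \<Longrightarrow> oplus t e = t"
    and ex: "\<And>n t. t \<in> C (Suc n) \<Longrightarrow> \<exists>k l. \<exists>u\<in>C k. \<exists>v\<in>C l. t = oplus (lam u) v"
    and unique: "\<And>k l k' l' u v u' v'. u \<in> C k \<Longrightarrow> v \<in> C l \<Longrightarrow> u' \<in> C k' \<Longrightarrow> v' \<in> C l'
      \<Longrightarrow> oplus (lam u) v = oplus (lam u') v' \<Longrightarrow> u = u' \<and> v = v'"
  shows "catalan_structure C e lam oplus"
proof -
  interpret catalan_data C e lam oplus .
  have e: "e \<in> C 0" using C_0 by simp
  have carr: "t \<in> carrier \<longleftrightarrow> (\<exists>n. t \<in> C n)" for t by (auto simp: carrier_def)
  have uniq: "u = u' \<and> v = v'" if "u \<in> carrier" "v \<in> carrier" "u' \<in> carrier" "v' \<in> carrier"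
    "oplus (lam u) v = oplus (lam u') v'" for u v u' v'
    using that unique unfolding carr by blast
  have lam_oplus_e: "oplus (lam s) e = lam s" if "s \<in> carrier" for s
    using that lam e_right unfolding carr by blast
  have e_carr: "e \<in> carrier" using e carr by blast
  have lam_oplus_ne: "oplus (lam u) v \<noteq> e" if "u \<in> carrier" "v \<in> carrier" for u v
  proof -
    obtain k l where "u \<in> C k" "v \<in> C l" using \<open>u \<in> carrier\<close> \<open>v \<in> carrier\<close> carr by blast
    then have "oplus (lam u) v \<in> C (Suc k + l)" using lam oplus by blast
    then show ?thesis using disj e by fastforce
  qed
  show ?thesis
  proof unfold_locales
    show "disjoint_family C" using disj by (auto simp: disjoint_family_on_def)
    show "C 0 = {e}" by (rule C_0)
    show "t = e \<or> indecomposable t \<or> decomposable t" if "t \<in> carrier" for t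
    proof (cases "t = e")
      case False
      obtain n where n: "t \<in> C n" using \<open>t \<in> carrier\<close> by (auto simp: carr)
      have "n \<noteq> 0"
      proof
        assume "n = 0"
        then have "t \<in> C 0" using n by (simp only:)
        then show False using False unfolding C_0 by simp
      qed
      then obtain m where m: "n = Suc m" using not0_implies_Suc by auto
      have "t \<in> C (Suc m)" using n m by (simp only:)
      then obtain u v where "u \<in> carrier" "v \<in> carrier" "t = oplus (lam u) v"
        using ex[of t m] by (auto simp: carr)
      then show ?thesis
        unfolding indecomposable_def decomposable_def using lam_oplus_e by (cases "v = e") auto
    qed simp
    show "\<not> indecomposable e"
      unfolding indecomposable_def using lam_oplus_ne[OF _ e_carr] lam_oplus_e by auto
    show "\<not> decomposable e"
      unfolding decomposable_def indecomposable_def using lam_oplus_ne by blast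
    show "\<not> decomposable t" if "indecomposable t" for t
    proof
      assume "decomposable t"
      then obtain u v where uv: "u \<in> carrier" "v \<in> carrier" "v \<noteq> e" "t = oplus (lam u) v"
        unfolding decomposable_def indecomposable_def by blast
      obtain s where "s \<in> carrier" "t = lam s"
        using \<open>indecomposable t\<close> unfolding indecomposable_def by blast
      \<comment> \<open>\<open>t\<close> is both \<open>lam u \<oplus> v\<close> and
        \<open>lam s \<oplus> e\<close>, so cancellation gives \<open>v = e\<close>.\<close>
      then show False using uniq[of u v s e] uv lam_oplus_e e_carr by simp
    qed
    show "inj_on lam carrier"
    proof (rule inj_onI)
      fix s t assume "s \<in> carrier" "t \<in> carrier" "lam s = lam t"
      then show "s = t" using uniq[of s e t e] e_carr by simp
    qed
    show "u = u' \<and> v = v'" if ind: "indecomposable u" "indecomposable u'" and "v \<in> carrier" "v' \<in> carrier"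
      "v \<noteq> e" "v' \<noteq> e" "oplus u v = oplus u' v'" for u u' v v'
    proof -
      obtain a a' where a: "a \<in> carrier" "u = lam a" "a' \<in> carrier" "u' = lam a'"
        using ind unfolding indecomposable_def by blast
      then show ?thesis using uniq[of a v a' v'] that by simp
    qed
  qed (use lam oplus assoc e_left e_right in \<open>auto simp: carr\<close>)
qed

text \<open>Surjectivity of \<open>f\<close> is automatic, as its image contains \<open>e\<close> and is closed under both
  operations; the algebraic laws of the source are then inherited from the target.\<close>

lemma catalan_structure_transport:
  fixes C :: "nat \<Rightarrow> 'a set" and C' :: "nat \<Rightarrow> 'b set"
  assumes "catalan_structure C e lam oplus"
    and f: "\<And>n t. t \<in> C' n \<Longrightarrow> f t \<in> C n"
    and inj: "\<And>n. inj_on f (C' n)"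
    and e': "e' \<in> C' 0"
    and lam': "\<And>n t. t \<in> C' n \<Longrightarrow> lam' t \<in> C' (Suc n)"
    and oplus': "\<And>m n s t. s \<in> C' m \<Longrightarrow> t \<in> C' n \<Longrightarrow> oplus' s t \<in> C' (m + n)"
    and f_lam: "\<And>n t. t \<in> C' n \<Longrightarrow> f (lam' t) = lam (f t)"
    and f_oplus: "\<And>m n s t. s \<in> C' m \<Longrightarrow> t \<in> C' n \<Longrightarrow> f (oplus' s t) = oplus (f s) (f t)"
  shows "catalan_structure C' e' lam' oplus'"
proof -
  interpret catalan_structure C e lam oplus by fact
  have fc: "t \<in> C' n \<Longrightarrow> f t \<in> carrier" for t n using f C_carrier by blast
  have f_e: "f e' = e" using f[OF e'] C_0 by simp
  have surj: "\<exists>n. \<exists>s\<in>C' n. f s = t" if "t \<in> carrier" for t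
    using that
  proof (induction rule: carrier_induct)
    case e
    then show ?case using e' f_e by blast
  next
    case (lam_oplus u v)
    then obtain k l u' v' where uv: "u' \<in> C' k" "v' \<in> C' l" "f u' = u" "f v' = v" by blast
    then have "f (oplus' (lam' u') v') = oplus (lam u) v"
      using f_lam[OF uv(1)] f_oplus[OF lam'[OF uv(1)] uv(2)] by simp
    then show ?case using oplus'[OF lam'[OF uv(1)] uv(2)] by blast
  qed
  \<comment> \<open>The sizes may differ a priori: the common image lies in \<open>C m\<close> and
    in \<open>C n\<close>, which forces \<open>m = n\<close>, and only then injectivity on a single
    level applies.\<close>
  have injD: "m = n \<and> s = t" if "s \<in> C' m" "t \<in> C' n" "f s = f t" for m n s t
    using that f size_unique inj unfolding inj_on_def by metis
  show ?thesis
  proof (rule catalan_structureI)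
    show "C' 0 = {e'}" 
    proof -
      have "t = e'" if "t \<in> C' 0" for t
        using injD[OF that e'] f[OF that] f_e C_0 by simp
      then show ?thesis using e' by blast
    qed
    show "oplus' (oplus' s t) u = oplus' s (oplus' t u)"
      if "s \<in> C' k" "t \<in> C' m" "u \<in> C' n" for k m n s t u
    proof (rule injD[THEN conjunct2])
      show "oplus' (oplus' s t) u \<in> C' (k + m + n)" "oplus' s (oplus' t u) \<in> C' (k + (m + n))"
        using that oplus' by blast+
      show "f (oplus' (oplus' s t) u) = f (oplus' s (oplus' t u))"
        using that by (simp add: oplus' f_oplus[where m = "k + m" and n = n] f_oplus[where m = k and n = "m + n"]
            f_oplus[where m = m and n = n] f_oplus[where m = k and n = m] oplus_assoc fc)
    qed
    show "oplus' e' t = t" if "t \<in> C' n" for n t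
    proof (rule injD[THEN conjunct2])
      show "oplus' e' t \<in> C' (0 + n)" "t \<in> C' n" using that oplus' e' by blast+
      show "f (oplus' e' t) = f t" using f_oplus[OF e' that] f_e oplus_e_left fc[OF that] by simp
    qed
    show "oplus' t e' = t" if "t \<in> C' n" for n t
    proof (rule injD[THEN conjunct2])
      show "oplus' t e' \<in> C' (n + 0)" "t \<in> C' n" using that oplus' e' by blast+
      show "f (oplus' t e') = f t" using f_oplus[OF that e'] f_e oplus_e_right fc[OF that] by simp
    qed
    show "\<exists>k l. \<exists>u\<in>C' k. \<exists>v\<in>C' l. t = oplus' (lam' u) v" if t: "t \<in> C' (Suc n)" for n t
    proof -
      have "f t \<noteq> e" using f[OF t] C_0 size_unique[of e 0 "Suc n"] by auto
      \<comment> \<open>The factors are found in the target and pulled back along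
        \<open>surj\<close>; injectivity carries the factorization of \<open>f t\<close> over to
        \<open>t\<close>.\<close>
      then obtain u v where "u \<in> carrier" "v \<in> carrier" "f t = oplus (lam u) v"
        using nonempty_form fc t by metis
      moreover from this obtain k l u' v' where uv: "u' \<in> C' k" "v' \<in> C' l" "f u' = u" "f v' = v"
        using surj by metis
      ultimately have "f t = f (oplus' (lam' u') v')"
        using lam' f_lam[OF uv(1)] f_oplus[OF lam'[OF uv(1)] uv(2)] by simp
      then have "t = oplus' (lam' u') v'"
        using injD[OF t oplus'[OF lam'[OF uv(1)] uv(2)]] by blast
      then show ?thesis using uv by blast
    qed
    show "u = u' \<and> v = v'" if "u \<in> C' k" "v \<in> C' l" "u' \<in> C' k'" "v' \<in> C' l'"
      "oplus' (lam' u) v = oplus' (lam' u') v'" for k l k' l' u v u' v'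
    proof -
      have "oplus (lam (f u)) (f v) = oplus (lam (f u')) (f v')"
        using f_lam[OF that(1)] f_oplus[OF lam'[OF that(1)] that(2)]
          f_lam[OF that(3)] f_oplus[OF lam'[OF that(3)] that(4)] that(5) by simp
      then have "f u = f u' \<and> f v = f v'" using that fc lam_oplus_inj by blast
      then show ?thesis using injD that by blast
    qed
  qed (use injD lam' oplus' in blast)+
qed

context catalan_structure
begin

text \<open>The clause of \<open>\<ominus>\<close> for sums demands nonempty factors, so the case
  \<open>v = e\<close> of \<open>lam u \<oplus> v\<close> is split off here.\<close>

lemma carrier_cases_lam [consumes 1, case_names e lam oplus]:
  assumes "t \<in> carrier"
  obtains "t = e" | u where "u \<in> carrier" "t = lam u"
    | u v where "u \<in> carrier" "v \<in> carrier" "v \<noteq> e" "t = lam u \<oplus> v"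
  using assms nonempty_form oplus_e_right lam_carrier by metis

lemma carrier_induct_lam [consumes 1, case_names e lam oplus]:
  assumes "t \<in> carrier" and "P e"
    and "\<And>u. u \<in> carrier \<Longrightarrow> P u \<Longrightarrow> P (lam u)"
    and "\<And>u v. u \<in> carrier \<Longrightarrow> v \<in> carrier \<Longrightarrow> v \<noteq> e \<Longrightarrow> P u \<Longrightarrow> P v \<Longrightarrow> P (lam u \<oplus> v)"
  shows "P t"
  using assms(1)
proof (induction rule: carrier_induct)
  case (lam_oplus u v)
  then show ?case using assms oplus_e_right lam_carrier by (cases "v = e") auto
qed (rule assms(2))

section \<open>Algebra of the operation \<open>\<ominus>\<close>\<close>

lemma lam_oplus_ominus:
  "u \<in> carrier \<Longrightarrow> v \<in> carrier \<Longrightarrow> w \<in> carrier \<Longrightarrow> v \<noteq> e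
    \<Longrightarrow> (lam u \<oplus> v) \<ominus> w = lam u \<oplus> (v \<ominus> w)"
  using oplus_ominus lam_carrier lam_not_e by blast

lemma ominus_closed:
  assumes "u \<in> carrier" "u \<in> C m" "v \<in> C n" shows "u \<ominus> v \<in> C (m + n)"
  using assms(1,2)
proof (induction arbitrary: m rule: carrier_induct_lam)
  case e
  then show ?case using assms(3) e_ominus C_carrier C_0 size_unique[of e 0 m] by auto
next
  case (lam u)
  obtain k where k: "u \<in> C k" using lam by (auto simp: carrier_def)
  then have "m = Suc k" using lam.prems lam_closed size_unique by blast
  moreover have "lam (u \<ominus> v) \<in> C (Suc (k + n))" using k lam.IH lam_closed by blast
  ultimately show ?case using lam_ominus[OF lam.hyps C_carrier[OF assms(3)]] by simp
next
  case (oplus u v')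
  obtain k l where kl: "u \<in> C k" "v' \<in> C l" using oplus by (auto simp: carrier_def)
  then have "m = Suc k + l"
    using oplus.prems size_unique oplus_closed[OF lam_closed] by blast
  moreover have "lam u \<oplus> (v' \<ominus> v) \<in> C (Suc k + (l + n))"
    using kl oplus.IH lam_closed oplus_closed by blast
  ultimately show ?case
    using lam_oplus_ominus[OF oplus.hyps(1,2) C_carrier[OF assms(3)]] oplus.hyps
    by (simp add: add.assoc)
qed

lemma ominus_carrier: "u \<in> carrier \<Longrightarrow> v \<in> carrier \<Longrightarrow> u \<ominus> v \<in> carrier"
  using ominus_closed unfolding carrier_def by blast

lemma ominus_eq_e_iff:
  assumes "u \<in> carrier" "v \<in> carrier" shows "u \<ominus> v = e \<longleftrightarrow> u = e \<and> v = e"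
  using assms(1)
  by (cases rule: carrier_cases_lam)
    (use assms(2) in \<open>auto simp: e_ominus lam_ominus lam_oplus_ominus lam_not_e lam_oplus_not_e
      ominus_carrier\<close>)

lemma oplus_eq_e_iff:
  assumes "u \<in> carrier" "v \<in> carrier" shows "u \<oplus> v = e \<longleftrightarrow> u = e \<and> v = e"
  using assms(1)
  by (cases rule: carrier_cases_lam)
    (use assms(2) in \<open>auto simp: oplus_e_left lam_not_e lam_oplus_not_e oplus_assoc lam_carrier
      oplus_carrier\<close>)

lemma ominus_e: "u \<in> carrier \<Longrightarrow> u \<ominus> e = u"
  by (induction rule: carrier_induct_lam)
    (auto simp: e_ominus lam_ominus lam_oplus_ominus e_carrier)

text \<open>\<open>u \<ominus> v\<close> follows last summands and enters each \<open>lam\<close>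
  until it meets \<open>e\<close>, which it replaces by \<open>v\<close>; grafting at the end of
  this chain is associative.\<close>

lemma ominus_assoc:
  assumes "u \<in> carrier" "v \<in> carrier" "w \<in> carrier"
  shows "(u \<ominus> v) \<ominus> w = u \<ominus> (v \<ominus> w)"
  using assms(1)
  by (induction rule: carrier_induct_lam)
    (use assms(2,3) in \<open>auto simp: e_ominus lam_ominus lam_oplus_ominus ominus_carrier
      ominus_eq_e_iff\<close>)

section \<open>The map \<open>h\<close> as an involution\<close>

lemma gamma_closed: "t \<in> C n \<Longrightarrow> gamma t \<in> C (Suc n)"
  unfolding gamma_def using oplus_closed[of t n "lam e" 1] lam_closed[of e 0] C_0 by auto

lemma gamma_carrier: "t \<in> carrier \<Longrightarrow> gamma t \<in> carrier"
  unfolding gamma_def using oplus_carrier lam_carrier e_carrier by blast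

lemma gamma_not_e: "t \<in> carrier \<Longrightarrow> gamma t \<noteq> e"
  unfolding gamma_def using oplus_eq_e_iff lam_carrier e_carrier lam_not_e by blast

lemma h_closed:
  assumes "t \<in> C n" shows "h t \<in> C n"
  using C_carrier[OF assms] assms
proof (induction arbitrary: n rule: carrier_induct)
  case e
  then show ?case using h_e by simp
next
  case (lam_oplus u v)
  obtain k l where kl: "u \<in> C k" "v \<in> C l" using lam_oplus by (auto simp: carrier_def)
  then have "lam u \<oplus> v \<in> C (Suc k + l)" using lam_closed oplus_closed by blast
  then have "n = l + Suc k" using lam_oplus.prems size_unique by fastforce
  moreover have "h v \<ominus> gamma (h u) \<in> C (l + Suc k)"
    using kl lam_oplus.IH gamma_closed ominus_closed C_carrier by blast
  ultimately show ?case using lam_oplus.hyps h_lam_oplus by simp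
qed

lemma h_carrier: "t \<in> carrier \<Longrightarrow> h t \<in> carrier"
  using h_closed unfolding carrier_def by blast

lemma h_lam: "u \<in> carrier \<Longrightarrow> h (lam u) = gamma (h u)"
  using h_lam_oplus[of u e] oplus_e_right e_carrier lam_carrier h_e e_ominus gamma_carrier
    h_carrier by simp

lemma h_eq_e_iff:
  assumes "t \<in> carrier" shows "h t = e \<longleftrightarrow> t = e"
proof -
  obtain n where n: "t \<in> C n" using assms by (auto simp: carrier_def)
  show ?thesis using n h_closed[OF n] h_e C_0 size_unique by (metis singletonD insertI1)
qed

text \<open>The recursion of \<open>h\<close> removes the first summand and puts its image last;
  associativity of \<open>\<ominus>\<close> extends this from one summand to any left
  factor.\<close>

lemma h_oplus:
  assumes "t \<in> carrier" "v \<in> carrier" shows "h (t \<oplus> v) = h v \<ominus> h t"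
  using assms(1)
proof (induction rule: carrier_induct)
  case e
  then show ?case using assms oplus_e_left h_e ominus_e h_carrier by simp
next
  case (lam_oplus u w)
  then show ?case
    using assms oplus_assoc lam_carrier oplus_carrier h_lam_oplus h_carrier gamma_carrier
      ominus_assoc by simp
qed

lemma h_gamma: "t \<in> carrier \<Longrightarrow> h (gamma t) = lam (h t)"
  unfolding gamma_def
  using h_oplus lam_carrier e_carrier h_lam h_e h_carrier lam_ominus e_ominus oplus_e_left
  by (simp add: gamma_def)

text \<open>The dual of \<open>h_oplus\<close>. For \<open>lam a\<close> it is associativity of
  \<open>\<oplus>\<close> inside \<open>gamma\<close>; for sums it is the mixed law.\<close>

lemma h_ominus:
  assumes "u \<in> carrier" "v \<in> carrier" shows "h (u \<ominus> v) = h v \<oplus> h u"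
  using assms(1)
proof (induction rule: carrier_induct_lam)
  case e
  then show ?case using assms e_ominus h_e h_carrier oplus_e_right by simp
next
  case (lam a)
  then show ?case
    using assms lam_ominus ominus_carrier h_lam h_carrier oplus_assoc lam_carrier e_carrier
    by (simp add: gamma_def)
next
  case (oplus a y)
  have "h ((lam a \<oplus> y) \<ominus> v) = (h v \<oplus> h y) \<ominus> gamma (h a)"
    using oplus assms lam_oplus_ominus h_lam_oplus ominus_carrier by simp
  \<comment> \<open>The mixed law needs both summands nonempty: \<open>h y\<close> is, because
    \<open>y\<close> is, while for \<open>h v = e\<close> both sides reduce to the same
    term.\<close>
  also have "\<dots> = h v \<oplus> (h y \<ominus> gamma (h a))"
    using oplus assms oplus_ominus[of "h v" "h y" "gamma (h a)"]
    by (cases "h v = e") (simp_all add: h_carrier gamma_carrier h_eq_e_iff h_e oplus_e_left ominus_carrier)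
  finally show ?case using oplus h_lam_oplus by simp
qed

text \<open>\<open>h (h v \<ominus> gamma (h u))\<close> equals
  \<open>h (gamma (h u)) \<oplus> h (h v)\<close>, and \<open>h\<close> turns the
  \<open>gamma\<close> back into \<open>lam\<close>.\<close>

lemma h_h: "t \<in> carrier \<Longrightarrow> h (h t) = t"
  by (induction rule: carrier_induct)
    (simp_all add: h_e h_lam_oplus h_ominus h_gamma h_carrier gamma_carrier)

text \<open>The value of \<open>p\<close> at \<open>e\<close> is left open: it is \<open>0\<close> or \<open>1\<close> depending on the family.\<close>

lemma h_sendsI:
  fixes comp rcomp p q :: "'a \<Rightarrow> nat"
  assumes n: "n \<ge> 1"
    and comp_lam: "\<And>u. u \<in> carrier \<Longrightarrow> comp (lam u) = 1"
    and comp_oplus: "\<And>u v. u \<in> carrier \<Longrightarrow> v \<in> carrier \<Longrightarrow> v \<noteq> e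
      \<Longrightarrow> comp (lam u \<oplus> v) = Suc (comp v)"
    and rcomp_lam_e: "rcomp (lam e) = 1"
    and rcomp_lam: "\<And>u. u \<in> carrier \<Longrightarrow> u \<noteq> e \<Longrightarrow> rcomp (lam u) = Suc (rcomp u)"
    and rcomp_oplus: "\<And>t u. t \<in> carrier \<Longrightarrow> u \<in> carrier \<Longrightarrow> t \<noteq> e \<Longrightarrow> u \<noteq> e
      \<Longrightarrow> rcomp (t \<oplus> u) = rcomp u"
    and p_lam_e: "p (lam e) = 1"
    and p_lam: "\<And>u. u \<in> carrier \<Longrightarrow> u \<noteq> e \<Longrightarrow> p (lam u) = p u"
    and p_oplus: "\<And>t u. t \<in> carrier \<Longrightarrow> u \<in> carrier \<Longrightarrow> t \<noteq> e \<Longrightarrow> u \<noteq> e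
      \<Longrightarrow> p (t \<oplus> u) = p t + p u"
    and q: "\<And>t. t \<in> C n \<Longrightarrow> q t = n + 1 - p t"
  shows "h_sends n (comp, p) (rcomp, q)"
proof -
  have rcomp_gamma: "rcomp (gamma t) = 1" if "t \<in> carrier" for t
    using that rcomp_oplus[of t "lam e"] rcomp_lam_e
    by (cases "t = e") (simp_all add: gamma_def oplus_e_left e_carrier lam_carrier lam_not_e)
  \<comment> \<open>\<open>rcomp\<close> counts the occurrences of \<open>lam\<close> entered along
    the chain of last summands, and grafting concatenates the chains of \<open>u\<close> and
    \<open>v\<close>.\<close>
  have rcomp_ominus: "rcomp (u \<ominus> v) = rcomp u + rcomp v"
    if "u \<in> carrier" "v \<in> carrier" "u \<noteq> e" "v \<noteq> e" for u v
    using that(1,3)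
  proof (induction rule: carrier_induct_lam)
    case (lam a)
    have "rcomp (lam (a \<ominus> v)) = Suc (rcomp (a \<ominus> v))"
      using lam that by (intro rcomp_lam) (simp_all add: ominus_carrier ominus_eq_e_iff)
    then show ?case
      using lam that rcomp_lam[of a] rcomp_lam_e by (cases "a = e") (simp_all add: lam_ominus e_ominus)
  next
    case (oplus a y)
    have "rcomp (lam a \<oplus> (y \<ominus> v)) = rcomp (y \<ominus> v)"
      using oplus that
      by (intro rcomp_oplus) (simp_all add: ominus_carrier ominus_eq_e_iff lam_carrier lam_not_e)
    then show ?case
      using oplus that rcomp_oplus[of "lam a" y]
      by (simp add: lam_oplus_ominus lam_carrier lam_not_e)
  qed simp
  have rcomp_h: "rcomp (h t) = comp t" if "t \<in> carrier" "t \<noteq> e" for t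
    using that
  proof (induction rule: carrier_induct_lam)
    case (lam u)
    then show ?case using h_lam h_carrier rcomp_gamma comp_lam by simp
  next
    case (oplus u v)
    then show ?case
      using h_lam_oplus h_carrier gamma_carrier gamma_not_e rcomp_gamma rcomp_ominus h_eq_e_iff
        comp_oplus by simp
  qed simp
  \<comment> \<open>Since \<open>p e\<close> is left open, the contribution of \<open>t\<close> is
    guarded by the test \<open>t = e\<close>.\<close>
  have p_gamma: "p (gamma t) = Suc (if t = e then 0 else p t)" if "t \<in> carrier" for t
    using that p_oplus[of t "lam e"] p_lam_e
    by (simp add: gamma_def oplus_e_left e_carrier lam_carrier lam_not_e)
  \<comment> \<open>The chain of \<open>u\<close> ends in an occurrence of \<open>lam e\<close>,
    which the graft of a nonempty \<open>v\<close> destroys.\<close>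
  have p_ominus: "Suc (p (u \<ominus> v)) = p u + p v"
    if "u \<in> carrier" "v \<in> carrier" "u \<noteq> e" "v \<noteq> e" for u v
    using that(1,3)
  proof (induction rule: carrier_induct_lam)
    case (lam a)
    have "p (lam (a \<ominus> v)) = p (a \<ominus> v)"
      using lam that by (intro p_lam) (simp_all add: ominus_carrier ominus_eq_e_iff)
    then show ?case
      using lam that p_lam[of a] p_lam_e by (cases "a = e") (simp_all add: lam_ominus e_ominus)
  next
    case (oplus a y)
    have "p (lam a \<oplus> (y \<ominus> v)) = p (lam a) + p (y \<ominus> v)"
      using oplus that
      by (intro p_oplus) (simp_all add: ominus_carrier ominus_eq_e_iff lam_carrier lam_not_e)
    then show ?case
      using oplus that p_oplus[of "lam a" y]
      by (simp add: lam_oplus_ominus lam_carrier lam_not_e)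
  qed simp
  \<comment> \<open>For \<open>lam u \<oplus> v\<close> with nonempty factors of sizes
    \<open>k\<close> and \<open>l\<close> the hypotheses give \<open>k + 1\<close> and
    \<open>l + 1\<close>; \<open>gamma\<close> adds one and \<open>\<ominus>\<close> takes one away,
    which leaves \<open>k + l + 2\<close>, where \<open>m = k + l + 1\<close>. For
    \<open>u = e\<close> the occurrence \<open>lam e\<close> itself supplies the missing
    one.\<close>
  have p_h: "p (h t) + p t = m + 1" if "t \<in> carrier" "t \<noteq> e" "t \<in> C m" for t m
    using that
  proof (induction arbitrary: m rule: carrier_induct_lam)
    case (lam u)
    obtain k where k: "u \<in> C k" using lam by (auto simp: carrier_def)
    then have m: "m = Suc k" using lam.prems lam_closed size_unique by blast
    have "u = e \<Longrightarrow> k = 0" using k C_0 size_unique[of e 0 k] by auto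
    then show ?case
      using lam.IH[of k] lam.hyps k m h_lam h_carrier p_gamma h_eq_e_iff h_e e_carrier p_lam p_lam_e
      by (cases "u = e") auto
  next
    case (oplus u v)
    obtain k l where kl: "u \<in> C k" "v \<in> C l" using oplus by (auto simp: carrier_def)
    then have m: "m = Suc k + l" using oplus.prems lam_closed oplus_closed size_unique by blast
    have k0: "u = e \<Longrightarrow> k = 0" using kl C_0 size_unique[of e 0 k] by auto
    have 1: "Suc (p (h (lam u \<oplus> v))) = p (h v) + p (gamma (h u))"
      using oplus.hyps h_lam_oplus p_ominus h_carrier gamma_carrier gamma_not_e h_eq_e_iff by simp
    have 2: "p (lam u \<oplus> v) = p (lam u) + p v"
      using oplus.hyps p_oplus lam_carrier lam_not_e by simp
    show ?case
      using 1 2 oplus.IH(1)[of k] oplus.IH(2)[of l] oplus.hyps kl m k0 p_gamma[of "h u"] h_carrier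
        h_eq_e_iff[of u] p_lam p_lam_e
      by (cases "u = e") auto
  qed simp
  have pair: "h t \<in> C n" "h (h t) = t" "rcomp (h t) = comp t" "q (h t) = p t" if "t \<in> C n" for t
  proof -
    have t: "t \<in> carrier" "t \<noteq> e" using that C_carrier C_0 n size_unique[of t 0 n] by auto
    show "h t \<in> C n" "h (h t) = t" using that t h_closed h_h by auto
    show "rcomp (h t) = comp t" using t rcomp_h by blast
    show "q (h t) = p t" using p_h[OF t that] q[OF h_closed[OF that]] by simp
  qed
  \<comment> \<open>The identities applied to \<open>h t\<close> read
    \<open>rcomp t = comp (h t)\<close> and \<open>q t = p (h t)\<close>, so \<open>h\<close> serves
    as its own inverse here.\<close>
  have "bij_betw h {t \<in> C n. comp t = i \<and> p t = j} {t \<in> C n. rcomp t = i \<and> q t = j}" for i j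
    by (rule bij_betw_byWitness[where f' = h]) (use pair in \<open>auto, metis+\<close>)
  then show ?thesis
    unfolding h_sends_def using pair by (auto dest: bij_betw_same_card)
qed

end

section \<open>Binary trees\<close>

lemma nodes_btree_oplus: "nodes (btree_oplus s t) = nodes s + nodes t"
  by (induction s) auto

lemma btree_oplus_assoc: "btree_oplus (btree_oplus s t) u = btree_oplus s (btree_oplus t u)"
  by (induction s) auto

lemma btree_oplus_Empty: "btree_oplus t Empty = t"
  by (induction t) auto

lemma btree_catalan: "catalan_structure btrees Empty btree_lam btree_oplus"
proof (rule catalan_structureI)
  show "btrees 0 = {Empty}"
  proof -
    have "nodes t = 0 \<longleftrightarrow> t = Empty" for t by (cases t) auto
    then show ?thesis by (auto simp: btrees_def)
  qed
  show "\<exists>k l. \<exists>u\<in>btrees k. \<exists>v\<in>btrees l. t = btree_oplus (btree_lam u) v"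
    if "t \<in> btrees (Suc n)" for n t
    using that by (cases t) (auto simp: btrees_def btree_lam_def)
qed (auto simp: btrees_def btree_lam_def nodes_btree_oplus btree_oplus_assoc btree_oplus_Empty)

lemma nodes_last_spine_left: "t \<noteq> Empty \<Longrightarrow> nodes (last_spine_left t) < nodes t"
  by (induction t) (auto simp: less_Suc_eq trans_less_add2)

lemma last_spine_left_terminates: "\<exists>k. (last_spine_left ^^ k) t = Empty"
proof (induction t rule: measure_induct_rule[where f = nodes])
  case (less t)
  show ?case
  proof (cases "t = Empty")
    case True
    then show ?thesis by (intro exI[of _ 0]) simp
  next
    case False
    then obtain k where "(last_spine_left ^^ k) (last_spine_left t) = Empty"
      using less nodes_last_spine_left by blast
    then show ?thesis by (intro exI[of _ "Suc k"]) (simp add: funpow_swap1)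
  qed
qed

lemma btree_rcomp_Empty: "btree_rcomp Empty = 0"
  unfolding btree_rcomp_def by (rule Least_equality) auto

text \<open>The iteration terminates because the left subtree has fewer nodes, and zero steps do not
  suffice for a nonempty tree, so the least number shifts by one.\<close>

lemma btree_rcomp_rec:
  assumes "t \<noteq> Empty" shows "btree_rcomp t = Suc (btree_rcomp (last_spine_left t))"
proof -
  obtain k where "(last_spine_left ^^ k) t = Empty" using last_spine_left_terminates by blast
  then show ?thesis unfolding btree_rcomp_def
    using Least_Suc[of "\<lambda>k. (last_spine_left ^^ k) t = Empty" k] assms
    by (simp add: funpow_swap1)
qed

lemma btree_oplus_eq_Empty_iff: "btree_oplus s t = Empty \<longleftrightarrow> s = Empty \<and> t = Empty"
  by (cases s) auto

lemma last_spine_left_oplus: "t \<noteq> Empty \<Longrightarrow> last_spine_left (btree_oplus s t) = last_spine_left t"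
  by (induction s) (auto simp: btree_oplus_eq_Empty_iff)

text \<open>The extra edge joins the last spine node of \<open>s\<close> to the root of
  \<open>t\<close>; the \<open>1 +\<close> in \<open>btree_redge\<close> absorbs it and makes that
  statistic additive.\<close>

lemma right_edges_oplus:
  "s \<noteq> Empty \<Longrightarrow> t \<noteq> Empty \<Longrightarrow> right_edges (btree_oplus s t) = right_edges s + right_edges t + 1"
proof (induction s)
  case (Node l r)
  then show ?case by (cases "r = Empty") (simp_all add: btree_oplus_eq_Empty_iff)
qed simp

lemma btree_h_sends:
  assumes "n \<ge> 1"
  shows "catalan_data.h_sends btrees Empty btree_lam btree_oplus n
    (btree_comp, btree_redge) (btree_rcomp, btree_ledge)"
proof -
  interpret catalan_structure btrees Empty btree_lam btree_oplus by (rule btree_catalan)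
  show ?thesis
    by (rule h_sendsI[OF assms])
      (auto simp: btree_lam_def btree_rcomp_rec btree_rcomp_Empty last_spine_left_oplus
        btree_oplus_eq_Empty_iff btree_redge_def right_edges_oplus btree_ledge_def btrees_def)
qed

section \<open>Dyck paths\<close>

lemma card_less_Suc_split:
  "card {i. i < Suc n \<and> Q i} = (if Q 0 then 1 else 0) + card {i. i < n \<and> Q (Suc i)}"
proof -
  have "{i. i < Suc n \<and> Q i} = (if Q 0 then {0} else {}) \<union> Suc ` {i. i < n \<and> Q (Suc i)}"
    by (auto simp: image_iff less_Suc_eq_0_disj)
  then show ?thesis by (simp add: card_Un_disjoint card_image)
qed

definition height :: "step list \<Rightarrow> int" where
  "height w = int (count_list w U) - int (count_list w D)"

lemma height_simps [simp]:
  "height [] = 0" "height (U # w) = height w + 1" "height (D # w) = height w - 1"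
  "height (v @ w) = height v + height w"
  by (simp_all add: height_def)

text \<open>Prefixes become splittings \<open>x @ y\<close> and heights become integers, which suits
  concatenation and avoids truncated subtraction.\<close>

lemma dyck_paths_iff:
  "w \<in> dyck_paths n \<longleftrightarrow>
    count_list w U = n \<and> height w = 0 \<and> (\<forall>x y. w = x @ y \<longrightarrow> height x \<ge> 0)"
proof -
  have "(\<forall>k\<le>length w. count_list (take k w) D \<le> count_list (take k w) U) \<longleftrightarrow>
      (\<forall>k\<le>length w. height (take k w) \<ge> 0)"
    by (simp add: height_def)
  also have "\<dots> \<longleftrightarrow> (\<forall>x y. w = x @ y \<longrightarrow> height x \<ge> 0)"
  proof safe
    fix x y assume *: "\<forall>k\<le>length (x @ y). height (take k (x @ y)) \<ge> 0"
    show "height x \<ge> 0" using *[rule_format, of "length x"] by simp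
  next
    fix k assume *: "\<forall>x y. w = x @ y \<longrightarrow> height x \<ge> 0"
    show "height (take k w) \<ge> 0" using *[rule_format, of "take k w" "drop k w"] by simp
  qed
  finally show ?thesis unfolding dyck_paths_def by (auto simp: height_def)
qed

lemma dyck_prefix: "w \<in> dyck_paths n \<Longrightarrow> w = x @ y \<Longrightarrow> height x \<ge> 0"
  by (simp add: dyck_paths_iff)

lemma dyck_hd:
  assumes "w \<in> dyck_paths n" "w \<noteq> []" shows "hd w = U"
proof (cases w)
  case (Cons s w')
  then show ?thesis using dyck_prefix[OF assms(1), of "[s]" w'] by (cases s) auto
qed (use assms in simp)

lemma dyck_last:
  assumes "w \<in> dyck_paths n" "w \<noteq> []" shows "last w = D"
proof -
  have "height (butlast w) \<ge> 0" "height (butlast w) + height [last w] = 0"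
    using assms append_butlast_last_id[of w] dyck_prefix[OF assms(1), of "butlast w" "[last w]"]
      height_simps(4)[of "butlast w" "[last w]"] by (auto simp: dyck_paths_iff)
  then show ?thesis by (cases "last w") auto
qed

text \<open>The shortest prefix of negative height must end in a \<open>D\<close> taken at height 0,
  since heights change by one; what precedes that \<open>D\<close> never goes below the
  axis.\<close>

lemma first_negative_prefix:
  assumes "w = x @ y" "height x < 0"
  shows "\<exists>u v. w = u @ D # v \<and> height u = 0 \<and> (\<forall>x y. u = x @ y \<longrightarrow> height x \<ge> 0)"
  using assms
proof (induction w arbitrary: x y rule: rev_induct)
  case (snoc s w)
  show ?case
  proof (cases "\<forall>x y. w = x @ y \<longrightarrow> height x \<ge> 0")
    case True
    have "y = []"
    proof (rule ccontr)
      assume "y \<noteq> []"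
      then have "w = x @ butlast y" using snoc.prems(1) by (metis butlast_append butlast_snoc)
      then show False using True snoc.prems(2) by force
    qed
    then have "height w + height [s] < 0" using snoc.prems by (metis append_Nil2 height_simps(4))
    moreover have "height w \<ge> 0" using True by simp
    ultimately have "s = D" "height w = 0" by (cases s; simp)+
    then show ?thesis using True by blast
  next
    case False
    then obtain x' y' where "w = x' @ y'" "height x' < 0" using not_le by blast
    then obtain u v where "w = u @ D # v" "height u = 0" "\<forall>x y. u = x @ y \<longrightarrow> height x \<ge> 0"
      using snoc.IH by blast
    then show ?thesis by (intro exI[of _ u] exI[of _ "v @ [s]"]) auto
  qed
qed simp

lemma dyck_catalan: "catalan_structure dyck_paths [] dyck_lam (@)"
proof (rule catalan_structureI)
  show "m = n" if "w \<in> dyck_paths m" "w \<in> dyck_paths n" for m n w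
    using that by (simp add: dyck_paths_iff)
  show "dyck_paths 0 = {[]}"
  proof -
    have "w = []" if "w \<in> dyck_paths 0" for w
      using that dyck_hd[of w 0] by (cases w) (auto simp: dyck_paths_iff)
    moreover have "[] \<in> dyck_paths 0" by (simp add: dyck_paths_iff)
    ultimately show ?thesis by blast
  qed
  show "dyck_lam w \<in> dyck_paths (Suc n)" if "w \<in> dyck_paths n" for w n
    unfolding dyck_paths_iff dyck_lam_def
  proof (intro conjI allI impI)
    fix x y assume eq: "U # w @ [D] = x @ y"
    show "height x \<ge> 0"
    proof (cases "x = [] \<or> y = []")
      case True
      then show ?thesis using eq that by (auto simp: dyck_paths_iff)
    next
      case False
      then obtain x' where x': "x = U # x'" using eq by (cases x) auto
      moreover have "w = x' @ butlast y"
        using eq x' False by (metis append_Cons butlast_append butlast_snoc list.inject)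
      ultimately show ?thesis using dyck_prefix[OF that] by fastforce
    qed
  qed (use that in \<open>auto simp: dyck_paths_iff\<close>)
  show "v @ w \<in> dyck_paths (m + n)" if "v \<in> dyck_paths m" "w \<in> dyck_paths n" for v w m n
    using that unfolding dyck_paths_iff by (auto simp: append_eq_append_conv2)
  show "\<exists>k l. \<exists>u\<in>dyck_paths k. \<exists>v\<in>dyck_paths l. w = dyck_lam u @ v"
    if w: "w \<in> dyck_paths (Suc n)" for n w
  proof -
    have "w \<noteq> []" using w by (auto simp: dyck_paths_iff)
    then obtain w' where w': "w = U # w'" using dyck_hd[OF w] by (cases w) auto
    then have "height w' < 0" using w by (auto simp: dyck_paths_iff)
    \<comment> \<open>Once the initial \<open>U\<close> is removed, the first descent below the axis
      is the \<open>D\<close> that matches this \<open>U\<close>: the first return of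
      \<open>w\<close>.\<close>
    then obtain u v where uv: "w' = u @ D # v" "height u = 0" "\<forall>x y. u = x @ y \<longrightarrow> height x \<ge> 0"
      using first_negative_prefix[of w' w' "[]"] by auto
    have "height x \<ge> 0" if "v = x @ y" for x y
      using dyck_prefix[OF w, of "U # u @ D # x" y] uv w' that by simp
    moreover have "height v = 0" using w w' uv by (auto simp: dyck_paths_iff)
    ultimately have "u \<in> dyck_paths (count_list u U)" "v \<in> dyck_paths (count_list v U)"
      using uv by (auto simp: dyck_paths_iff)
    then show ?thesis using w' uv by (auto simp: dyck_lam_def)
  qed
  show "u = u' \<and> v = v'"
    if dy: "u \<in> dyck_paths k" "u' \<in> dyck_paths k'" and "dyck_lam u @ v = dyck_lam u' @ v'"
    for k k' u v u' v'
  proof -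
    \<comment> \<open>If the inner paths differed, one would continue the other by a
      \<open>D\<close> and thus have a prefix of height -1.\<close>
    have contra: False if "a \<in> dyck_paths i" "b \<in> dyck_paths j" "a = b @ D # z" for a b i j z
    proof -
      have "height (b @ [D]) \<ge> 0" by (rule dyck_prefix[OF that(1), of _ z]) (simp add: that(3))
      then show False using that(2) by (simp add: dyck_paths_iff)
    qed
    have "u @ D # v = u' @ D # v'" using that(3) by (simp add: dyck_lam_def)
    then obtain z where "u = u' @ z \<and> z @ D # v = D # v' \<or> u @ z = u' \<and> D # v = z @ D # v'"
      by (auto simp: append_eq_append_conv2)
    then show ?thesis using contra[OF dy] contra[OF dy(2,1)] by (cases z) auto
  qed
qed auto

section \<open>Statistics of Dyck paths\<close>

lemma dyck_comp_height:
  "dyck_comp w = card {k \<in> {1..length w}. height (take k w) = 0}"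
  unfolding dyck_comp_def height_def by (rule arg_cong[of _ _ card]) auto

text \<open>\<open>dyck_lam u\<close> stays strictly above the axis until its last step, so it
  contributes a single return, at \<open>l\<close>; the later returns are those of \<open>v\<close>
  moved by \<open>l\<close>.\<close>

lemma dyck_comp_lam_append:
  assumes "u \<in> dyck_paths n" shows "dyck_comp (dyck_lam u @ v) = Suc (dyck_comp v)"
proof -
  define l where "l = length u + 2"
  have low: "height (take k (dyck_lam u @ v)) > 0" if "k \<in> {1..<l}" for k
  proof -
    obtain j where j: "k = Suc j" "j \<le> length u" using \<open>k \<in> {1..<l}\<close> by (cases k) (auto simp: l_def)
    have "height (take j u) \<ge> 0"
      using dyck_prefix[OF assms, of "take j u" "drop j u"] by simp
    then show ?thesis using j by (simp add: dyck_lam_def)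
  qed
  have high: "height (take (l + j) (dyck_lam u @ v)) = height (take j v)" for j
    using assms by (simp add: dyck_lam_def l_def dyck_paths_iff)
  have "{k \<in> {1..length (dyck_lam u @ v)}. height (take k (dyck_lam u @ v)) = 0} =
      insert l ((\<lambda>j. l + j) ` {j \<in> {1..length v}. height (take j v) = 0})" (is "?L = ?R")
  proof (rule set_eqI)
    fix k
    show "k \<in> ?L \<longleftrightarrow> k \<in> ?R"
    proof (cases "k < l")
      case True
      then show ?thesis using low[of k] by (cases "k = 0") (auto simp: l_def)
    next
      case False
      then obtain j where "k = l + j" using le_Suc_ex not_less by blast
      then show ?thesis using high[of j] by (cases "j = 0") (auto simp: dyck_lam_def l_def)
    qed
  qed
  then show ?thesis
    unfolding dyck_comp_height by (simp add: card_insert_if card_image image_iff)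
qed

text \<open>Kept general in \<open>P\<close> so that peaks and double rises obey the same
  recursion.\<close>

lemma card_adjacent_Cons:
  "card {i. Suc i < length (x # w) \<and> P ((x # w) ! i) ((x # w) ! Suc i)} =
    (if w \<noteq> [] \<and> P x (hd w) then 1 else 0) + card {i. Suc i < length w \<and> P (w ! i) (w ! Suc i)}"
proof (cases w)
  case (Cons y v)
  then show ?thesis
    using card_less_Suc_split[of "length v" "\<lambda>i. P ((x # w) ! i) ((x # w) ! Suc i)"]
    by (simp add: conj_commute)
qed simp

lemma dyck_peak_Nil [simp]: "dyck_peak [] = 0"
  by (simp add: dyck_peak_def)

lemma dyck_peak_Cons [simp]:
  "dyck_peak (x # w) = (if w \<noteq> [] \<and> x = U \<and> hd w = D then 1 else 0) + dyck_peak w"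
  unfolding dyck_peak_def using card_adjacent_Cons[of x w "\<lambda>x y. x = U \<and> y = D"] by simp

lemma dyck_peak_append:
  "w \<noteq> [] \<Longrightarrow> hd w = U \<Longrightarrow> dyck_peak (v @ w) = dyck_peak v + dyck_peak w"
  by (induction v) (auto simp: hd_append)

lemma dyck_peak_snoc:
  "dyck_peak (w @ [D]) = dyck_peak w + (if w \<noteq> [] \<and> last w = U then 1 else 0)"
  by (induction w) (auto simp: hd_append)

text \<open>As the word does not end in \<open>U\<close>, every \<open>U\<close> is followed by
  \<open>U\<close> or by \<open>D\<close>, so double rises and peaks together count the up
  steps.\<close>

lemma dyck_nonpeak_plus_peak:
  assumes "w = [] \<or> last w = D"
  shows "dyck_nonpeak w + dyck_peak w = Suc (count_list w U)"
proof -
  define uu where "uu w = card {i. Suc i < length w \<and> w ! i = U \<and> w ! Suc i = U}" for w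
  have uu_Nil: "uu [] = 0" by (simp add: uu_def)
  have uu_Cons: "uu (x # w) = (if w \<noteq> [] \<and> x = U \<and> hd w = U then 1 else 0) + uu w" for x w
    unfolding uu_def using card_adjacent_Cons[of x w "\<lambda>x y. x = U \<and> y = U"] by simp
  have "uu w + dyck_peak w = count_list w U"
    using assms
  proof (induction w)
    case (Cons x w)
    then show ?case
      by (cases "w = []"; cases x; cases "hd w") (simp_all add: uu_Cons uu_Nil)
  qed (simp add: uu_Nil)
  then show ?thesis by (simp add: dyck_nonpeak_def uu_def)
qed

lemma dyck_rcomp_lam: "dyck_rcomp (dyck_lam w) = Suc (dyck_rcomp w)"
proof -
  have "takeWhile (\<lambda>s. s = D) (v @ [U]) = takeWhile (\<lambda>s. s = D) v" for v
    by (induction v) auto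
  then show ?thesis by (simp add: dyck_rcomp_def dyck_lam_def)
qed

lemma dyck_rcomp_append:
  assumes "w \<in> dyck_paths n" "w \<noteq> []" shows "dyck_rcomp (v @ w) = dyck_rcomp w"
proof -
  have "U \<in> set (rev w)" using dyck_hd[OF assms] assms(2) by (metis hd_in_set set_rev)
  then show ?thesis by (simp add: dyck_rcomp_def takeWhile_append1)
qed

text \<open>A nonempty Dyck word starts with \<open>U\<close> and ends with \<open>D\<close>, so
  neither of the two new steps takes part in a peak.\<close>

lemma dyck_peak_lam:
  assumes "w \<in> dyck_paths n" "w \<noteq> []" shows "dyck_peak (dyck_lam w) = dyck_peak w"
  using dyck_hd[OF assms] dyck_last[OF assms] assms(2)
  by (simp add: dyck_lam_def dyck_peak_snoc hd_append)

text \<open>The recursions demanded by \<open>h_sendsI\<close> are proved once, for Dyck words, and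
  read back through \<open>f\<close>. The statistics are compared in positive sizes only, as
  conventions at \<open>e\<close> may differ: \<open>perm_rcomp []\<close> is 1 but
  \<open>dyck_rcomp []\<close> is 0.\<close>

lemma h_sends_via_dyck:
  fixes C :: "nat \<Rightarrow> 'a set" and comp p rcomp q :: "'a \<Rightarrow> nat"
  assumes "catalan_structure C e lam oplus" and n: "n \<ge> 1"
    and f: "\<And>n t. t \<in> C n \<Longrightarrow> f t \<in> dyck_paths n"
    and f_e: "f e = []"
    and f_lam: "\<And>n t. t \<in> C n \<Longrightarrow> f (lam t) = dyck_lam (f t)"
    and f_oplus: "\<And>m n s t. s \<in> C m \<Longrightarrow> t \<in> C n \<Longrightarrow> f (oplus s t) = f s @ f t"
    and comp: "\<And>n t. t \<in> C n \<Longrightarrow> n \<ge> 1 \<Longrightarrow> comp t = dyck_comp (f t)"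
    and p: "\<And>n t. t \<in> C n \<Longrightarrow> n \<ge> 1 \<Longrightarrow> p t = dyck_peak (f t)"
    and rcomp: "\<And>n t. t \<in> C n \<Longrightarrow> n \<ge> 1 \<Longrightarrow> rcomp t = dyck_rcomp (f t)"
    and q: "\<And>n t. t \<in> C n \<Longrightarrow> n \<ge> 1 \<Longrightarrow> q t = dyck_nonpeak (f t)"
  shows "catalan_data.h_sends C e lam oplus n (comp, p) (rcomp, q)"
proof -
  interpret catalan_structure C e lam oplus by fact
  have dyck: "\<exists>n. f t \<in> dyck_paths n" if "t \<in> carrier" for t
    using that f unfolding carrier_def by blast
  have pos: "\<exists>n\<ge>1. t \<in> C n" if t: "t \<in> carrier" "t \<noteq> e" for t
  proof -
    obtain n where n: "t \<in> C n" using t by (auto simp: carrier_def)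
    moreover have "n \<noteq> 0"
    proof
      assume "n = 0"
      then show False using n t(2) C_0 by simp
    qed
    ultimately show ?thesis by (intro exI[of _ n]) simp
  qed
  have stat: "comp t = dyck_comp (f t)" "p t = dyck_peak (f t)" "rcomp t = dyck_rcomp (f t)"
    if "t \<in> carrier" "t \<noteq> e" for t
    using pos[OF that] comp p rcomp by auto
  have ne: "f t \<noteq> []" if "t \<in> carrier" "t \<noteq> e" for t
    using pos[OF that] f by (fastforce simp: dyck_paths_iff)
  have fl: "f (lam t) = dyck_lam (f t)" if "t \<in> carrier" for t
    using that f_lam by (auto simp: carrier_def)
  have fo: "f (oplus s t) = f s @ f t" if "s \<in> carrier" "t \<in> carrier" for s t
    using that f_oplus by (auto simp: carrier_def)
  note cl = lam_carrier lam_not_e e_carrier oplus_carrier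
  show ?thesis
  proof (rule h_sendsI[OF n])
    show "comp (lam u) = 1" if u: "u \<in> carrier" for u
    proof -
      obtain n where "f u \<in> dyck_paths n" using dyck[OF u] by blast
      then show ?thesis
        using dyck_comp_lam_append[of "f u" n "[]"] u by (simp add: stat fl cl dyck_comp_def)
    qed
    show "comp (oplus (lam u) v) = Suc (comp v)" if uv: "u \<in> carrier" "v \<in> carrier" "v \<noteq> e" for u v
    proof -
      obtain n where "f u \<in> dyck_paths n" using dyck uv by blast
      then show ?thesis
        using dyck_comp_lam_append[of "f u" n "f v"] uv
        by (simp add: stat fl fo cl lam_oplus_not_e)
    qed
    show "rcomp (lam e) = 1" "p (lam e) = 1"
      by (simp_all add: stat fl cl f_e dyck_rcomp_def dyck_lam_def)
    show "rcomp (lam u) = Suc (rcomp u)" if "u \<in> carrier" "u \<noteq> e" for u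
      using that by (simp add: stat fl cl dyck_rcomp_lam)
    show "p (lam u) = p u" if u: "u \<in> carrier" "u \<noteq> e" for u
    proof -
      obtain n where "f u \<in> dyck_paths n" using dyck u by blast
      then show ?thesis using u by (simp add: stat fl cl dyck_peak_lam ne)
    qed
    show "rcomp (oplus t u) = rcomp u" "p (oplus t u) = p t + p u"
      if tu: "t \<in> carrier" "u \<in> carrier" "t \<noteq> e" "u \<noteq> e" for t u
    proof -
      obtain n where n: "f u \<in> dyck_paths n" using dyck tu by blast
      then show "rcomp (oplus t u) = rcomp u"
        using tu dyck_rcomp_append[OF n] by (simp add: stat fo cl oplus_eq_e_iff ne)
      show "p (oplus t u) = p t + p u"
        using tu dyck_peak_append dyck_hd[OF n] by (simp add: stat fo cl oplus_eq_e_iff ne)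
    qed
    show "q t = n + 1 - p t" if t: "t \<in> C n" for t
    proof -
      have "dyck_nonpeak (f t) + dyck_peak (f t) = Suc n"
        using dyck_nonpeak_plus_peak[of "f t"] dyck_last[OF f[OF t]] f[OF t]
        by (auto simp: dyck_paths_iff)
      then show ?thesis using p[OF t n] q[OF t n] by simp
    qed
  qed
qed

lemma dyck_h_sends:
  "n \<ge> 1 \<Longrightarrow> catalan_data.h_sends dyck_paths [] dyck_lam (@) n
    (dyck_comp, dyck_peak) (dyck_rcomp, dyck_nonpeak)"
  by (rule h_sends_via_dyck[where f = "\<lambda>w. w", OF dyck_catalan]) auto

section \<open>Standard Young tableaux\<close>

text \<open>The ballot word: index \<open>i\<close> carries the entry \<open>Suc i\<close>, because
  list positions start at 0 and tableau entries at 1.\<close>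

definition step_word :: "nat set \<Rightarrow> nat \<Rightarrow> step list" where
  "step_word A m = map (\<lambda>i. if Suc i \<in> A then U else D) [0..<m]"

definition syt_word :: "nat list \<times> nat list \<Rightarrow> step list" where
  "syt_word = (\<lambda>(a, b). step_word (set a) (2 * length a))"

lemma card_Suc_mem: "card {i. i < k \<and> Suc i \<in> A} = card (A \<inter> {1..k})"
proof -
  have "A \<inter> {1..k} = Suc ` {i. i < k \<and> Suc i \<in> A}"
  proof (rule set_eqI)
    fix x show "x \<in> A \<inter> {1..k} \<longleftrightarrow> x \<in> Suc ` {i. i < k \<and> Suc i \<in> A}"
      by (cases x) (auto simp: image_iff)
  qed
  then show ?thesis by (simp add: card_image)
qed

lemma count_step_word:
  "count_list (step_word A m) U = card (A \<inter> {1..m})"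
  "count_list (step_word A m) D = card (- A \<inter> {1..m})"
proof -
  have "count_list (map f [0..<m]) x = card {i. i < m \<and> f i = x}" for f :: "nat \<Rightarrow> step" and x
  proof -
    have "{i. i < m \<and> f i = x} = {i. i < length (map f [0..<m]) \<and> x = map f [0..<m] ! i}" by auto
    then show ?thesis unfolding count_list_eq_length_filter length_filter_conv_card by simp
  qed
  then show "count_list (step_word A m) U = card (A \<inter> {1..m})"
    "count_list (step_word A m) D = card (- A \<inter> {1..m})"
    unfolding step_word_def card_Suc_mem[symmetric]
    by (auto intro!: arg_cong[of _ _ card] split: if_splits)
qed

lemma take_step_word: "k \<le> m \<Longrightarrow> take k (step_word A m) = step_word A k"
  by (simp add: step_word_def take_map)

lemma length_step_word [simp]: "length (step_word A m) = m"
  by (simp add: step_word_def)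

lemma nth_step_word: "i < m \<Longrightarrow> step_word A m ! i = (if Suc i \<in> A then U else D)"
  by (simp add: step_word_def)

lemma sytD:
  assumes "(a, b) \<in> syts n"
  shows "length a = n" "length b = n" "set a \<union> set b = {1..2 * n}"
    "sorted_wrt (<) a" "sorted_wrt (<) b" "\<And>i. i < n \<Longrightarrow> a ! i < b ! i"
    "distinct a" "distinct b" "set a \<inter> set b = {}" "set b = {1..2 * n} - set a"
    "syt_word (a, b) = step_word (set a) (2 * n)"
    "set a \<subseteq> {1..2 * n}" "set b \<subseteq> {1..2 * n}"
proof -
  show *: "length a = n" "length b = n" "set a \<union> set b = {1..2 * n}"
    "sorted_wrt (<) a" "sorted_wrt (<) b" "\<And>i. i < n \<Longrightarrow> a ! i < b ! i"
    using assms by (auto simp: syts_def)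
  show dist: "distinct a" "distinct b" using *(4,5) by (auto simp: strict_sorted_iff)
  \<comment> \<open>Disjointness of the rows is not part of the definition; it follows by counting,
    as \<open>2 * n\<close> entries cover \<open>2 * n\<close> values.\<close>
  have "card (set a \<union> set b) = 2 * n" using *(3) by simp
  moreover have "card (set a \<union> set b) + card (set a \<inter> set b) = card (set a) + card (set b)"
    by (rule card_Un_Int[symmetric]) simp_all
  ultimately have "card (set a \<inter> set b) = 0"
    using dist * by (simp add: distinct_card)
  then show "set a \<inter> set b = {}" by simp
  then show "set b = {1..2 * n} - set a" using *(3) by blast
  show "syt_word (a, b) = step_word (set a) (2 * n)" using * by (simp add: syt_word_def)
  show "set a \<subseteq> {1..2 * n}" "set b \<subseteq> {1..2 * n}" using *(3) by blast+
qed

lemma syt_compl: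
  assumes "(a, b) \<in> syts n" "k \<le> 2 * n" shows "- set a \<inter> {1..k} = set b \<inter> {1..k}"
  using assms(2) unfolding sytD(10)[OF assms(1)] by auto

lemma syt_count:
  assumes "(a, b) \<in> syts n" "k \<le> 2 * n"
  shows "count_list (take k (syt_word (a, b))) U = card (set a \<inter> {1..k})"
    "count_list (take k (syt_word (a, b))) D = card (set b \<inter> {1..k})"
  using assms by (simp_all add: sytD(11) take_step_word count_step_word syt_compl del: One_nat_def)

lemma syt_card_sum:
  assumes "(a, b) \<in> syts n" "k \<le> 2 * n"
  shows "card (set a \<inter> {1..k}) + card (set b \<inter> {1..k}) = k"
proof -
  have "card ((set a \<inter> {1..k}) \<union> (set b \<inter> {1..k})) = card (set a \<inter> {1..k}) + card (set b \<inter> {1..k})"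
    using sytD(9)[OF assms(1)] by (intro card_Un_disjoint) auto
  moreover have "(set a \<inter> {1..k}) \<union> (set b \<inter> {1..k}) = {1..k}"
    unfolding Int_Un_distrib2[symmetric] sytD(3)[OF assms(1)] using assms(2) by auto
  ultimately show ?thesis by simp
qed

text \<open>Each bottom entry up to \<open>k\<close> has a smaller top entry in its column, and
  distinct columns give distinct top entries.\<close>

lemma syt_ballot:
  assumes "(a, b) \<in> syts n"
  shows "card (set b \<inter> {1..k}) \<le> card (set a \<inter> {1..k})"
proof -
  note T = sytD[OF assms]
  define J where "J = {j. j < n \<and> b ! j \<le> k}"
  have J: "J \<subseteq> {..<n}" by (auto simp: J_def)
  have pos: "x \<ge> 1" if "x \<in> set a \<union> set b" for x using that T(3) by auto
  have "set b \<inter> {1..k} \<subseteq> (!) b ` J"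
    using T(2) by (auto simp: J_def in_set_conv_nth)
  then have "card (set b \<inter> {1..k}) \<le> card ((!) b ` J)"
    using J by (intro card_mono finite_imageI) (auto intro: finite_subset)
  also have "\<dots> \<le> card J" using J by (intro card_image_le) (auto intro: finite_subset)
  also have "\<dots> = card ((!) a ` J)"
    using J T by (intro card_image[symmetric] inj_on_nth) auto
  also have "(!) a ` J \<subseteq> set a \<inter> {1..k}"
  proof
    fix x assume "x \<in> (!) a ` J"
    then obtain j where j: "x = a ! j" "j < n" "b ! j \<le> k" by (auto simp: J_def)
    then have "x \<in> set a" using T(1) by auto
    moreover have "x \<le> k" using T(6)[OF j(2)] j by simp
    ultimately show "x \<in> set a \<inter> {1..k}" using pos[of x] by auto
  qed
  then have "card ((!) a ` J) \<le> card (set a \<inter> {1..k})" by (intro card_mono) auto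
  finally show ?thesis .
qed

lemma syt_word_dyck:
  assumes "T \<in> syts n" shows "syt_word T \<in> dyck_paths n"
proof -
  obtain a b where T: "T = (a, b)" "(a, b) \<in> syts n" using assms by (cases T) auto
  note ab = sytD[OF T(2)]
  have len: "length (syt_word T) = 2 * n" by (simp add: T(1) ab)
  have "set a \<inter> {1..2 * n} = set a" "set b \<inter> {1..2 * n} = set b" using ab(3) by auto
  then have "count_list (syt_word T) U = n" "count_list (syt_word T) D = n"
    using syt_count[OF T(2), of "2 * n"] len ab(1,2,7,8) by (simp_all add: T(1) distinct_card)
  then show ?thesis
    using len syt_count[OF T(2)] syt_ballot[OF T(2)] by (auto simp: dyck_paths_def T(1))
qed

text \<open>The word determines the set of the top row, the bottom row is the complement, and
  strictly sorted lists are determined by their sets.\<close>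

lemma syt_word_inj: "inj_on syt_word (syts n)"
proof (rule inj_onI, clarify)
  fix a b c d assume ab: "(a, b) \<in> syts n" and cd: "(c, d) \<in> syts n"
    and eq: "syt_word (a, b) = syt_word (c, d)"
  note A = sytD[OF ab] and C = sytD[OF cd]
  have mem: "Suc i \<in> set a \<longleftrightarrow> Suc i \<in> set c" if "i < 2 * n" for i
    using arg_cong[OF eq, of "\<lambda>w. w ! i"] that by (simp add: A(11) C(11) nth_step_word split: if_splits)
  have sub: "set a \<subseteq> {1..2 * n}" "set c \<subseteq> {1..2 * n}" using A(12) C(12) .
  have "x \<in> set a \<longleftrightarrow> x \<in> set c" for x
  proof (cases "x \<in> {1..2 * n}")
    case True
    then show ?thesis using mem[of "x - 1"] by (cases x) auto
  qed (use sub in auto)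
  then have "set a = set c" by blast
  then show "a = c \<and> b = d"
    using A C strict_sorted_equal by metis
qed

lemma syt_lam_closed:
  assumes "T \<in> syts n" shows "syt_lam T \<in> syts (Suc n)"
proof -
  obtain a b where T: "T = (a, b)" "(a, b) \<in> syts n" using assms by (cases T) auto
  note ab = sytD[OF T(2)]
  have a_bd: "a ! i \<ge> 1" "a ! i \<le> 2 * n" "b ! i \<ge> 1" "b ! i \<le> 2 * n" if "i < n" for i
    using ab(1-3) that nth_mem[of i a] nth_mem[of i b] by fastforce+
  have "insert 1 (Suc ` set a) \<union> (Suc ` set b \<union> {2 * n + 2}) = insert 1 (Suc ` {1..2 * n} \<union> {2 * n + 2})"
    unfolding ab(3)[symmetric] by blast
  also have "Suc ` {1..2 * n} = {2..2 * n + 1}" by (simp add: numeral_2_eq_2)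
  also have "insert 1 ({2..2 * n + 1} \<union> {2 * n + 2}) = {1..2 * n + 2}" by auto
  finally have "insert 1 (Suc ` set a) \<union> (Suc ` set b \<union> {2 * n + 2}) = {1..2 * n + 2}" .
  moreover have "(1 # map Suc a) ! i < (map Suc b @ [2 * n + 2]) ! i" if "i < Suc n" for i
  proof (cases i)
    case 0
    then show ?thesis using a_bd[of 0] ab(2) by (auto simp: nth_append)
  next
    case (Suc j)
    \<comment> \<open>In \<open>syt_lam\<close> the top row moves one column to the right against
      the bottom row, so \<open>a ! j\<close> now stands above \<open>b ! Suc j\<close>, or above
      the new last entry.\<close>
    have "a ! j < b ! j" "Suc j < n \<Longrightarrow> b ! j < b ! Suc j"
      using ab(2,5,6) Suc that by (auto simp: sorted_wrt_iff_nth_less)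
    then show ?thesis
      using Suc that a_bd[of j] ab(1,2) by (auto simp: nth_append)
  qed
  moreover have bd: "\<forall>x\<in>set a \<union> set b. 0 < x \<and> x < 2 * n + 1" unfolding ab(3) by auto
  have "sorted_wrt (<) (1 # map Suc a)" "sorted_wrt (<) (map Suc b @ [2 * n + 2])"
    using bd ab(4,5) by (auto simp: sorted_wrt_append sorted_wrt_map)
  ultimately show ?thesis
    using ab(1,2) by (simp add: syts_def T(1) syt_lam_def insert_commute)
qed

lemma syt_oplus_closed:
  assumes "S \<in> syts m" "T \<in> syts n" shows "syt_oplus S T \<in> syts (m + n)"
proof -
  obtain a b where S: "S = (a, b)" "(a, b) \<in> syts m" using assms by (cases S) auto
  obtain c d where T: "T = (c, d)" "(c, d) \<in> syts n" using assms by (cases T) auto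
  note ab = sytD[OF S(2)] and cd = sytD[OF T(2)]
  have "set a \<union> (\<lambda>x. x + 2 * m) ` set c \<union> (set b \<union> (\<lambda>x. x + 2 * m) ` set d) =
      {1..2 * m} \<union> (\<lambda>x. x + 2 * m) ` {1..2 * n}"
    unfolding ab(3)[symmetric] cd(3)[symmetric] by blast
  also have "(\<lambda>x. x + 2 * m) ` {1..2 * n} = {2 * m + 1..2 * (m + n)}"
    using image_add_atLeastAtMost[of "2 * m" 1 "2 * n"] by (simp add: add.commute distrib_left)
  also have "{1..2 * m} \<union> {2 * m + 1..2 * (m + n)} = {1..2 * (m + n)}" by auto
  finally have "set a \<union> (\<lambda>x. x + 2 * m) ` set c \<union> (set b \<union> (\<lambda>x. x + 2 * m) ` set d) = {1..2 * (m + n)}" .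
  moreover have "x < y + 2 * m" if "x \<in> set a \<union> set b" "y \<in> set c \<union> set d" for x y
    using that unfolding ab(3) cd(3) by auto
  then have "sorted_wrt (<) (a @ map (\<lambda>x. x + 2 * m) c)" "sorted_wrt (<) (b @ map (\<lambda>x. x + 2 * m) d)"
    using ab(4,5) cd(4,5) by (auto simp: sorted_wrt_append sorted_wrt_map)
  moreover have "(a @ map (\<lambda>x. x + 2 * m) c) ! i < (b @ map (\<lambda>x. x + 2 * m) d) ! i" if "i < m + n" for i
    using that ab(1,2,6) cd(1,2,6) by (auto simp: nth_append)
  ultimately show ?thesis
    using ab(1,2) cd(1,2) by (simp add: syts_def S(1) T(1) syt_oplus_def)
qed

lemma syt_word_lam:
  assumes "T \<in> syts n" shows "syt_word (syt_lam T) = dyck_lam (syt_word T)"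
proof -
  obtain a b where T: "T = (a, b)" "(a, b) \<in> syts n" using assms by (cases T) auto
  note ab = sytD[OF T(2)]
  have "[0..<Suc (Suc m)] = 0 # map Suc [0..<Suc m]" for m
    unfolding map_Suc_upt by (rule upt_conv_Cons) simp
  from this[of "2 * n"] have "[0..<2 * Suc n] = 0 # map Suc [0..<2 * n] @ [Suc (2 * n)]" by simp
  moreover have "0 \<notin> set a" "Suc (2 * n) \<notin> set a" using ab(12) by auto
  ultimately show ?thesis
    using ab(1) by (simp add: T(1) syt_lam_def syt_word_def step_word_def dyck_lam_def image_iff del: upt_Suc)
qed

lemma syt_word_oplus:
  assumes "S \<in> syts m" "T \<in> syts n"
  shows "syt_word (syt_oplus S T) = syt_word S @ syt_word T"
proof -
  obtain a b where S: "S = (a, b)" "(a, b) \<in> syts m" using assms by (cases S) auto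
  obtain c d where T: "T = (c, d)" "(c, d) \<in> syts n" using assms by (cases T) auto
  note ab = sytD[OF S(2)] and cd = sytD[OF T(2)]
  have upt: "[0..<2 * m + 2 * n] = [0..<2 * m] @ map (\<lambda>i. i + 2 * m) [0..<2 * n]"
    unfolding map_add_upt add.commute[of "2 * n"] by (rule upt_add_eq_append) simp
  have 1: "Suc i \<notin> (\<lambda>x. x + 2 * m) ` set c" if "i < 2 * m" for i
    using that cd(12) by auto
  have 2: "Suc (i + 2 * m) \<notin> set a" for i
    using ab(12) by auto
  have 3: "Suc (i + 2 * m) \<in> (\<lambda>x. x + 2 * m) ` set c \<longleftrightarrow> Suc i \<in> set c" for i
    by (force simp: image_iff)
  have "step_word (set a \<union> (\<lambda>x. x + 2 * m) ` set c) (2 * m + 2 * n) =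
      step_word (set a) (2 * m) @ step_word (set c) (2 * n)"
    unfolding step_word_def upt by (simp add: 1 2 3)
  then show ?thesis
    using ab(1) cd(1) by (simp add: S(1) T(1) syt_oplus_def syt_word_def distrib_left)
qed

lemma syt_catalan: "catalan_structure syts ([], []) syt_lam syt_oplus"
  by (rule catalan_structure_transport[OF dyck_catalan, where f = syt_word])
    (use syt_word_dyck syt_word_inj syt_lam_closed syt_oplus_closed syt_word_lam syt_word_oplus
      in \<open>auto simp: syts_def\<close>)

text \<open>An entry \<open>a ! j > m\<close> with \<open>j < k\<close> would leave, by sortedness,
  at most \<open>j\<close> entries in \<open>{1..m}\<close>.\<close>

lemma strict_sorted_take_subset:
  fixes a :: "nat list"
  assumes "sorted_wrt (<) a" "k \<le> length a" "card (set a \<inter> {1..m}) = k" "0 \<notin> set a"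
  shows "set (take k a) \<subseteq> {1..m}"
proof
  fix x assume "x \<in> set (take k a)"
  then obtain j where j: "j < k" "x = a ! j" using assms(2) by (auto simp: in_set_conv_nth)
  show "x \<in> {1..m}"
  proof (rule ccontr)
    assume "x \<notin> {1..m}"
    moreover have "x \<in> set a" using assms(2) j by simp
    then have "x \<noteq> 0" using assms(4) by metis
    ultimately have m: "m < a ! j" using j by auto
    have "set a \<inter> {1..m} \<subseteq> (!) a ` {..<j}"
    proof
      fix y assume "y \<in> set a \<inter> {1..m}"
      then obtain i where i: "i < length a" "y = a ! i" "y \<le> m" by (auto simp: in_set_conv_nth)
      have "i < j"
      proof (rule ccontr)
        assume "\<not> i < j"
        then have "a ! j \<le> a ! i"
          using assms(1) i(1) by (cases "i = j") (auto simp: sorted_wrt_iff_nth_less intro: less_imp_le)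
        then show False using m i by simp
      qed
      then show "y \<in> (!) a ` {..<j}" using i by blast
    qed
    then have "card (set a \<inter> {1..m}) \<le> j"
      using card_mono[of "(!) a ` {..<j}" "set a \<inter> {1..m}"] card_image_le[of "{..<j}" "(!) a"] by simp
    then show False using j assms(3) by simp
  qed
qed

lemma syt_comp_word:
  assumes "T \<in> syts n" shows "syt_comp T = dyck_comp (syt_word T)"
proof -
  obtain a b where T: "T = (a, b)" "(a, b) \<in> syts n" using assms by (cases T) auto
  note ab = sytD[OF T(2)]
  have zero: "0 \<notin> set a" "0 \<notin> set b" using ab(12,13) by auto
  \<comment> \<open>The two counts add up to \<open>2 * k\<close>, so equality makes both
    \<open>k\<close>; then the first \<open>k\<close> entries of each sorted row are exactly those
    up to \<open>2 * k\<close>.\<close>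
  have iff: "set (take k a) \<union> set (take k b) = {1..2 * k} \<longleftrightarrow>
      card (set a \<inter> {1..2 * k}) = card (set b \<inter> {1..2 * k})" if k: "k \<le> n" for k
  proof -
    have sum: "card (set a \<inter> {1..2 * k}) + card (set b \<inter> {1..2 * k}) = 2 * k"
      using syt_card_sum[OF T(2)] k by simp
    have cards: "card (set (take k a)) = k" "card (set (take k b)) = k"
      using ab k by (simp_all add: distinct_card)
    show ?thesis
    proof
      assume *: "set (take k a) \<union> set (take k b) = {1..2 * k}"
      have "set (take k a) \<subseteq> set a \<inter> {1..2 * k}" "set (take k b) \<subseteq> set b \<inter> {1..2 * k}"
        using * set_take_subset[of k a] set_take_subset[of k b] by blast+
      then have "k \<le> card (set a \<inter> {1..2 * k})" "k \<le> card (set b \<inter> {1..2 * k})"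
        using card_mono[of "set a \<inter> {1..2 * k}" "set (take k a)"]
          card_mono[of "set b \<inter> {1..2 * k}" "set (take k b)"] cards by auto
      then show "card (set a \<inter> {1..2 * k}) = card (set b \<inter> {1..2 * k})" using sum by simp
    next
      assume *: "card (set a \<inter> {1..2 * k}) = card (set b \<inter> {1..2 * k})"
      then have "card (set a \<inter> {1..2 * k}) = k" "card (set b \<inter> {1..2 * k}) = k" using sum by auto
      then have sub: "set (take k a) \<subseteq> {1..2 * k}" "set (take k b) \<subseteq> {1..2 * k}"
        using strict_sorted_take_subset[of a k "2 * k"] strict_sorted_take_subset[of b k "2 * k"]
          ab(1,2,4,5) k zero by simp_all
      have "set (take k a) \<inter> set (take k b) = {}"
        using ab(9) set_take_subset[of k a] set_take_subset[of k b] by blast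
      then have "card (set (take k a) \<union> set (take k b)) = 2 * k"
        using cards by (simp add: card_Un_disjoint)
      then show "set (take k a) \<union> set (take k b) = {1..2 * k}"
        using sub by (intro card_subset_eq) auto
    qed
  qed
  have "{m \<in> {1..length (syt_word T)}. count_list (take m (syt_word T)) U = count_list (take m (syt_word T)) D} =
      (\<lambda>k. 2 * k) ` {k \<in> {1..length a}. set (take k a) \<union> set (take k b) = {1..2 * k}}" (is "?L = ?R")
  proof (rule set_eqI)
    fix m
    have L: "m \<in> ?L \<longleftrightarrow> 1 \<le> m \<and> m \<le> 2 * n \<and> card (set a \<inter> {1..m}) = card (set b \<inter> {1..m})"
      using syt_count[OF T(2), of m] by (auto simp: T(1) ab(11))
    show "m \<in> ?L \<longleftrightarrow> m \<in> ?R"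
    proof
      assume m: "m \<in> ?L"
      \<comment> \<open>A return happens at an even length only, because the two equal counts add up
        to \<open>m\<close>.\<close>
      then have "m = 2 * card (set a \<inter> {1..m})"
        using L syt_card_sum[OF T(2), of m] by simp
      then obtain k where "m = 2 * k" by blast
      then show "m \<in> ?R" using m iff[of k] unfolding L by (auto simp: ab(1))
    next
      assume "m \<in> ?R"
      then show "m \<in> ?L" using iff unfolding L by (auto simp: ab(1))
    qed
  qed
  then show ?thesis
    by (simp add: dyck_comp_def syt_comp_def T(1) card_image inj_on_def)
qed

lemma syt_adjacent_word:
  assumes "(a, b) \<in> syts n"
  shows "syt_noncons (a, b) = dyck_peak (syt_word (a, b))"
    and "syt_cons (a, b) = dyck_nonpeak (syt_word (a, b))"
proof -
  note ab = sytD[OF assms]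
  have "{i \<in> set a. i + 1 \<in> B} = Suc ` {i. Suc i < 2 * n \<and> Suc i \<in> set a \<and> Suc (Suc i) \<in> B}"
    if "B \<subseteq> {1..2 * n}" for B
  proof (rule set_eqI)
    fix x
    have "x \<in> set a \<Longrightarrow> x \<ge> 1" using ab(12) by auto
    then show "x \<in> {i \<in> set a. i + 1 \<in> B} \<longleftrightarrow>
        x \<in> Suc ` {i. Suc i < 2 * n \<and> Suc i \<in> set a \<and> Suc (Suc i) \<in> B}"
      using that by (cases x) auto
  qed
  then have card: "card {i \<in> set a. i + 1 \<in> B} =
      card {i. Suc i < 2 * n \<and> Suc i \<in> set a \<and> Suc (Suc i) \<in> B}"
    if "B \<subseteq> {1..2 * n}" for B
    using that by (simp add: card_image)
  have "{i. Suc i < 2 * n \<and> Suc i \<in> set a \<and> Suc (Suc i) \<in> set b} =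
      {i. Suc i < 2 * n \<and> step_word (set a) (2 * n) ! i = U \<and> step_word (set a) (2 * n) ! Suc i = D}"
    by (auto simp: nth_step_word ab(10) split: if_splits)
  then show "syt_noncons (a, b) = dyck_peak (syt_word (a, b))"
    using card[of "set b"] ab(13) by (simp add: syt_noncons_def dyck_peak_def ab(11))
  have "{i. Suc i < 2 * n \<and> Suc i \<in> set a \<and> Suc (Suc i) \<in> set a} =
      {i. Suc i < 2 * n \<and> step_word (set a) (2 * n) ! i = U \<and> step_word (set a) (2 * n) ! Suc i = U}"
    by (auto simp: nth_step_word split: if_splits)
  then show "syt_cons (a, b) = dyck_nonpeak (syt_word (a, b))"
    using card[of "set a"] ab(12) by (simp add: syt_cons_def dyck_nonpeak_def ab(11))
qed

lemma le_length_takeWhile_iff: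
  "k \<le> length (takeWhile P xs) \<longleftrightarrow> k \<le> length xs \<and> (\<forall>j<k. P (xs ! j))"
proof (induction xs arbitrary: k)
  case (Cons x xs)
  show ?case
    by (cases k) (auto simp: Cons.IH nth_Cons split: nat.splits)
qed auto

lemma syt_rcomp_word:
  assumes "T \<in> syts n" shows "syt_rcomp T = dyck_rcomp (syt_word T)"
proof -
  obtain a b where T: "T = (a, b)" "(a, b) \<in> syts n" using assms by (cases T) auto
  note ab = sytD[OF T(2)]
  define r where "r = length (takeWhile (\<lambda>s. s = D) (rev (syt_word T)))"
  have rev_word: "rev (syt_word T) ! j = D \<longleftrightarrow> 2 * n - j \<in> set b" if "j < 2 * n" for j
    using that by (auto simp: T(1) ab(10,11) rev_nth nth_step_word Suc_diff_Suc)
  have desc: "rev b ! i > rev b ! j" if "i < j" "j < n" for i j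
    using that ab(2,5) by (simp add: rev_nth sorted_wrt_iff_nth_less)
  \<comment> \<open>If these largest values all occur in the bottom row, strict decrease of
    \<open>rev b\<close> forces them into its first places in this order.\<close>
  have run: "(\<forall>j<k. rev b ! j = 2 * n - j) \<longleftrightarrow> (\<forall>j<k. 2 * n - j \<in> set b)" if k: "k \<le> n" for k
  proof
    assume *: "\<forall>j<k. rev b ! j = 2 * n - j"
    show "\<forall>j<k. 2 * n - j \<in> set b"
      using * k ab(2) by (metis length_rev less_le_trans nth_mem set_rev)
  next
    assume *: "\<forall>j<k. 2 * n - j \<in> set b"
    have "rev b ! j = 2 * n - j" if "j < k" for j
      using that
    proof (induction j rule: less_induct)
      case (less j)
      have "2 * n - j \<in> set (rev b)" using * less.prems by simp
      then obtain l where l: "l < n" "rev b ! l = 2 * n - j"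
        using ab(2) unfolding in_set_conv_nth length_rev by blast
      have "\<not> l < j" using less l k by auto
      then have ge: "2 * n - j \<le> rev b ! j"
        using desc[of j l] l by (cases "j = l") auto
      have "rev b ! j \<in> set (rev b)" using less.prems k ab(2) by (intro nth_mem) simp
      then have mem: "rev b ! j \<le> 2 * n" using ab(13) by auto
      show ?case
      proof (cases j)
        case 0
        then show ?thesis using ge mem by simp
      next
        case (Suc i)
        then have "rev b ! i = 2 * n - i" using less by simp
        moreover have "rev b ! j < rev b ! i" using desc[of i j] Suc less.prems k by simp
        ultimately show ?thesis using ge Suc less.prems k by linarith
      qed
    qed
    then show "\<forall>j<k. rev b ! j = 2 * n - j" by blast
  qed
  \<comment> \<open>The word has only \<open>n\<close> down steps; this settles lengths
    \<open>k\<close> beyond the row, which \<open>syt_rcomp\<close> excludes explicitly.\<close>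
  have "r \<le> n"
  proof -
    have "takeWhile (\<lambda>s. s = D) (rev (syt_word T)) = replicate r D"
      unfolding r_def by (rule replicate_eqI) (auto dest: set_takeWhileD)
    then obtain v where "rev (syt_word T) = replicate r D @ v"
      by (metis takeWhile_dropWhile_id)
    then have "count_list (rev (syt_word T)) D = r + count_list v D"
      by (simp add: count_list_eq_length_filter)
    then show ?thesis using syt_word_dyck[OF assms] by (simp add: dyck_paths_def)
  qed
  have "k \<le> length b \<and> (\<forall>j<k. rev b ! j = 2 * length b - j) \<longleftrightarrow> k \<le> r" for k
  proof (cases "k \<le> n")
    case True
    have "length (rev (syt_word T)) = 2 * n" by (simp add: T(1) ab(11))
    then show ?thesis
      using True run[OF True] rev_word by (auto simp: r_def le_length_takeWhile_iff ab(2))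
  next
    case False
    then show ?thesis using \<open>r \<le> n\<close> by (simp add: ab(2))
  qed
  then have "{k. k \<le> length b \<and> (\<forall>j<k. rev b ! j = 2 * length b - j)} = {..r}" by auto
  moreover have "Max {..r} = r" by (rule Max_eqI) auto
  ultimately show ?thesis
    unfolding dyck_rcomp_def r_def[symmetric]
    by (simp add: syt_rcomp_def T(1))
qed

lemma syt_h_sends:
  assumes "n \<ge> 1"
  shows "catalan_data.h_sends syts ([], []) syt_lam syt_oplus n
    (syt_comp, syt_noncons) (syt_rcomp, syt_cons)"
proof (rule h_sends_via_dyck[where f = syt_word, OF syt_catalan assms])
  show "syt_word ([], []) = []" by (simp add: syt_word_def step_word_def)
  show "syt_noncons t = dyck_peak (syt_word t)" "syt_cons t = dyck_nonpeak (syt_word t)"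
    if "t \<in> syts n" for n t
    using that syt_adjacent_word by (cases t; simp)+
qed (use syt_word_dyck syt_word_lam syt_word_oplus syt_comp_word syt_rcomp_word in auto)

section \<open>Permutations\<close>

lemma perms_iff: "p \<in> perms n \<longleftrightarrow> distinct p \<and> set p = {1..n}"
  by (auto simp: perms_def permutations_of_set_def)

lemma perms_length: "p \<in> perms n \<Longrightarrow> length p = n"
  by (auto simp: perms_iff dest: distinct_card)

text \<open>By pigeonhole, a list of the right length is a permutation once every value is
  exhibited.\<close>

lemma perms_iff_length: "p \<in> perms n \<longleftrightarrow> length p = n \<and> {1..n} \<subseteq> set p"
proof
  assume "length p = n \<and> {1..n} \<subseteq> set p"
  then have *: "length p = n" "{1..n} \<subseteq> set p" by auto
  then have "card (set p) \<le> card {1..n}" using card_length[of p] by simp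
  then have "set p = {1..n}" using * card_seteq[of "set p" "{1..n}"] by simp
  then show "p \<in> perms n" using * by (simp add: perms_iff card_distinct)
qed (auto simp: perms_iff dest: distinct_card)

lemma perms_0 [simp]: "p \<in> perms 0 \<longleftrightarrow> p = []"
  by (auto simp: perms_iff)

lemma shift_image_atLeastAtMost: "(\<lambda>x. x + k) ` {1..l} = {k + 1..k + l :: nat}"
  using image_add_atLeastAtMost[of k 1 l] by (simp add: add.commute)

lemma perm_oplus_perms:
  assumes "p \<in> perms m" "q \<in> perms n" shows "perm_oplus p q \<in> perms (m + n)"
proof -
  have "{1..m + n} = {1..m} \<union> (\<lambda>x. x + m) ` {1..n}"
    unfolding shift_image_atLeastAtMost by auto
  then have "set (perm_oplus p q) = {1..m + n}"
    using assms perms_length[OF assms(1)] by (simp add: perms_iff perm_oplus_def)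
  then show ?thesis
    using assms[THEN perms_length] by (simp add: perms_iff_length perm_oplus_def)
qed

text \<open>The prefix uses up \<open>{1..k}\<close>, so the rest consists of the values above
  \<open>k\<close> and can be shifted down.\<close>

lemma perm_append_split:
  assumes "p \<in> perms k" "p @ us \<in> perms (k + l)"
  shows "\<exists>q\<in>perms l. us = map (\<lambda>x. x + k) q"
proof -
  have "set us = {1..k + l} - {1..k}" using assms by (auto simp: perms_iff)
  also have "\<dots> = (\<lambda>x. x + k) ` {1..l}" unfolding shift_image_atLeastAtMost by auto
  finally have us: "set us = (\<lambda>x. x + k) ` {1..l}" .
  define q where "q = map (\<lambda>x. x - k) us"
  have "map (\<lambda>x. x + k) q = us" unfolding q_def map_map by (rule map_idI) (auto simp: us)
  moreover have "set q = {1..l}" unfolding q_def set_map us image_image by simp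
  moreover have "distinct us" using assms by (simp add: perms_iff)
  then have "distinct q" using calculation(1) distinct_map by metis
  ultimately show ?thesis by (auto simp: perms_iff)
qed

lemma perm_oplus_Nil [simp]: "perm_oplus p [] = p" "perm_oplus [] p = p"
  by (simp_all add: perm_oplus_def)

lemma length_perm_oplus [simp]: "length (perm_oplus p q) = length p + length q"
  by (simp add: perm_oplus_def)

lemma perm_oplus_assoc: "perm_oplus (perm_oplus p q) r = perm_oplus p (perm_oplus q r)"
  by (simp add: perm_oplus_def add.assoc add.commute[of "length q"])

lemma map_shift_inj: "map (\<lambda>x. x + k) p = map (\<lambda>x. x + k) q \<longleftrightarrow> p = (q :: nat list)"
  by (rule inj_map_eq_map) (simp add: inj_on_def)

lemma perm_oplus_cancel:
  "length p = length p' \<Longrightarrow> perm_oplus p q = perm_oplus p' q' \<longleftrightarrow> p = p' \<and> q = q'"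
  by (auto simp: perm_oplus_def map_shift_inj)

text \<open>One of the two first summands is a prefix of the other; a proper prefix would split the
  longer one by \<open>perm_append_split\<close>.\<close>

lemma sum_indecomposable_cancel:
  assumes "sum_indecomposable q" "sum_indecomposable q'"
    "r \<in> perms (length r)" "r' \<in> perms (length r')" "perm_oplus q r = perm_oplus q' r'"
  shows "q = q' \<and> r = r'"
proof -
  have False if q: "sum_indecomposable q" "sum_indecomposable (q @ us)" and "us \<noteq> []" for q us
  proof -
    have "q \<in> perms (length q)" "q @ us \<in> perms (length q + length us)" "q \<noteq> []"
      using q by (auto simp: sum_indecomposable_def)
    moreover from this obtain s where s: "s \<in> perms (length us)" "us = map (\<lambda>x. x + length q) s"
      using perm_append_split by blast
    moreover have "s \<noteq> []" "q @ us = perm_oplus q s" "length s = length us"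
      using s \<open>us \<noteq> []\<close> by (auto simp: perm_oplus_def)
    ultimately show False
      using q(2) unfolding sum_indecomposable_def by (metis (no_types))
  qed
  note * = this
  obtain us where us: "q = q' @ us \<and> us @ map (\<lambda>x. x + length q) r = map (\<lambda>x. x + length q') r' \<or>
      q @ us = q' \<and> map (\<lambda>x. x + length q) r = us @ map (\<lambda>x. x + length q') r'"
    using assms(5) unfolding perm_oplus_def append_eq_append_conv2 by blast
  then have "us = []" using *[of q us] *[of q' us] assms(1,2) by auto
  then show ?thesis using us map_shift_inj by auto
qed

lemma foldr_perm_oplus_perms:
  "\<forall>q\<in>set qs. sum_indecomposable q \<Longrightarrow>
    foldr perm_oplus qs [] \<in> perms (length (foldr perm_oplus qs []))"
proof (induction qs)
  case (Cons q qs)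
  then have "perm_oplus q (foldr perm_oplus qs []) \<in> perms (length q + length (foldr perm_oplus qs []))"
    by (intro perm_oplus_perms) (auto simp: sum_indecomposable_def)
  then show ?case by simp
qed simp

lemma perm_comp_foldr:
  assumes "\<forall>q\<in>set qs. sum_indecomposable q"
  shows "perm_comp (foldr perm_oplus qs []) = length qs"
proof -
  have "qs = qs'" if "\<forall>q\<in>set qs. sum_indecomposable q" "\<forall>q\<in>set qs'. sum_indecomposable q"
    "foldr perm_oplus qs [] = foldr perm_oplus qs' []" for qs qs'
    using that
  proof (induction qs arbitrary: qs')
    case Nil
    then show ?case by (cases qs') (auto simp: perm_oplus_def sum_indecomposable_def)
  next
    case (Cons q qs)
    then obtain r rs where qs': "qs' = r # rs"
      by (cases qs') (auto simp: perm_oplus_def sum_indecomposable_def)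
    have "q = r \<and> foldr perm_oplus qs [] = foldr perm_oplus rs []"
      using Cons.prems unfolding qs'
      by (intro sum_indecomposable_cancel) (simp_all add: foldr_perm_oplus_perms)
    moreover from this have "qs = rs" using Cons.prems(1,2) qs' by (intro Cons.IH) simp_all
    ultimately show ?case using qs' by simp
  qed
  then show ?thesis unfolding perm_comp_def using assms by (intro the_equality) blast+
qed

text \<open>\<open>perm_comp\<close> refers to direct sums of arbitrary permutations, not to the
  structure \<open>C\<close>. The hypothesis on \<open>lam\<close> shows that the factorization
  inside \<open>C\<close> is also the one that \<open>perm_comp\<close> counts.\<close>

lemma perm_comp_lam_oplus:
  assumes "catalan_structure C [] lam perm_oplus"
    and lam: "\<And>n u. u \<in> C n \<Longrightarrow> sum_indecomposable (lam u)"
    and uv: "u \<in> C k" "v \<in> C l"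
  shows "perm_comp (perm_oplus (lam u) v) = Suc (perm_comp v)" and "perm_comp (lam u) = 1"
proof -
  interpret catalan_structure C "[]" lam perm_oplus by fact
  have "\<exists>qs. (\<forall>q\<in>set qs. sum_indecomposable q) \<and> v = foldr perm_oplus qs []" if "v \<in> carrier" for v
    using that
  proof (induction rule: carrier_induct)
    case e
    show ?case by (intro exI[of _ "[]"]) simp
  next
    case (lam_oplus u v)
    then obtain qs where "\<forall>q\<in>set qs. sum_indecomposable q" "v = foldr perm_oplus qs []" by blast
    moreover have "sum_indecomposable (lam u)"
      using lam_oplus(1) lam by (auto simp: carrier_def)
    ultimately show ?case by (intro exI[of _ "lam u # qs"]) simp
  qed
  then obtain qs where "\<forall>q\<in>set qs. sum_indecomposable q" "v = foldr perm_oplus qs []"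
    using C_carrier uv by blast
  then show "perm_comp (perm_oplus (lam u) v) = Suc (perm_comp v)"
    using perm_comp_foldr[of qs] perm_comp_foldr[of "lam u # qs"] lam[OF uv(1)] by simp
  show "perm_comp (lam u) = 1"
    using perm_comp_foldr[of "[lam u]"] lam[OF uv(1)] by simp
qed

section \<open>Right-to-left minima and maxima\<close>

lemma perm_rmin_Cons:
  "perm_rmin (x # p) = (if \<forall>y\<in>set p. x < y then 1 else 0) + perm_rmin p"
proof -
  have "is_rtl_min (x # p) 0 \<longleftrightarrow> (\<forall>y\<in>set p. x < y)"
    unfolding is_rtl_min_def all_set_conv_all_nth by (auto simp: nth_Cons' less_Suc_eq_0_disj)
  moreover have "is_rtl_min (x # p) (Suc i) \<longleftrightarrow> is_rtl_min p i" for i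
    unfolding is_rtl_min_def
    by (auto simp: less_Suc_eq_0_disj dest: spec[of _ "Suc _"])
  ultimately show ?thesis
    unfolding perm_rmin_def by (simp add: card_less_Suc_split)
qed

lemma perm_rmax_Cons:
  "perm_rmax (x # p) = (if \<forall>y\<in>set p. y < x then 1 else 0) + perm_rmax p"
proof -
  have "is_rtl_max (x # p) 0 \<longleftrightarrow> (\<forall>y\<in>set p. y < x)"
    unfolding is_rtl_max_def all_set_conv_all_nth by (auto simp: nth_Cons' less_Suc_eq_0_disj)
  moreover have "is_rtl_max (x # p) (Suc i) \<longleftrightarrow> is_rtl_max p i" for i
    unfolding is_rtl_max_def
    by (auto simp: less_Suc_eq_0_disj dest: spec[of _ "Suc _"])
  ultimately show ?thesis
    unfolding perm_rmax_def by (simp add: card_less_Suc_split)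
qed

lemma perm_rmin_Nil [simp]: "perm_rmin [] = 0" and perm_rmax_Nil [simp]: "perm_rmax [] = 0"
  by (simp_all add: perm_rmin_def perm_rmax_def)

lemma perm_rmin_append:
  "\<forall>x\<in>set p. \<forall>y\<in>set q. x < y \<Longrightarrow> perm_rmin (p @ q) = perm_rmin p + perm_rmin q"
  by (induction p) (auto simp: perm_rmin_Cons)

lemma perm_rmax_append:
  "\<forall>x\<in>set p. \<forall>y\<in>set q. x < y \<Longrightarrow> q \<noteq> [] \<Longrightarrow> perm_rmax (p @ q) = perm_rmax q"
proof (induction p)
  case (Cons x p)
  then have "x < hd q" "hd q \<in> set (p @ q)" using hd_in_set[of q] by auto
  then have "\<not> (\<forall>y\<in>set (p @ q). y < x)" by (meson less_asym)
  then show ?case using Cons by (simp add: perm_rmax_Cons)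
qed simp

lemma perm_rmin_shift: "perm_rmin (map (\<lambda>x. x + k) p) = perm_rmin p"
  by (induction p) (auto simp: perm_rmin_Cons)

lemma perm_rmax_shift: "perm_rmax (map (\<lambda>x. x + k) p) = perm_rmax p"
  by (induction p) (auto simp: perm_rmax_Cons)

lemma perm_oplus_separated:
  "p \<in> perms m \<Longrightarrow> q \<in> perms n \<Longrightarrow> \<forall>x\<in>set p. \<forall>y\<in>set (map (\<lambda>x. x + length p) q). x < y"
  using perms_length[of p m] by (auto simp: perms_iff)

lemma perm_rmin_oplus:
  "p \<in> perms m \<Longrightarrow> q \<in> perms n \<Longrightarrow> perm_rmin (perm_oplus p q) = perm_rmin p + perm_rmin q"
  unfolding perm_oplus_def using perm_rmin_append[OF perm_oplus_separated] by (simp add: perm_rmin_shift)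

lemma perm_rmax_oplus:
  "p \<in> perms m \<Longrightarrow> q \<in> perms n \<Longrightarrow> q \<noteq> [] \<Longrightarrow> perm_rmax (perm_oplus p q) = perm_rmax q"
  unfolding perm_oplus_def using perm_rmax_append[OF perm_oplus_separated] by (simp add: perm_rmax_shift)

lemma perm_nonrmin_eq: "perm_nonrmin p = length p + 1 - perm_rmin p"
proof -
  have "{i. i < length p \<and> \<not> is_rtl_min p i} = {..<length p} - {i. i < length p \<and> is_rtl_min p i}"
    by auto
  then have "card {i. i < length p \<and> \<not> is_rtl_min p i} = length p - perm_rmin p"
    unfolding perm_rmin_def by (simp add: card_Diff_subset subset_eq)
  moreover have "perm_rmin p \<le> length p"
    unfolding perm_rmin_def using card_mono[of "{..<length p}" "{i. i < length p \<and> is_rtl_min p i}"]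
    by auto
  ultimately show ?thesis by (simp add: perm_nonrmin_def)
qed

text \<open>The pattern is a relation \<open>R\<close> on values, so that one set of lemmas serves
  both 231 and 321.\<close>

definition has_triple :: "(nat \<Rightarrow> nat \<Rightarrow> nat \<Rightarrow> bool) \<Rightarrow> nat list \<Rightarrow> bool" where
  "has_triple R p \<longleftrightarrow> (\<exists>i j k. i < j \<and> j < k \<and> k < length p \<and> R (p ! i) (p ! j) (p ! k))"

lemma has_tripleI:
  "i < j \<Longrightarrow> j < k \<Longrightarrow> k < length p \<Longrightarrow> R (p ! i) (p ! j) (p ! k) \<Longrightarrow> has_triple R p"
  unfolding has_triple_def by blast

lemma has_triple_appendI1: "has_triple R p \<Longrightarrow> has_triple R (p @ q)"
  unfolding has_triple_def
  by (elim exE conjE, rule_tac x = i in exI, rule_tac x = j in exI, rule_tac x = k in exI)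
    (simp add: nth_append)

lemma has_triple_appendI2:
  assumes "has_triple R q" shows "has_triple R (p @ q)"
proof -
  obtain i j k where "i < j" "j < k" "k < length q" "R (q ! i) (q ! j) (q ! k)"
    using assms unfolding has_triple_def by blast
  then show ?thesis
    by (intro has_tripleI[of "length p + i" "length p + j" "length p + k"]) simp_all
qed

lemma has_triple_map:
  "has_triple R (map f p) \<longleftrightarrow> has_triple (\<lambda>x y z. R (f x) (f y) (f z)) p"
  unfolding has_triple_def by (intro ex_cong1) auto

text \<open>In both patterns the last value is below the first, so these two cannot lie in different
  parts, and the whole occurrence stays within one part.\<close>

lemma no_triple_append:
  assumes "\<not> has_triple R p" "\<not> has_triple R q" "\<forall>x\<in>set p. \<forall>y\<in>set q. x < y"
    and R: "\<And>x y z. R x y z \<Longrightarrow> z < x"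
  shows "\<not> has_triple R (p @ q)"
proof
  assume "has_triple R (p @ q)"
  then obtain i j k where ijk: "i < j" "j < k" "k < length p + length q"
    "R ((p @ q) ! i) ((p @ q) ! j) ((p @ q) ! k)"
    unfolding has_triple_def by auto
  show False
  proof (cases "k < length p")
    case True
    then show False using assms(1) ijk has_tripleI[of i j k p R] by (simp add: nth_append)
  next
    case False
    have "\<not> i < length p"
    proof
      assume "i < length p"
      then have "(p @ q) ! i \<in> set p" "(p @ q) ! k \<in> set q"
        using False ijk by (simp_all add: nth_append)
      then show False using assms(3) R[OF ijk(4)] by fastforce
    qed
    moreover from this have "i - length p < j - length p" "j - length p < k - length p"
      "k - length p < length q" using ijk by linarith+
    ultimately show False
      using assms(2) ijk has_tripleI[of "i - length p" "j - length p" "k - length p" q R]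
      by (simp add: nth_append)
  qed
qed

abbreviation (input) pat_231 :: "nat \<Rightarrow> nat \<Rightarrow> nat \<Rightarrow> bool" where
  "pat_231 \<equiv> \<lambda>x y z. z < x \<and> x < y"

abbreviation (input) pat_321 :: "nat \<Rightarrow> nat \<Rightarrow> nat \<Rightarrow> bool" where
  "pat_321 \<equiv> \<lambda>x y z. z < y \<and> y < x"

lemma perms_231_iff: "p \<in> perms_231 n \<longleftrightarrow> p \<in> perms n \<and> \<not> has_triple pat_231 p"
  by (simp add: perms_231_def has_triple_def)

lemma perms_321_iff: "p \<in> perms_321 n \<longleftrightarrow> p \<in> perms n \<and> \<not> has_triple pat_321 p"
  by (simp add: perms_321_def has_triple_def)

lemma perm_oplus_231:
  "p \<in> perms_231 m \<Longrightarrow> q \<in> perms_231 n \<Longrightarrow> perm_oplus p q \<in> perms_231 (m + n)"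
  unfolding perms_231_iff
proof (elim conjE, rule conjI)
  assume "p \<in> perms m" "q \<in> perms n" "\<not> has_triple pat_231 p" "\<not> has_triple pat_231 q"
  then show "perm_oplus p q \<in> perms (m + n)" "\<not> has_triple pat_231 (perm_oplus p q)"
    using perm_oplus_separated perm_oplus_perms unfolding perm_oplus_def
    by (simp, intro no_triple_append) (auto simp: has_triple_map)
qed

lemma perm_oplus_321:
  "p \<in> perms_321 m \<Longrightarrow> q \<in> perms_321 n \<Longrightarrow> perm_oplus p q \<in> perms_321 (m + n)"
  unfolding perms_321_iff
proof (elim conjE, rule conjI)
  assume "p \<in> perms m" "q \<in> perms n" "\<not> has_triple pat_321 p" "\<not> has_triple pat_321 q"
  then show "perm_oplus p q \<in> perms (m + n)" "\<not> has_triple pat_321 (perm_oplus p q)"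
    using perm_oplus_separated perm_oplus_perms unfolding perm_oplus_def
    by (simp, intro no_triple_append) (auto simp: has_triple_map)
qed

subsection \<open>Avoiding 231\<close>

text \<open>A leading maximum could only play the part of the 2, which needs a larger value after
  it.\<close>

lemma lam_231_closed:
  assumes "p \<in> perms_231 n" shows "lam_231 p \<in> perms_231 (Suc n)"
proof -
  have p: "p \<in> perms n" "\<not> has_triple pat_231 p" "length p = n"
    using assms perms_length by (auto simp: perms_231_iff)
  have "\<not> has_triple pat_231 (Suc n # p)"
  proof
    assume "has_triple pat_231 (Suc n # p)"
    then obtain i j k where ijk: "i < j" "j < k" "k < Suc n"
      "pat_231 ((Suc n # p) ! i) ((Suc n # p) ! j) ((Suc n # p) ! k)"
      unfolding has_triple_def using p(3) by auto
    then obtain j' k' where j': "j = Suc j'" "k = Suc k'" by (cases j; cases k) auto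
    show False
    proof (cases i)
      case 0
      have "p ! j' \<in> set p" using j' ijk p(3) by simp
      then show False using 0 ijk j' p(1) by (simp add: perms_iff)
    next
      case (Suc i')
      then show False using p ijk j' has_tripleI[of i' j' k' p pat_231] by simp
    qed
  qed
  moreover have "Suc n # p \<in> perms (Suc n)"
    using p by (auto simp: perms_iff)
  ultimately show ?thesis using p by (simp add: perms_231_iff lam_231_def)
qed

text \<open>Let \<open>x\<close> be the first entry. A value below \<open>x\<close> after a value
  above \<open>x\<close> would give a 231, so all smaller values come first. They form
  \<open>u\<close> on \<open>{1..<x}\<close>, whence \<open>x = length u + 1\<close> and
  \<open>x # u = lam_231 u\<close> is the first summand.\<close>

lemma perms_231_decompose:
  assumes "t \<in> perms_231 (Suc n)"
  shows "\<exists>k l. \<exists>u\<in>perms_231 k. \<exists>v\<in>perms_231 l. t = perm_oplus (lam_231 u) v"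
proof -
  have t: "t \<in> perms (Suc n)" "\<not> has_triple pat_231 t" using assms by (auto simp: perms_231_iff)
  then obtain x p where xp: "t = x # p" using perms_length[of t "Suc n"] by (cases t) auto
  define u w where "u = takeWhile (\<lambda>y. y < x) p" and "w = dropWhile (\<lambda>y. y < x) p"
  have p: "p = u @ w" by (simp add: u_def w_def)
  have u_less: "y < x" if "y \<in> set u" for y using that by (auto simp: u_def dest: set_takeWhileD)
  have dist: "x \<notin> set u" "x \<notin> set w" "distinct u" using t xp p by (auto simp: perms_iff)
  have w_greater: "x < y" if y: "y \<in> set w" for y
  proof (rule ccontr)
    assume "\<not> x < y"
    then have "y < x" using y dist by (metis linorder_neqE_nat)
    obtain z ws where w: "w = z # ws" using y by (cases w) auto
    have "\<not> z < x" using w unfolding w_def by (metis hd_dropWhile list.sel(1) list.distinct(1))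
    then have z: "x < z" using w dist by auto
    then have "y \<in> set ws" using y w \<open>y < x\<close> by auto
    then obtain j where j: "j < length ws" "y = ws ! j" by (auto simp: in_set_conv_nth)
    have "has_triple pat_231 ([x] @ u @ z # ws)"
      by (rule has_tripleI[of 0 "Suc (length u)" "Suc (Suc (length u + j))"])
        (use j z \<open>y < x\<close> in \<open>auto simp: nth_append\<close>)
    then show False using t(2) xp p w by simp
  qed
  have set_t: "set t = insert x (set u \<union> set w)" "set t = {1..Suc n}"
    using t xp p by (auto simp: perms_iff)
  have "x \<in> {1..Suc n}" using set_t by blast
  have "set u = {1..<x}"
  proof (rule set_eqI)
    fix y
    have "y \<in> set t \<longleftrightarrow> 1 \<le> y \<and> y \<le> Suc n" unfolding set_t(2) by simp
    then show "y \<in> set u \<longleftrightarrow> y \<in> {1..<x}"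
      using set_t(1) u_less w_greater[of y] \<open>x \<in> {1..Suc n}\<close> by auto
  qed
  then have len: "length u = x - 1" using dist by (metis distinct_card card_atLeastLessThan)
  then have x: "x = length u + 1" using \<open>x \<in> {1..Suc n}\<close> by auto
  have "{1..<x} = {1..length u}" unfolding x by auto
  then have set_u: "set u = {1..length u}" using \<open>set u = {1..<x}\<close> by (rule trans[rotated])
  then have u: "u \<in> perms (length u)" unfolding perms_iff using dist(3) by blast
  have lam_u: "lam_231 u = x # u" using x by (simp add: lam_231_def)
  have "x # u \<in> perms x"
  proof -
    have "{1..x} = insert x {1..length u}" unfolding x by auto
    then show ?thesis unfolding perms_iff using dist(1,3) set_u by simp
  qed
  moreover have "(x # u) @ w \<in> perms (x + length w)"
    using t(1) perms_length[OF t(1)] unfolding xp p by (simp add: x)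
  ultimately obtain v where v: "v \<in> perms (length w)" "w = map (\<lambda>y. y + x) v"
    using perm_append_split by blast
  have "t = perm_oplus (lam_231 u) v" using xp p v(2) x lam_u by (simp add: perm_oplus_def)
  moreover have "\<not> has_triple pat_231 u" "\<not> has_triple pat_231 w"
    using t(2) has_triple_appendI1[of pat_231 "u" "w"] has_triple_appendI2[of pat_231 "p" "[x]"]
      has_triple_appendI2[of pat_231 "w" "u"] xp p by auto
  moreover from this(2) have "\<not> has_triple pat_231 v" unfolding v(2) has_triple_map by simp
  ultimately show ?thesis using u v(1) perms_231_iff by blast
qed

lemma perms_231_catalan: "catalan_structure perms_231 [] lam_231 perm_oplus"
proof (rule catalan_structureI)
  show "m = n" if "p \<in> perms_231 m" "p \<in> perms_231 n" for m n p
    using that perms_length unfolding perms_231_iff by blast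
  show "perms_231 0 = {[]}" by (auto simp: perms_231_iff has_triple_def)
  show "u = u' \<and> v = v'" if "perm_oplus (lam_231 u) v = perm_oplus (lam_231 u') v'" for u v u' v'
  proof -
    have "length u = length u'"
      using arg_cong[OF that, of hd] by (simp add: perm_oplus_def lam_231_def)
    then show ?thesis
      using that perm_oplus_cancel[of "lam_231 u" "lam_231 u'"] by (simp add: lam_231_def)
  qed
qed (use lam_231_closed perm_oplus_231 perms_231_decompose perm_oplus_assoc in auto)

text \<open>The maximum stands first, so any nonempty first summand contains it and already has full
  length.\<close>

lemma lam_231_indecomposable:
  assumes "u \<in> perms_231 n" shows "sum_indecomposable (lam_231 u)"
proof -
  have lam: "lam_231 u \<in> perms (Suc n)" and u: "length u = n"
    using assms lam_231_closed perms_length by (auto simp: perms_231_iff)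
  have False if qr: "q \<in> perms (length q)" "q \<noteq> []" "r \<noteq> []" "lam_231 u = perm_oplus q r" for q r
  proof -
    have "Suc n \<in> set q" using qr(2,4) u by (cases q) (auto simp: lam_231_def perm_oplus_def)
    then have "Suc n \<le> length q" using qr(1) by (auto simp: perms_iff)
    moreover have "Suc n = length q + length r"
      using arg_cong[OF qr(4), of length] u by (simp add: lam_231_def perm_oplus_def)
    ultimately show False using qr(3) by simp
  qed
  then show ?thesis
    using lam perms_length[OF lam] unfolding sum_indecomposable_def by (auto simp: lam_231_def)
qed

lemma perms_231_h_sends:
  assumes "n \<ge> 1"
  shows "catalan_data.h_sends perms_231 [] lam_231 perm_oplus n
    (perm_comp, perm_rmin) (perm_rmax, perm_nonrmin)"
proof -
  interpret catalan_structure perms_231 "[]" lam_231 perm_oplus by (rule perms_231_catalan)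
  have perms: "p \<in> perms (length p)" if "p \<in> carrier" for p
    using that perms_length by (auto simp: carrier_def perms_231_iff)
  have bound: "x \<le> length p" "p \<in> perms (length p)" if "p \<in> carrier" "x \<in> set p" for p x
    using perms[OF that(1)] that(2) by (auto simp: perms_iff)
  note comp = perm_comp_lam_oplus[OF perms_231_catalan lam_231_indecomposable]
  show ?thesis
  proof (rule h_sendsI[OF assms])
    show "perm_comp (lam_231 u) = 1" if "u \<in> carrier" for u
      using that comp(2) by (auto simp: carrier_def)
    show "perm_comp (perm_oplus (lam_231 u) v) = Suc (perm_comp v)"
      if "u \<in> carrier" "v \<in> carrier" for u v
      using that comp(1) by (auto simp: carrier_def)
    show "perm_rmax (lam_231 []) = 1" "perm_rmin (lam_231 []) = 1"
      by (simp_all add: lam_231_def perm_rmax_Cons perm_rmin_Cons)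
    show "perm_rmax (lam_231 u) = Suc (perm_rmax u)" if "u \<in> carrier" for u
      using bound(1)[OF that] by (auto simp: lam_231_def perm_rmax_Cons less_Suc_eq_le)
    show "perm_rmin (lam_231 u) = perm_rmin u" if "u \<in> carrier" "u \<noteq> []" for u
      using bound(1)[OF that(1), of "hd u"] that(2)
      by (auto simp: lam_231_def perm_rmin_Cons intro!: bexI[of _ "hd u"])
    show "perm_rmax (perm_oplus t u) = perm_rmax u" "perm_rmin (perm_oplus t u) = perm_rmin t + perm_rmin u"
      if "t \<in> carrier" "u \<in> carrier" "u \<noteq> []" for t u
      using that perms perm_rmax_oplus perm_rmin_oplus by blast+
    show "perm_nonrmin t = n + 1 - perm_rmin t" if "t \<in> perms_231 n" for t
      using that perms_length[of t n] by (simp add: perm_nonrmin_eq perms_231_iff)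
  qed
qed

subsection \<open>Avoiding 321\<close>

lemma foldr_min_less_iff: "m < foldr min xs N \<longleftrightarrow> m < N \<and> (\<forall>x\<in>set xs. m < (x::nat))"
  by (induction xs) auto

lemma foldr_min_ge_iff: "m \<le> foldr min xs N \<longleftrightarrow> m \<le> N \<and> (\<forall>x\<in>set xs. m \<le> (x::nat))"
  by (induction xs) auto

lemma foldr_min_le: "foldr min xs N \<le> (N::nat)" "x \<in> set xs \<Longrightarrow> foldr min xs N \<le> x"
  using foldr_min_ge_iff[of "foldr min xs N" xs N] by auto

lemma foldr_min_mem: "foldr min xs N \<in> insert (N::nat) (set xs)"
  by (induction xs) (auto simp: min_def)

lemma foldr_min_shift: "foldr min (map (\<lambda>x. x + k) xs) (N + k) = foldr min xs N + (k::nat)"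
  by (induction xs) auto

lemma foldr_min_perm:
  assumes "p \<in> perms n" shows "foldr min p (n + 1) = 1"
proof (rule antisym)
  show "foldr min p (n + 1) \<le> 1"
  proof (cases "n = 0")
    case False
    then have "1 \<in> set p" using assms by (simp add: perms_iff)
    then show ?thesis by (rule foldr_min_le(2))
  qed (use assms in simp)
  show "1 \<le> foldr min p (n + 1)"
    using assms unfolding foldr_min_ge_iff by (simp add: perms_iff)
qed

text \<open>Each entry contributes an up step, followed by as many down steps as the minimum of the
  remaining suffix increases; thus the peaks are the right-to-left minima.  The parameter \<open>N\<close> is
  the minimum assigned to the empty suffix.\<close>

primrec min_word :: "nat \<Rightarrow> nat list \<Rightarrow> step list" where
  "min_word N [] = []"
| "min_word N (x # xs) =
     U # replicate (foldr min xs N - foldr min (x # xs) N) D @ min_word N xs"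

definition perm_word :: "nat list \<Rightarrow> step list" where
  "perm_word p = min_word (length p + 1) p"

text \<open>The suffix \<open>ys\<close> influences the word of \<open>xs\<close> only through its
  minimum, which takes over the role of \<open>N\<close>.\<close>

lemma min_word_append:
  "min_word N (xs @ ys) = min_word (foldr min ys N) xs @ min_word N ys"
  by (induction xs) auto

lemma min_word_shift: "min_word (N + k) (map (\<lambda>x. x + k) xs) = min_word N xs"
  by (induction xs) (auto simp: foldr_min_shift min_add_distrib_left[symmetric])

lemma count_list_replicate: "count_list (replicate n x) y = (if x = y then n else 0)"
  by (induction n) auto

lemma count_min_word:
  "count_list (min_word N xs) U = length xs"
  "count_list (min_word N xs) D = N - foldr min xs N"
proof (induction xs)
  case (Cons x xs)
  {
    case 1 then show ?case using Cons by (simp add: count_list_replicate)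
  next
    case 2 then show ?case
      using Cons foldr_min_le(1)[of xs N] by (simp add: count_list_replicate)
  }
qed simp_all

text \<open>Heights are lowest at the ends of the \<open>D\<close> runs, and there the runs have
  telescoped into the rise of the suffix minimum. The number \<open>c\<close> is the height reached
  before \<open>xs\<close>; the induction passes from \<open>c\<close> to
  \<open>c + 1 - d\<close>.\<close>

lemma min_word_heights:
  fixes c :: int
  assumes "\<And>as bs. xs = as @ bs \<Longrightarrow>
      c + int (length as) \<ge> int (foldr min bs N) - int (foldr min xs N)"
    and "min_word N xs = x @ y"
  shows "c + height x \<ge> 0"
  using assms
proof (induction xs arbitrary: c x)
  case Nil
  then show ?case using Nil.prems(1)[of "[]" "[]"] by simp
next
  case (Cons z zs)
  define d where "d = foldr min zs N - foldr min (z # zs) N"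
  have d: "int d = int (foldr min zs N) - int (foldr min (z # zs) N)"
    by (simp add: d_def)
  have c: "c \<ge> 0" using Cons.prems(1)[of "[]" "z # zs"] by simp
  have cd: "c + 1 - int d \<ge> 0" using Cons.prems(1)[of "[z]" zs] d by simp
  have hr: "height (replicate i D) = - int i" for i by (induction i) auto
  have eq: "U # replicate d D @ min_word N zs = x @ y"
    using Cons.prems(2) by (simp add: d_def)
  show ?case
  proof (cases x)
    case Nil
    then show ?thesis using c by simp
  next
    case (Cons s x')
    then have s: "s = U" and "replicate d D @ min_word N zs = x' @ y" using eq by auto
    then obtain us where us: "replicate d D = x' @ us \<and> us @ min_word N zs = y \<or>
        replicate d D @ us = x' \<and> min_word N zs = us @ y"
      by (auto simp: append_eq_append_conv2)
    then show ?thesis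
    proof
      assume *: "replicate d D = x' @ us \<and> us @ min_word N zs = y"
      then have "x' = replicate (length x') D" "length x' \<le> d"
        by (metis append_eq_conv_conj take_replicate length_replicate min.commute length_append le_add1 min_absorb1)+
      then have "height x' \<ge> - int d" using hr[of "length x'"] by simp
      then show ?thesis using Cons s cd by simp
    next
      assume *: "replicate d D @ us = x' \<and> min_word N zs = us @ y"
      have "(c + 1 - int d) + height us \<ge> 0"
      proof (rule Cons.IH)
        show "min_word N zs = us @ y" using * by simp
        show "c + 1 - int d + int (length as) \<ge> int (foldr min bs N) - int (foldr min zs N)"
          if "zs = as @ bs" for as bs
          using Cons.prems(1)[of "z # as" bs] that d by simp
      qed
      moreover have "height x = 1 - int d + height us"
        using * hr[of d] s \<open>x = s # x'\<close> by auto
      ultimately show ?thesis by simp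
    qed
  qed
qed

lemma perm_word_dyck:
  assumes "p \<in> perms n" shows "perm_word p \<in> dyck_paths n"
proof -
  note len = perms_length[OF assms]
  have "int (length as) \<ge> int (foldr min bs (n + 1)) - int (foldr min p (n + 1))"
    if p: "p = as @ bs" for as bs
  proof -
    \<comment> \<open>Values below the minimum of the suffix \<open>bs\<close> must have occurred in
      \<open>as\<close>, which bounds the down steps so far by the up steps.\<close>
    have "{1..<foldr min bs (n + 1)} \<subseteq> set as"
    proof
      fix v assume v: "v \<in> {1..<foldr min bs (n + 1)}"
      then have "v < n + 1" "v \<notin> set bs" using foldr_min_less_iff[of v bs "n + 1"] by auto
      then show "v \<in> set as" using v assms unfolding p perms_iff by auto
    qed
    then have "card {1..<foldr min bs (n + 1)} \<le> length as"
      using card_mono[of "set as"] card_length[of as] by (meson List.finite_set le_trans)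
    then show ?thesis using foldr_min_perm[OF assms] by simp
  qed
  then have "height x \<ge> 0" if "perm_word p = x @ y" for x y
    using min_word_heights[where xs = p and c = 0 and N = "n + 1" and x = x and y = y] that
    by (simp add: perm_word_def len)
  then show ?thesis
    unfolding dyck_paths_iff
    using count_min_word[of "n + 1" p] foldr_min_perm[OF assms]
    by (simp add: perm_word_def len height_def)
qed

lemma min_word_hd: "min_word N xs = [] \<or> hd (min_word N xs) = U"
  by (cases xs) auto

lemma replicate_D_append_cancel:
  assumes "replicate a D @ v = replicate b D @ w" "v = [] \<or> hd v = U" "w = [] \<or> hd w = U"
  shows "a = b \<and> v = w"
proof -
  have "takeWhile (\<lambda>s. s = D) (replicate a D @ v) = replicate a D" if "v = [] \<or> hd v = U" for a v
    using that by (cases v) (auto simp: takeWhile_append)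
  then have "replicate a D = replicate b D" using assms by metis
  then show ?thesis using assms(1) by (auto simp: replicate_eq_replicate)
qed

text \<open>For arbitrary lists only the length and the suffix minima are recovered; avoiding 321 is
  what later makes them determine the entries.\<close>

lemma min_word_inj:
  assumes "min_word N p = min_word N q"
  shows "length p = length q \<and> (\<forall>i. foldr min (drop i p) N = foldr min (drop i q) N)"
  using assms
proof (induction p arbitrary: q)
  case Nil
  then show ?case by (cases q) auto
next
  case (Cons x xs)
  then obtain y ys where q: "q = y # ys" by (cases q) auto
  have "foldr min xs N - foldr min (x # xs) N = foldr min ys N - foldr min (y # ys) N \<and>
      min_word N xs = min_word N ys"
    using Cons.prems min_word_hd unfolding q by (intro replicate_D_append_cancel) simp_all
  then have eq: "foldr min xs N - foldr min (x # xs) N = foldr min ys N - foldr min (y # ys) N"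
    and IH: "length xs = length ys" "\<And>i. foldr min (drop i xs) N = foldr min (drop i ys) N"
    using Cons.IH by auto
  have "foldr min (x # xs) N = foldr min (y # ys) N"
    using eq IH(2)[of 0] by simp
  moreover have "foldr min (drop (Suc i) (x # xs)) N = foldr min (drop (Suc i) (y # ys)) N" for i
    using IH(2) by simp
  ultimately have "foldr min (drop i (x # xs)) N = foldr min (drop i (y # ys)) N" for i
    by (cases i) simp_all
  then show ?case using IH(1) q by simp
qed

lemma rtl_min_iff_foldr:
  assumes "i < length p" "\<forall>x\<in>set p. x < N"
  shows "is_rtl_min p i \<longleftrightarrow> p ! i < foldr min (drop (Suc i) p) N"
proof -
  have "(\<forall>x\<in>set (drop (Suc i) p). p ! i < x) \<longleftrightarrow> is_rtl_min p i"
  proof -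
    have "(\<forall>x\<in>set (drop (Suc i) p). p ! i < x) \<longleftrightarrow> (\<forall>k<length p - Suc i. p ! i < p ! (Suc i + k))"
      using assms(1) by (simp add: all_set_conv_all_nth)
    also have "\<dots> \<longleftrightarrow> is_rtl_min p i"
    proof
      assume *: "\<forall>k<length p - Suc i. p ! i < p ! (Suc i + k)"
      show "is_rtl_min p i"
        unfolding is_rtl_min_def
      proof (intro allI impI)
        fix j assume j: "i < j \<and> j < length p"
        then have "j - Suc i < length p - Suc i" by linarith
        then show "p ! i < p ! j" using *[rule_format, of "j - Suc i"] j by simp
      qed
    qed (simp add: is_rtl_min_def)
    finally show ?thesis .
  qed
  then show ?thesis using assms by (simp add: foldr_min_less_iff)
qed

lemma drop_foldr_min:
  "i < length p \<Longrightarrow> foldr min (drop i p) N = min (p ! i) (foldr min (drop (Suc i) p) N)"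
  by (simp add: Cons_nth_drop_Suc[symmetric])

text \<open>If \<open>p ! i\<close> were larger, it would form a 321 with \<open>p ! j\<close> and a
  smaller entry to the right of \<open>j\<close>.\<close>

lemma non_rtl_min_greater:
  assumes "p \<in> perms_321 n" "i < j" "j < n" "\<not> is_rtl_min p j"
  shows "p ! i < p ! j"
proof (rule ccontr)
  assume "\<not> p ! i < p ! j"
  have p: "distinct p" "length p = n" "\<not> has_triple pat_321 p"
    using assms(1) perms_length[of p n] by (auto simp: perms_321_iff perms_iff)
  obtain k where k: "j < k" "k < n" "p ! k \<le> p ! j"
    using assms(4) p(2) unfolding is_rtl_min_def by (meson leI)
  then have "p ! k < p ! j" "p ! j < p ! i"
    using p(1,2) assms(2,3) \<open>\<not> p ! i < p ! j\<close> by (simp_all add: nth_eq_iff_index_eq less_le)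
  then show False using has_tripleI[of i j k p pat_321] p assms k by simp
qed

text \<open>The suffix minima jump exactly at the right-to-left minima and give their values there.
  The other entries form an increasing sequence, so their values are determined as well.\<close>

lemma perm_word_inj: "inj_on perm_word (perms_321 n)"
proof (rule inj_onI)
  fix p q assume pq: "p \<in> perms_321 n" "q \<in> perms_321 n" and eq: "perm_word p = perm_word q"
  have facts: "distinct p \<and> length p = n \<and> (\<forall>x\<in>set p. x < n + 1) \<and> set p = {1..n}"
    if "p \<in> perms_321 n" for p
    using that perms_length[of p n] by (auto simp: perms_321_iff perms_iff)
  note P = facts[OF pq(1)] and Q = facts[OF pq(2)]
  have mins: "foldr min (drop i p) (n + 1) = foldr min (drop i q) (n + 1)" for i
    using eq P Q min_word_inj[of "n + 1" p q] unfolding perm_word_def by simp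
  have rtl_val: "is_rtl_min p i \<Longrightarrow> p ! i = foldr min (drop i p) (n + 1)"
    if "i < n" "p \<in> perms_321 n" for p i
    using rtl_min_iff_foldr[of i p "n + 1"] facts[OF that(2)] that(1) drop_foldr_min[of i p "n + 1"] by simp
  have rtl_iff: "is_rtl_min p i \<longleftrightarrow> foldr min (drop i p) (n + 1) < foldr min (drop (Suc i) p) (n + 1)"
    if "i < n" "p \<in> perms_321 n" for p i
    using rtl_min_iff_foldr[of i p "n + 1"] facts[OF that(2)] that(1) drop_foldr_min[of i p "n + 1"]
    by (simp add: min_less_iff_disj)
  have rtl: "is_rtl_min p i \<longleftrightarrow> is_rtl_min q i" "is_rtl_min p i \<Longrightarrow> p ! i = q ! i" if "i < n" for i
    using rtl_iff rtl_val pq that mins by metis+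
  \<comment> \<open>At the first difference the smaller value \<open>p ! i\<close> has to occur in
    \<open>q\<close> at some \<open>k > i\<close>, where \<open>q\<close> has no right-to-left
    minimum, since \<open>p\<close> and \<open>q\<close> agree at those. Then
    \<open>q ! i < q ! k = p ! i\<close>.\<close>
  have step: False if *: "p \<in> perms_321 n" "q \<in> perms_321 n" "i < n" "p ! i < q ! i"
      "\<forall>j<i. p ! j = q ! j" "\<not> is_rtl_min q i"
      "\<forall>k<n. is_rtl_min q k \<longrightarrow> p ! k = q ! k" for p q i
  proof -
    have "p ! i \<in> set q" using facts[OF *(1)] facts[OF *(2)] *(3) by (metis nth_mem)
    then obtain k where k: "k < n" "q ! k = p ! i" using facts[OF *(2)] unfolding in_set_conv_nth by blast
    have "k \<noteq> i" using k * by auto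
    then have "p ! k \<noteq> p ! i" using facts[OF *(1)] k *(3) by (simp add: nth_eq_iff_index_eq)
    then have "\<not> k < i" "\<not> is_rtl_min q k" using k * by auto
    then have "q ! i < q ! k" using non_rtl_min_greater[OF *(2), of i k] k \<open>k \<noteq> i\<close> by simp
    then show False using k *(4) by simp
  qed
  have "p ! i = q ! i" if "i < n" for i
    using that
  proof (induction i rule: less_induct)
    case (less i)
    then have eq: "\<forall>j<i. p ! j = q ! j" "\<forall>j<i. q ! j = p ! j" by simp_all
    have same: "\<forall>k<n. is_rtl_min q k \<longrightarrow> p ! k = q ! k" "\<forall>k<n. is_rtl_min p k \<longrightarrow> q ! k = p ! k"
      using rtl by auto
    show ?case
    proof (cases "is_rtl_min p i")
      case True
      then show ?thesis using rtl less.prems by blast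
    next
      case False
      then have "\<not> is_rtl_min q i" using rtl less.prems by blast
      then show ?thesis
        using step[OF pq less.prems _ eq(1) _ same(1)] step[OF pq(2,1) less.prems _ eq(2) False same(2)]
        by (metis linorder_neqE_nat)
    qed
  qed
  then show "p = q" using P Q by (intro nth_equalityI) auto
qed

lemma perm_word_oplus:
  assumes "p \<in> perms m" "q \<in> perms n"
  shows "perm_word (perm_oplus p q) = perm_word p @ perm_word q"
proof -
  define q' where "q' = map (\<lambda>x. x + m) q"
  \<comment> \<open>The minimum of the shifted \<open>q\<close> is exactly the bound that
    \<open>perm_word p\<close> assigns to its empty suffix.\<close>
  have "foldr min q' (n + 1 + m) = 1 + m"
    unfolding q'_def foldr_min_shift foldr_min_perm[OF assms(2)] by simp
  moreover have "min_word (n + 1 + m) q' = min_word (n + 1) q"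
    unfolding q'_def by (rule min_word_shift)
  moreover have "perm_word (perm_oplus p q) = min_word (n + 1 + m) (p @ q')"
    using assms[THEN perms_length] by (simp add: perm_word_def perm_oplus_def q'_def add.commute)
  ultimately show ?thesis
    using assms[THEN perms_length] by (simp add: min_word_append perm_word_def)
qed

lemma dyck_peak_replicate_D: "dyck_peak (replicate d D @ w) = dyck_peak w"
  by (induction d) auto

text \<open>The \<open>U\<close> of an entry is followed by a \<open>D\<close> exactly when the
  entry lies below all later ones; the bound \<open>N\<close> makes this true of the last entry
  too.\<close>

lemma dyck_peak_min_word: "\<forall>x\<in>set xs. x < N \<Longrightarrow> dyck_peak (min_word N xs) = perm_rmin xs"
proof (induction xs)
  case (Cons x xs)
  define d where "d = foldr min xs N - foldr min (x # xs) N"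
  have "d > 0 \<longleftrightarrow> (\<forall>y\<in>set xs. x < y)"
    using Cons.prems foldr_min_less_iff[of x xs N] by (auto simp: d_def)
  moreover have "dyck_peak (U # replicate d D @ min_word N xs) =
      (if d > 0 then 1 else 0) + dyck_peak (min_word N xs)"
  proof (cases d)
    case 0
    then show ?thesis using min_word_hd[of N xs] by auto
  next
    case (Suc e)
    have "dyck_peak (U # D # replicate e D @ min_word N xs) = 1 + dyck_peak (min_word N xs)"
      by (simp add: dyck_peak_replicate_D)
    then show ?thesis using Suc by simp
  qed
  ultimately show ?case using Cons by (simp add: d_def perm_rmin_Cons)
qed simp

text \<open>The last entry raises the suffix minimum from \<open>last p\<close> to the bound
  \<open>n + 1\<close>, which fixes the length of the final run.\<close>

lemma perm_rcomp_word:
  assumes "p \<in> perms n" "n \<ge> 1" shows "perm_rcomp p = dyck_rcomp (perm_word p)"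
proof -
  have len: "length p = n" "p \<noteq> []" using assms perms_length[of p n] by auto
  have "last p \<in> set p" using len by simp
  then have last: "last p \<le> n" using assms(1) by (simp add: perms_iff)
  have "perm_word p = min_word (n + 1) (butlast p @ [last p])"
    using len by (simp add: perm_word_def)
  also have "\<dots> = min_word (last p) (butlast p) @ U # replicate (n + 1 - last p) D"
    unfolding min_word_append using last by simp
  finally have "rev (perm_word p) = replicate (n + 1 - last p) D @ U # rev (min_word (last p) (butlast p))"
    by simp
  then show ?thesis
    using last len by (simp add: dyck_rcomp_def perm_rcomp_def takeWhile_append)
qed

section \<open>The cyclic shift of \<open>lam_321\<close> and its effect on suffix minima\<close>

lemma length_fold_list_update:
  "length (fold (\<lambda>(p, x) ys. ys[p := x]) pxs xs) = length xs"
  by (induction pxs arbitrary: xs) auto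

lemma nth_fold_list_update_other:
  "l \<notin> set ps \<Longrightarrow> fold (\<lambda>(p, x) ys. ys[p := x]) (zip ps vs) xs ! l = xs ! l"
proof (induction ps arbitrary: vs xs)
  case (Cons p ps)
  then show ?case by (cases vs) auto
qed simp

lemma nth_fold_list_update:
  assumes "distinct ps" "length vs = length ps" "k < length ps" "ps ! k < length xs"
  shows "fold (\<lambda>(p, x) ys. ys[p := x]) (zip ps vs) xs ! (ps ! k) = vs ! k"
  using assms
proof (induction ps arbitrary: vs xs k)
  case (Cons p ps)
  then obtain v vs' where vs: "vs = v # vs'" by (cases vs) auto
  show ?case
  proof (cases k)
    case 0
    then show ?thesis using Cons.prems vs by (simp add: nth_fold_list_update_other)
  next
    case (Suc k')
    then show ?thesis using Cons vs by simp
  qed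
qed simp

text \<open>In a 321-avoiding permutation every entry that is not a right-to-left minimum is a
  left-to-right maximum.  Hence \<open>lam_321\<close> moves the right-to-left minima one position to the right,
  keeps their values, and arranges the remaining values together with \<open>n + 1\<close> increasingly.\<close>

locale lam_321_setup =
  fixes p :: "nat list" and n :: nat
  assumes p: "p \<in> perms_321 n" and n: "n \<ge> 1"
begin

lemma p_facts: "p \<in> perms n" "distinct p" "length p = n" "set p = {1..n}" "p \<noteq> []"
  using p n perms_length[of p n] by (auto simp: perms_321_iff perms_iff)

lemma nth_bounds: "j < n \<Longrightarrow> 1 \<le> p ! j \<and> p ! j \<le> n"
  using p_facts(3,4) nth_mem[of j p] by simp

definition i where "i = pos_of_1 p"

lemma i: "i < n" "p ! i = 1"
proof -
  have "1 \<in> set p" using p_facts(4) n by simp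
  then obtain j where j: "j < n" "p ! j = 1" using p_facts(3) unfolding in_set_conv_nth by blast
  have "i = j" unfolding i_def pos_of_1_def
    by (rule the_equality) (use j p_facts(2,3) in \<open>auto simp: nth_eq_iff_index_eq[symmetric]\<close>)
  then show "i < n" "p ! i = 1" using j by auto
qed

lemma nth_eq_1: "j < n \<Longrightarrow> p ! j = 1 \<Longrightarrow> j = i"
  using i p_facts(2,3) by (metis nth_eq_iff_index_eq)

lemma nth_gt_1: "j < n \<Longrightarrow> j \<noteq> i \<Longrightarrow> 1 < p ! j"
  using nth_eq_1[of j] nth_bounds[of j] by linarith

lemma rtl_i: "is_rtl_min p i"
  unfolding is_rtl_min_def using nth_gt_1 i p_facts(3) by auto

lemma not_rtl_before_i: "j < i \<Longrightarrow> \<not> is_rtl_min p j"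
  unfolding is_rtl_min_def using i p_facts(3) nth_bounds[of j] by (auto intro!: exI[of _ i])

definition B where "B = boxed_positions p"

text \<open>By \<open>non_rtl_min_greater\<close> an entry that is no right-to-left minimum exceeds
  everything before it.\<close>

lemma B_eq: "B = {j. i < j \<and> j < n \<and> \<not> is_rtl_min p j}"
proof -
  have "is_ltr_max p j" if "j < n" "\<not> is_rtl_min p j" for j
    unfolding is_ltr_max_def using non_rtl_min_greater[OF p] that by blast
  then show ?thesis unfolding B_def boxed_positions_def i_def p_facts(3) by blast
qed

definition bs where "bs = sorted_list_of_set B"

lemma bs: "set bs = B" "sorted_wrt (<) bs" "distinct bs"
proof -
  have "finite B" unfolding B_eq by simp
  then show "set bs = B" "sorted_wrt (<) bs" "distinct bs" by (auto simp: bs_def)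
qed

lemma bs_mem: "j \<in> set bs \<longleftrightarrow> i < j \<and> j < n \<and> \<not> is_rtl_min p j"
  unfolding bs(1) B_eq by simp

text \<open>The boxed positions after the insertion. In \<open>vs\<close> stand the values they hold
  after the shift: the inserted \<open>n + 1\<close> occupied the first of them and wraps to the
  last.\<close>

definition ps where "ps = i # map Suc bs"
definition vs where "vs = map ((!) p) bs @ [n + 1]"

lemma sorted_ps: "sorted_wrt (<) ps"
  using bs(2) by (auto simp: ps_def sorted_wrt_map bs_mem)

lemma ps_less: "x \<in> set ps \<Longrightarrow> x < n + 1"
  using i(1) by (auto simp: ps_def bs_mem)

lemma length_ps: "length ps = length bs + 1" "length vs = length bs + 1"
  by (simp_all add: ps_def vs_def)

definition L where "L = lam_321 p"

lemma L_eq: "L = fold (\<lambda>(p, x) ys. ys[p := x]) (zip ps vs) (insert_at i (n + 1) p)"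
proof -
  have "set ps = insert i (Suc ` B)" using bs(1) by (simp add: ps_def)
  then have ps: "sorted_list_of_set (insert i (Suc ` B)) = ps"
    using sorted_ps by (metis sorted_list_of_set.idem_if_sorted_distinct strict_sorted_iff)
  have at: "insert_at i (n + 1) p ! i = n + 1" "insert_at i (n + 1) p ! Suc j = p ! j" if "i \<le> j" "j < n" for j
    using i that p_facts(3) by (simp_all add: insert_at_def nth_append nth_Cons')
  have "map ((!) (insert_at i (n + 1) p)) (map Suc bs) = map ((!) p) bs"
    using at by (auto simp: bs_mem)
  then have "rotate1 (map ((!) (insert_at i (n + 1) p)) ps) = vs"
    using at(1)[of i] i by (simp add: ps_def vs_def)
  then show ?thesis
    using p_facts(3,5) ps
    by (simp add: L_def lam_321_def cyclic_shift_left_def Let_def i_def[symmetric] B_def[symmetric])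
qed

lemma length_L: "length L = n + 1"
  using i p_facts(3) by (simp add: L_eq length_fold_list_update insert_at_def)

lemma L_before: "l < i \<Longrightarrow> L ! l = p ! l"
  using sorted_ps i p_facts(3)
  by (subst L_eq, subst nth_fold_list_update_other) (auto simp: ps_def insert_at_def nth_append)

lemma L_rtl:
  assumes "i \<le> j" "j < n" "is_rtl_min p j" shows "L ! Suc j = p ! j"
proof -
  have "Suc j \<notin> set ps" using assms by (auto simp: ps_def bs_mem)
  then show ?thesis
    using assms i p_facts(3)
    by (simp add: L_eq nth_fold_list_update_other) (simp add: insert_at_def nth_append nth_Cons')
qed

lemma L_ps: "k \<le> length bs \<Longrightarrow> L ! (ps ! k) = vs ! k"
  unfolding L_eq
  by (rule nth_fold_list_update)
    (use sorted_ps length_ps i p_facts(3) ps_less[of "ps ! k"]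
      in \<open>auto simp: strict_sorted_iff insert_at_def\<close>)

lemma L_bs:
  assumes "j \<in> B" shows "\<exists>k<length bs. j = bs ! k \<and> L ! (ps ! k) = p ! j \<and> ps ! Suc k = Suc j"
proof -
  obtain k where k: "k < length bs" "j = bs ! k"
    using assms bs(1) unfolding set_conv_nth by blast
  then show ?thesis using L_ps[of k] by (intro exI[of _ k]) (simp add: vs_def ps_def nth_append)
qed

text \<open>The positions before \<open>i\<close> together with the boxed ones. The remaining
  positions are \<open>Suc j\<close> for right-to-left minima \<open>j\<close> of \<open>p\<close>,
  so \<open>L\<close> is increasing on \<open>cs\<close> and on its complement.\<close>

definition cs where "cs = [0..<i] @ ps"
definition ws where "ws = map ((!) p) ([0..<i] @ bs) @ [n + 1]"

lemma sorted_cs: "sorted_wrt (<) cs"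
proof -
  have "i \<le> x" if "x \<in> set ps" for x
    using that by (auto simp: ps_def bs_mem)
  then show ?thesis using sorted_ps by (force simp: cs_def sorted_wrt_append)
qed

text \<open>Entries before position \<open>i\<close> precede the value 1 and so are no right-to-left
  minima; hence \<open>non_rtl_min_greater\<close> orders them and the boxed entries alike, and
  \<open>n + 1\<close> exceeds them all.\<close>

lemma sorted_ws: "sorted_wrt (<) ws"
proof -
  have non_rtl: "\<not> is_rtl_min p x" "x < n" if "x \<in> set ([0..<i] @ bs)" for x
    using that i(1) not_rtl_before_i[of x] by (auto simp: bs_mem)
  have "sorted_wrt (<) ([0..<i] @ bs)"
    using bs(2) by (auto simp: sorted_wrt_append bs_mem)
  then have "sorted_wrt (\<lambda>x y. p ! x < p ! y) ([0..<i] @ bs)"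
    by (rule sorted_wrt_mono_rel[rotated]) (use non_rtl non_rtl_min_greater[OF p] in blast)
  then have "sorted_wrt (<) (map ((!) p) ([0..<i] @ bs))" by (simp only: sorted_wrt_map)
  moreover have "x < n + 1" if "x \<in> set (map ((!) p) ([0..<i] @ bs))" for x
    using that non_rtl(2) nth_bounds by (auto simp: less_Suc_eq_le)
  ultimately show ?thesis unfolding ws_def sorted_wrt_append by simp
qed

lemma length_cs: "length cs = length ws"
  by (simp add: cs_def ws_def ps_def)

lemma L_cs: "k < length cs \<Longrightarrow> L ! (cs ! k) = ws ! k"
proof (cases "k < i")
  case True
  then show ?thesis using L_before[of k] by (simp add: cs_def ws_def nth_append)
next
  case False
  assume "k < length cs"
  then have "k - i \<le> length bs" using False length_ps by (simp add: cs_def)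
  then show ?thesis using L_ps[of "k - i"] False
    by (simp add: cs_def ws_def vs_def nth_append)
qed

lemma L_increasing:
  assumes "x \<in> set cs" "y \<in> set cs" "x < y" shows "L ! x < L ! y"
proof -
  obtain k l where kl: "k < length cs" "x = cs ! k" "l < length cs" "y = cs ! l"
    using assms unfolding in_set_conv_nth by blast
  have "k < l"
  proof (rule ccontr)
    assume "\<not> k < l"
    then have "cs ! l \<le> cs ! k"
      using sorted_cs kl by (cases "k = l") (auto simp: sorted_wrt_iff_nth_less intro: less_imp_le)
    then show False using kl assms(3) by simp
  qed
  then have "ws ! k < ws ! l" using sorted_ws kl length_cs by (simp add: sorted_wrt_iff_nth_less)
  then show ?thesis using L_cs kl by simp
qed

lemma not_cs:
  assumes "l < n + 1" "l \<notin> set cs"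
  obtains j where "l = Suc j" "i \<le> j" "j < n" "is_rtl_min p j"
proof -
  have "i < l" using assms(2) by (auto simp: cs_def ps_def intro: linorder_neqE_nat)
  then obtain j where j: "l = Suc j" "i \<le> j" "j < n" using assms(1) by (cases l) auto
  have "j \<notin> B" using assms(2) bs(1) j by (auto simp: cs_def ps_def)
  then have "is_rtl_min p j" using B_eq j rtl_i by (cases "j = i") auto
  then show ?thesis using that j by blast
qed

lemma L_increasing_rtl:
  assumes "l \<notin> set cs" "l' \<notin> set cs" "l < l'" "l' < n + 1" shows "L ! l < L ! l'"
proof -
  obtain j where j: "l = Suc j" "i \<le> j" "j < n" "is_rtl_min p j"
    using not_cs[of l] assms by auto
  obtain j' where j': "l' = Suc j'" "i \<le> j'" "j' < n" "is_rtl_min p j'"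
    using not_cs[of l'] assms by auto
  have "p ! j < p ! j'" using j(4) j j' assms(3) p_facts(3) unfolding is_rtl_min_def by simp
  then show ?thesis using L_rtl j j' by simp
qed

text \<open>A union of two increasing sequences contains no 321.\<close>

lemma L_avoids: "\<not> has_triple pat_321 L"
proof
  assume "has_triple pat_321 L"
  then obtain a b c where abc: "a < b" "b < c" "c < n + 1" "L ! c < L ! b" "L ! b < L ! a"
    unfolding has_triple_def length_L by blast
  \<comment> \<open>Of three positions two belong to the same class, and any two positions of a 321
    form an inversion.\<close>
  have "\<exists>x y. x < y \<and> y < n + 1 \<and> L ! y < L ! x \<and> (x \<in> set cs \<longleftrightarrow> y \<in> set cs)"
    using abc by (metis less_trans)
  then show False using L_increasing L_increasing_rtl by (metis less_asym)
qed

lemma L_perm: "L \<in> perms (Suc n)"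
proof -
  have "v \<in> set L" if v: "v \<in> {1..Suc n}" for v
  proof (cases "v = Suc n")
    case True
    have "L ! (ps ! length bs) = Suc n" using L_ps[of "length bs"] by (simp add: vs_def nth_append)
    moreover have "ps ! length bs < length L"
      using ps_less[of "ps ! length bs"] length_ps length_L by simp
    ultimately show ?thesis using True by (metis nth_mem)
  next
    case False
    then have "v \<in> set p" using v p_facts(4) by auto
    then obtain j where j: "j < n" "v = p ! j" using p_facts(3) unfolding in_set_conv_nth by blast
    have "\<exists>l<n + 1. L ! l = v"
    proof (cases "j < i")
      case True
      then show ?thesis using L_before j by (intro exI[of _ j]) simp
    next
      case False
      show ?thesis
      proof (cases "j \<in> B")
        case True
        then obtain k where "k < length bs" "L ! (ps ! k) = p ! j" using L_bs by blast
        moreover from this have "ps ! k < n + 1" using length_ps by (intro ps_less) simp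
        ultimately show ?thesis using j by blast
      next
        case nB: False
        then have "is_rtl_min p j" using B_eq j False rtl_i by (cases "j = i") auto
        then show ?thesis using L_rtl False j by (intro exI[of _ "Suc j"]) simp
      qed
    qed
    then show ?thesis using length_L by (metis nth_mem)
  qed
  then show ?thesis using length_L by (auto simp: perms_iff_length)
qed

text \<open>A right-to-left minimum keeps its value under the offset; at a boxed position the value
  \<open>p ! l\<close> has moved to the previous box, and a larger one replaces it.\<close>

lemma L_ge: assumes "i \<le> l" "l < n" shows "p ! l \<le> L ! Suc l"
proof (cases "is_rtl_min p l")
  case True
  then show ?thesis using L_rtl assms by simp
next
  case False
  then have "l \<in> B" using assms rtl_i by (cases "l = i") (auto simp: B_eq)
  then obtain k where k: "k < length bs" "L ! (ps ! k) = p ! l" "ps ! Suc k = Suc l"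
    using L_bs by blast
  have "ps ! k < ps ! Suc k" "ps ! k \<in> set ps" "ps ! Suc k \<in> set ps"
    using sorted_ps k(1) length_ps by (simp_all add: sorted_wrt_iff_nth_less)
  then have "L ! (ps ! k) < L ! (ps ! Suc k)" by (intro L_increasing) (simp_all add: cs_def)
  then show ?thesis using k by simp
qed

text \<open>The minimum of a suffix of \<open>p\<close> is attained at a right-to-left minimum,
  which \<open>L\<close> keeps one place further right; \<open>L_ge\<close> excludes smaller values.
  The bounds \<open>n + 2\<close> and \<open>n + 1\<close> are those of \<open>perm_word\<close> for
  the two lengths.\<close>

lemma L_suffix_min:
  assumes k: "k < n"
  shows "foldr min (drop (Suc k) L) (n + 2) = foldr min (drop k p) (n + 1)"
proof -
  define m where "m = foldr min (drop k p) (n + 1)"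
  have le: "m \<le> p ! l" if "k \<le> l" "l < n" for l
  proof -
    have "p ! l \<in> set (drop k p)"
      using that p_facts(3) by (auto simp: in_set_conv_nth intro!: exI[of _ "l - k"])
    then show ?thesis unfolding m_def by (rule foldr_min_le(2))
  qed
  have "m \<noteq> n + 1" using le[of k] nth_bounds[of k] k by simp
  then have "m \<in> set (drop k p)" using foldr_min_mem[of "drop k p" "n + 1"] by (simp add: m_def)
  then obtain t where "t < n - k" "m = p ! (k + t)"
    using p_facts(3) k by (auto simp: in_set_conv_nth)
  then obtain j where j: "k \<le> j" "j < n" "m = p ! j"
    using that[of "k + t"] by simp
  have rtl: "is_rtl_min p j"
    unfolding is_rtl_min_def
  proof (intro allI impI)
    fix l assume l: "j < l \<and> l < length p"
    then have "p ! j \<noteq> p ! l" using p_facts(2) j(2) by (simp add: nth_eq_iff_index_eq)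
    moreover have "p ! j \<le> p ! l" using le[of l] l j p_facts(3) by simp
    ultimately show "p ! j < p ! l" by simp
  qed
  then have "i \<le> j" using not_rtl_before_i not_le by blast
  then have "L ! Suc j = m" using L_rtl rtl j by simp
  moreover have "L ! Suc j \<in> set (drop (Suc k) L)"
    using j length_L by (auto simp: in_set_conv_nth intro!: exI[of _ "j - k"])
  ultimately have upper: "foldr min (drop (Suc k) L) (n + 2) \<le> m"
    using foldr_min_le(2) by metis
  have "m \<le> x" if x: "x \<in> set (drop (Suc k) L)" for x
  proof -
    obtain t where "t < n - k" and t: "x = L ! Suc (k + t)"
      using x length_L by (auto simp: in_set_conv_nth)
    then have kt: "k + t < n" by simp
    show ?thesis
    proof (cases "i \<le> k + t")
      case True
      then show ?thesis using L_ge[of "k + t"] le[of "k + t"] t kt by simp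
    next
      case False
      \<comment> \<open>Here \<open>k < i\<close>, so the suffix of \<open>p\<close> contains the
        entry 1 at position \<open>i\<close>.\<close>
      then have "m \<le> 1" using le[of i] i by simp
      moreover have "x \<in> set L" using t kt length_L by simp
      ultimately show ?thesis using L_perm by (auto simp: perms_iff)
    qed
  qed
  moreover have "m \<le> n + 2" using le[of k] nth_bounds[of k] k by simp
  ultimately show ?thesis using upper foldr_min_ge_iff unfolding m_def by (metis le_antisym)
qed

end

lemma lam_321_closed:
  assumes "p \<in> perms_321 n" shows "lam_321 p \<in> perms_321 (Suc n)"
proof (cases "n = 0")
  case True
  then have "p = []" using assms by (simp add: perms_321_iff)
  then show ?thesis using True by (simp add: perms_321_iff perms_iff lam_321_def has_triple_def)
next
  case False
  then interpret lam_321_setup p n using assms by unfold_locales auto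
  show ?thesis using L_perm L_avoids by (simp add: perms_321_iff L_def)
qed

text \<open>Minima of nonempty suffixes agree, so raising the bound only lengthens the run after the
  last entry. With bounds \<open>n + 1\<close> and \<open>n + 2\<close> this is the final
  \<open>D\<close> of \<open>dyck_lam\<close>.\<close>

lemma min_word_larger_bound:
  assumes "length q = length r" "r \<noteq> []" "N \<le> N'"
    and "\<And>k. k < length r \<Longrightarrow> foldr min (drop k q) N' = foldr min (drop k r) N"
  shows "min_word N' q = min_word N r @ replicate (N' - N) D"
  using assms
proof (induction r arbitrary: q)
  case (Cons x r)
  then obtain y q' where q: "q = y # q'" by (cases q) auto
  have 0: "foldr min (y # q') N' = foldr min (x # r) N"
    using Cons.prems(4)[of 0] q by simp
  show ?case
  proof (cases "r = []")
    case True
    then have "N' - min y N' = (N - min x N) + (N' - N)" "q' = []"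
      using 0 Cons.prems(1,3) q by (auto simp: min_def split: if_splits)
    then show ?thesis using q True by (simp add: replicate_add[symmetric])
  next
    case False
    have "foldr min (drop k q') N' = foldr min (drop k r) N" if "k < length r" for k
      using Cons.prems(4)[of "Suc k"] q that by simp
    moreover from this[of 0] have "foldr min q' N' = foldr min r N" using False by simp
    ultimately show ?thesis
      using Cons.IH[of q'] Cons.prems(1,3) False q 0 by simp
  qed
qed simp

lemma perm_word_lam:
  assumes "p \<in> perms_321 n" shows "perm_word (lam_321 p) = dyck_lam (perm_word p)"
proof (cases "n = 0")
  case True
  then have "p = []" using assms by (simp add: perms_321_iff)
  then show ?thesis by (simp add: lam_321_def perm_word_def dyck_lam_def)
next
  case False
  then interpret lam_321_setup p n using assms by unfold_locales auto
  obtain y q where L: "L = y # q" using length_L by (cases L) auto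
  have mins: "foldr min (drop k q) (n + 2) = foldr min (drop k p) (n + 1)" if "k < n" for k
    using L_suffix_min[OF that] L by simp
  have "min_word (n + 2) q = min_word (n + 1) p @ replicate (n + 2 - (n + 1)) D"
    by (rule min_word_larger_bound) (use mins length_L L p_facts(3,5) in auto)
  \<comment> \<open>The value 1 already occurs after the first entry \<open>y\<close>, so
    \<open>y\<close> contributes a bare \<open>U\<close>: the initial step of
    \<open>dyck_lam\<close>.\<close>
  moreover have "foldr min q (n + 2) = 1"
    using mins[of 0] n foldr_min_perm[OF p_facts(1)] by simp
  moreover have "y \<ge> 1" using L_perm L by (auto simp: perms_iff)
  moreover have "perm_word L = min_word (n + 2) (y # q)"
    using length_L L by (simp add: perm_word_def)
  ultimately have "perm_word L = U # min_word (n + 1) p @ [D]" by simp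
  then show ?thesis using p_facts(3) by (simp add: L_def dyck_lam_def perm_word_def)
qed

lemma perms_321_catalan: "catalan_structure perms_321 [] lam_321 perm_oplus"
proof (rule catalan_structure_transport[OF dyck_catalan, where f = perm_word])
  show "perm_word p \<in> dyck_paths n" if "p \<in> perms_321 n" for p n
    using that perm_word_dyck by (simp add: perms_321_iff)
  show "perm_word (perm_oplus p q) = perm_word p @ perm_word q"
    if "p \<in> perms_321 m" "q \<in> perms_321 n" for p q m n
    using that perm_word_oplus unfolding perms_321_iff by blast
  show "[] \<in> perms_321 0" by (simp add: perms_321_iff has_triple_def)
qed (use perm_word_inj lam_321_closed perm_oplus_321 perm_word_lam in auto)

text \<open>A splitting of \<open>lam_321 u\<close> would factor
  \<open>dyck_lam (perm_word u)\<close> into two nonempty Dyck words, against uniqueness of the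
  first-return factorization.\<close>

lemma lam_321_indecomposable:
  assumes "u \<in> perms_321 n" shows "sum_indecomposable (lam_321 u)"
proof -
  interpret catalan_structure dyck_paths "[]" dyck_lam "(@)" by (rule dyck_catalan)
  have word: "perm_word p \<in> carrier" if "p \<in> perms m" for p m
    using perm_word_dyck[OF that] by (rule C_carrier)
  have word_ne: "perm_word p \<noteq> []" if "p \<noteq> []" for p
    using that by (cases p) (simp_all add: perm_word_def)
  have lam: "lam_321 u \<in> perms (Suc n)" using lam_321_closed[OF assms] by (simp add: perms_321_iff)
  have False if qr: "q \<in> perms (length q)" "r \<in> perms (length r)" "q \<noteq> []" "r \<noteq> []"
    "lam_321 u = perm_oplus q r" for q r
  proof -
    obtain a b where ab: "a \<in> carrier" "b \<in> carrier" "perm_word q = dyck_lam a @ b"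
      using nonempty_form[OF word[OF qr(1)] word_ne[OF qr(3)]] by blast
    have "dyck_lam (perm_word u) @ [] = dyck_lam a @ (b @ perm_word r)"
      using perm_word_lam[OF assms] perm_word_oplus[OF qr(1,2)] qr(5) ab(3) by simp
    then have "b @ perm_word r = []"
      using lam_oplus_inj[of "perm_word u" "[]" a "b @ perm_word r"] ab word[OF qr(2)] assms
        word[of u n] e_carrier oplus_carrier by (simp add: perms_321_iff)
    then show False using word_ne[OF qr(4)] by simp
  qed
  moreover have "lam_321 u \<noteq> []" using perms_length[OF lam] by auto
  ultimately show ?thesis
    using lam perms_length[OF lam] unfolding sum_indecomposable_def by auto
qed

text \<open>\<open>perm_comp\<close> is a definite description, so it is matched with the returns by
  their common recursion rather than by a bijection.\<close>

lemma perm_comp_word: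
  assumes "p \<in> perms_321 n" shows "perm_comp p = dyck_comp (perm_word p)"
proof -
  interpret catalan_structure perms_321 "[]" lam_321 perm_oplus by (rule perms_321_catalan)
  show ?thesis
    using C_carrier[OF assms]
  proof (induction rule: carrier_induct)
    case e
    show ?case using perm_comp_foldr[of "[]"] by (simp add: perm_word_def dyck_comp_def)
  next
    case (lam_oplus u v)
    obtain k l where kl: "u \<in> perms_321 k" "v \<in> perms_321 l"
      using lam_oplus by (auto simp: carrier_def)
    then have "perm_word (perm_oplus (lam_321 u) v) = dyck_lam (perm_word u) @ perm_word v"
      using perm_word_oplus[of "lam_321 u" "Suc k" v l] lam_321_closed[OF kl(1)] perm_word_lam
      by (simp add: perms_321_iff)
    moreover have "perm_comp (perm_oplus (lam_321 u) v) = Suc (perm_comp v)"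
      by (rule perm_comp_lam_oplus(1)[OF perms_321_catalan _ kl]) (rule lam_321_indecomposable)
    ultimately show ?case
      using dyck_comp_lam_append[OF perm_word_dyck, of u k] kl lam_oplus(4)
      by (simp add: perms_321_iff)
  qed
qed

lemma perms_321_h_sends:
  assumes "n \<ge> 1"
  shows "catalan_data.h_sends perms_321 [] lam_321 perm_oplus n
    (perm_comp, perm_rmin) (perm_rcomp, perm_nonrmin)"
proof (rule h_sends_via_dyck[where f = perm_word, OF perms_321_catalan assms])
  fix n p assume p: "p \<in> perms_321 n"
  then have p': "p \<in> perms n" and len: "length p = n"
    using perms_length by (auto simp: perms_321_iff)
  show "perm_word p \<in> dyck_paths n" by (rule perm_word_dyck[OF p'])
  show "perm_word (lam_321 p) = dyck_lam (perm_word p)" by (rule perm_word_lam[OF p])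
  show "perm_comp p = dyck_comp (perm_word p)" by (rule perm_comp_word[OF p])
  show rmin: "perm_rmin p = dyck_peak (perm_word p)"
    unfolding perm_word_def by (rule dyck_peak_min_word[symmetric])
      (use p' len in \<open>auto simp: perms_iff\<close>)
  show "perm_rcomp p = dyck_rcomp (perm_word p)" if "n \<ge> 1" by (rule perm_rcomp_word[OF p' that])
  have "perm_word p = [] \<or> last (perm_word p) = D" using dyck_last[OF perm_word_dyck[OF p']] by blast
  then show "perm_nonrmin p = dyck_nonpeak (perm_word p)"
    using dyck_nonpeak_plus_peak[of "perm_word p"] perm_word_dyck[OF p'] rmin len
    by (simp add: perm_nonrmin_eq dyck_paths_iff)
next
  show "perm_word (perm_oplus p q) = perm_word p @ perm_word q"
    if "p \<in> perms_321 m" "q \<in> perms_321 n" for p q m n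
    using that perm_word_oplus unfolding perms_321_iff by blast
  show "perm_word [] = []" by (simp add: perm_word_def)
qed

section \<open>Non-crossing partitions\<close>

definition noncrossing_blocks :: "nat set set \<Rightarrow> bool" where
  "noncrossing_blocks P \<longleftrightarrow> (\<forall>A\<in>P. \<forall>B\<in>P. \<forall>a\<in>A. \<forall>b\<in>B. \<forall>c\<in>A. \<forall>d\<in>B.
     a < b \<longrightarrow> b < c \<longrightarrow> c < d \<longrightarrow> A = B)"

lemma noncrossing_blocksD:
  assumes "noncrossing_blocks P" "A \<in> P" "B \<in> P" "a \<in> A" "b \<in> B" "c \<in> A" "d \<in> B"
    "a < b" "b < c" "c < d"
  shows "A = B"
  using assms(1)[unfolded noncrossing_blocks_def, rule_format, OF assms(2-)] .

lemma nc_partitions_iff: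
  "P \<in> nc_partitions n \<longleftrightarrow> partition_on {1..n} P \<and> noncrossing_blocks P"
  unfolding nc_partitions_def mem_Collect_eq
proof (rule conj_cong[OF refl], rule iffI)
  assume *: "\<not> (\<exists>A\<in>P. \<exists>B\<in>P. A \<noteq> B \<and>
         (\<exists>a\<in>A. \<exists>b\<in>B. \<exists>c\<in>A. \<exists>d\<in>B. a < b \<and> b < c \<and> c < d))"
  show "noncrossing_blocks P"
    unfolding noncrossing_blocks_def
    by (intro ballI impI, rule ccontr, rule notE[OF *], intro bexI conjI; assumption)
next
  assume nc: "noncrossing_blocks P"
  show "\<not> (\<exists>A\<in>P. \<exists>B\<in>P. A \<noteq> B \<and>
         (\<exists>a\<in>A. \<exists>b\<in>B. \<exists>c\<in>A. \<exists>d\<in>B. a < b \<and> b < c \<and> c < d))"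
    by (intro notI, elim bexE conjE, erule notE) (rule noncrossing_blocksD[OF nc])
qed

lemma nc_blocks:
  assumes "P \<in> nc_partitions n"
  shows "\<Union>P = {1..n}" "{} \<notin> P" "disjoint P" "finite P" "noncrossing_blocks P"
  using assms finite_elements[of "{1..n}" P]
  by (auto simp: nc_partitions_iff partition_on_def)

lemma nc_block:
  assumes "P \<in> nc_partitions n" "A \<in> P"
  shows "A \<subseteq> {1..n}" "finite A" "A \<noteq> {}"
proof -
  show "A \<subseteq> {1..n}" using nc_blocks(1)[OF assms(1)] assms(2) by blast
  then show "finite A" by (rule finite_subset) simp
  show "A \<noteq> {}" using nc_blocks(2)[OF assms(1)] assms(2) by blast
qed

lemma nc_block_eq:
  "P \<in> nc_partitions n \<Longrightarrow> A \<in> P \<Longrightarrow> B \<in> P \<Longrightarrow> x \<in> A \<Longrightarrow> x \<in> B \<Longrightarrow> A = B"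
  using nc_blocks(3) by (auto dest: disjointD)

lemma ncp_size_eq: "P \<in> nc_partitions n \<Longrightarrow> ncp_size P = n"
  unfolding ncp_size_def by (simp add: nc_blocks(1))

lemma nc_partitions_0: "nc_partitions 0 = {{}}"
proof -
  have "P = {}" if "P \<in> nc_partitions 0" for P
    using that by (simp add: nc_partitions_iff partition_on_empty)
  moreover have "{} \<in> nc_partitions 0"
    by (simp add: nc_partitions_iff partition_on_empty noncrossing_blocks_def)
  ultimately show ?thesis by blast
qed

lemma nc_block_of_1:
  assumes "P \<in> nc_partitions n" "n \<ge> 1" obtains B where "B \<in> P" "1 \<in> B"
proof -
  have "1 \<in> \<Union>P" unfolding nc_blocks(1)[OF assms(1)] using assms(2) by simp
  then show thesis using that by blast
qed

lemma ncp_lam_eq: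
  assumes "P \<in> nc_partitions n" "B \<in> P" "1 \<in> B"
  shows "ncp_lam P = insert (insert (n + 1) B) (P - {B})"
proof -
  have "A \<in> P \<Longrightarrow> 1 \<in> A \<longleftrightarrow> A = B" for A using nc_block_eq[OF assms(1) _ assms(2) _ assms(3)] assms(3) by blast
  then have "(\<lambda>A. if 1 \<in> A then insert (n + 1) A else A) ` P = insert (insert (n + 1) B) (P - {B})"
    using assms(2) by auto
  then show ?thesis using assms(2) ncp_size_eq[OF assms(1)] by (auto simp: ncp_lam_def)
qed

lemma ncp_lam_closed:
  assumes P: "P \<in> nc_partitions n" shows "ncp_lam P \<in> nc_partitions (Suc n)"
proof (cases "n = 0")
  case True
  then have "P = {}" using P nc_partitions_0 by simp
  moreover have "{{1 :: nat}} \<in> nc_partitions (Suc 0)"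
    by (simp add: nc_partitions_iff partition_on_def noncrossing_blocks_def)
  ultimately show ?thesis using True by (simp add: ncp_lam_def)
next
  case False
  then obtain B where B: "B \<in> P" "1 \<in> B" using nc_block_of_1[OF P] by auto
  have lam: "ncp_lam P = insert (insert (n + 1) B) (P - {B})" by (rule ncp_lam_eq[OF P B])
  have less: "x < n + 1" "x \<ge> 1" if "A \<in> P" "x \<in> A" for x A using nc_block(1)[OF P that(1)] that(2) by auto
  have "{1..Suc n} = insert (n + 1) (\<Union>P)" unfolding nc_blocks(1)[OF P] by auto
  then have "\<Union>(ncp_lam P) = {1..Suc n}" unfolding lam using B(1) by auto
  \<comment> \<open>\<open>old\<close> sends a block of \<open>ncp_lam P\<close> to the block of
    \<open>P\<close> it comes from; disjointness and non-crossing are pulled back along this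
    injection.\<close>
  moreover define old where "old X = (if X = insert (n + 1) B then B else X)" for X
  have old: "old X \<in> P" "\<And>x. x \<in> X \<Longrightarrow> x \<noteq> n + 1 \<Longrightarrow> x \<in> old X" if "X \<in> ncp_lam P" for X
    using that B(1) unfolding lam old_def by auto
  have inj_old: "X = Y" if "X \<in> ncp_lam P" "Y \<in> ncp_lam P" "old X = old Y" for X Y
    using that unfolding lam old_def by (auto split: if_splits)
  have new: "X = insert (n + 1) B" if "X \<in> ncp_lam P" "n + 1 \<in> X" for X
    using that less unfolding lam by blast
  have "disjoint (ncp_lam P)"
  proof (rule disjointI)
    fix X Y assume XY: "X \<in> ncp_lam P" "Y \<in> ncp_lam P" "X \<noteq> Y"
    show "X \<inter> Y = {}"
    proof (rule ccontr)
      assume "X \<inter> Y \<noteq> {}"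
      then obtain x where x: "x \<in> X" "x \<in> Y" by blast
      then have "x \<noteq> n + 1" using new XY by metis
      then have "old X = old Y" using nc_block_eq[OF P old(1)[OF XY(1)] old(1)[OF XY(2)]] old(2) XY x by blast
      then show False using inj_old XY by blast
    qed
  qed
  moreover have "{} \<notin> ncp_lam P" unfolding lam using nc_blocks(2)[OF P] by auto
  moreover have "noncrossing_blocks (ncp_lam P)"
    unfolding noncrossing_blocks_def
  proof (intro ballI impI)
    fix A A' a b c d
    assume mem: "A \<in> ncp_lam P" "A' \<in> ncp_lam P" "a \<in> A" "b \<in> A'" "c \<in> A" "d \<in> A'"
      and ord: "a < b" "b < c" "c < d"
    have bound: "x \<le> n + 1" if "X \<in> ncp_lam P" "x \<in> X" for X x
    proof -
      have "x \<in> {1..Suc n}" using \<open>\<Union>(ncp_lam P) = {1..Suc n}\<close> that by blast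
      then show ?thesis by simp
    qed
    have "d \<le> n + 1" using bound mem by blast
    have inA: "a \<in> old A" "b \<in> old A'" "c \<in> old A"
      using old(2) mem ord \<open>d \<le> n + 1\<close> by auto
    have "old A = old A'"
    proof (cases "d = n + 1")
      case False
      then have "d \<in> old A'" using old(2) mem by blast
      then show ?thesis
        using noncrossing_blocksD[OF nc_blocks(5)[OF P], of "old A" "old A'" a b c d] inA old(1) mem ord by blast
    next
      case True
      have "A' = insert (n + 1) B" using new[OF mem(2)] mem(6) True by simp
      then have oldA': "old A' = B" by (simp add: old_def)
      show ?thesis
      proof (cases "a = 1")
        case True
        then show ?thesis using oldA' nc_block_eq[OF P old(1)[OF mem(1)] B(1) _ B(2)] inA by simp
      next
        case False
        \<comment> \<open>When \<open>d\<close> is the new element, \<open>A'\<close> contains 1,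
          and \<open>1 < a < b < c\<close> takes the place of \<open>a < b < c < d\<close> as a
          crossing inside \<open>P\<close>.\<close>
        then have "1 < a" using less(2)[OF old(1)[OF mem(1)] inA(1)] by simp
        then show ?thesis
          using noncrossing_blocksD[OF nc_blocks(5)[OF P] B(1) old(1)[OF mem(1)] B(2) inA(1)] inA oldA' ord
          by blast
      qed
    qed
    then show "A = A'" using inj_old mem by blast
  qed
  ultimately show ?thesis by (simp add: nc_partitions_iff partition_on_def)
qed

definition shift_blocks :: "nat \<Rightarrow> nat set set \<Rightarrow> nat set set" where
  "shift_blocks k Q = (\<lambda>B. (\<lambda>x. x + k) ` B) ` Q"

lemma ncp_oplus_eq: "P \<in> nc_partitions m \<Longrightarrow> ncp_oplus P Q = P \<union> shift_blocks m Q"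
  by (simp add: ncp_oplus_def shift_blocks_def ncp_size_eq)

lemma inj_shift_image: "inj (\<lambda>B. (\<lambda>x. x + k :: nat) ` B)"
  by (rule injI) (auto simp: inj_image_eq_iff)

lemma shift_blocks_inj: "shift_blocks k Q = shift_blocks k Q' \<longleftrightarrow> Q = Q'"
  unfolding shift_blocks_def by (rule inj_image_eq_iff[OF inj_shift_image])

lemma shift_blocks_block:
  "Q \<in> nc_partitions n \<Longrightarrow> A \<in> shift_blocks k Q \<Longrightarrow> A \<subseteq> {k + 1..k + n} \<and> A \<noteq> {}"
  using nc_block unfolding shift_blocks_def by fastforce

lemma ncp_oplus_closed:
  assumes P: "P \<in> nc_partitions m" and Q: "Q \<in> nc_partitions n"
  shows "ncp_oplus P Q \<in> nc_partitions (m + n)"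
proof -
  have sep: "x < y" if "A \<in> P" "x \<in> A" "B \<in> shift_blocks m Q" "y \<in> B" for A B x y
    using nc_block(1)[OF P that(1)] shift_blocks_block[OF Q that(3)] that(2,4) by fastforce
  have "\<Union>(shift_blocks m Q) = (\<lambda>x. x + m) ` \<Union>Q" unfolding shift_blocks_def by blast
  then have "\<Union>(P \<union> shift_blocks m Q) = {1..m} \<union> {m + 1..m + n}"
    unfolding Union_Un_distrib by (simp add: nc_blocks(1)[OF P] nc_blocks(1)[OF Q] add.commute)
  also have "\<dots> = {1..m + n}" by auto
  finally have "\<Union>(P \<union> shift_blocks m Q) = {1..m + n}" .
  moreover have "disjoint (P \<union> shift_blocks m Q)"
  proof (rule disjointI)
    fix A B assume AB: "A \<in> P \<union> shift_blocks m Q" "B \<in> P \<union> shift_blocks m Q" "A \<noteq> B"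
    have "A = B" if x: "x \<in> A" "x \<in> B" for x
    proof -
      consider "A \<in> P" "B \<in> P" | "A \<in> shift_blocks m Q" "B \<in> shift_blocks m Q"
        using AB(1,2) sep x by blast
      then show ?thesis
      proof cases
        case 1
        then show ?thesis using nc_block_eq[OF P] x by blast
      next
        case 2
        then obtain A' B' where AB': "A' \<in> Q" "B' \<in> Q" "A = (\<lambda>x. x + m) ` A'" "B = (\<lambda>x. x + m) ` B'"
          unfolding shift_blocks_def by blast
        moreover obtain y where "y \<in> A'" "y \<in> B'" using AB'(3,4) x by auto
        ultimately show ?thesis using nc_block_eq[OF Q AB'(1,2)] by blast
      qed
    qed
    then show "A \<inter> B = {}" using AB(3) by blast
  qed
  moreover have "{} \<notin> P \<union> shift_blocks m Q"
    using nc_blocks(2)[OF P] shift_blocks_block[OF Q] by blast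
  moreover have "noncrossing_blocks (P \<union> shift_blocks m Q)"
    unfolding noncrossing_blocks_def
  proof (intro ballI impI)
    fix A B a b c d
    assume AB: "A \<in> P \<union> shift_blocks m Q" "B \<in> P \<union> shift_blocks m Q" and mem: "a \<in> A" "b \<in> B" "c \<in> A" "d \<in> B"
      and ord: "a < b" "b < c" "c < d"
    consider "A \<in> P" "B \<in> P" | "A \<in> shift_blocks m Q" "B \<in> shift_blocks m Q"
      using AB sep mem ord by (meson UnE less_asym)
    then show "A = B"
    proof cases
      case 1
      then show ?thesis using noncrossing_blocksD[OF nc_blocks(5)[OF P]] mem ord by blast
    next
      case 2
      then obtain A' B' where AB': "A' \<in> Q" "B' \<in> Q" "A = (\<lambda>x. x + m) ` A'" "B = (\<lambda>x. x + m) ` B'"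
        unfolding shift_blocks_def by blast
      then obtain a' b' c' d' where "a' \<in> A'" "b' \<in> B'" "c' \<in> A'" "d' \<in> B'"
        "a = a' + m" "b = b' + m" "c = c' + m" "d = d' + m" using mem by blast
      then have "A' = B'"
        using noncrossing_blocksD[OF nc_blocks(5)[OF Q] AB'(1,2), of a' b' c' d'] ord by simp
      then show ?thesis using AB' by simp
    qed
  qed
  ultimately show ?thesis
    unfolding ncp_oplus_eq[OF P] by (simp add: nc_partitions_iff partition_on_def)
qed

lemma noncrossing_restrict:
  assumes "noncrossing_blocks P" shows "noncrossing_blocks ((\<inter>) S ` P - {{}})"
  unfolding noncrossing_blocks_def
proof (intro ballI impI)
  fix A B a b c d
  assume AB: "A \<in> (\<inter>) S ` P - {{}}" "B \<in> (\<inter>) S ` P - {{}}" and mem: "a \<in> A" "b \<in> B" "c \<in> A" "d \<in> B"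
    and ord: "a < b" "b < c" "c < d"
  then obtain A' B' where "A' \<in> P" "B' \<in> P" "A = S \<inter> A'" "B = S \<inter> B'" by blast
  then show "A = B" using noncrossing_blocksD[OF assms, of A' B' a b c d] mem ord by blast
qed

lemma nc_restrict:
  assumes "P \<in> nc_partitions n" "m \<le> n"
  shows "(\<inter>) {1..m} ` P - {{}} \<in> nc_partitions m"
proof -
  have "{1..m} \<inter> {1..n} = {1..m}" using assms(2) by auto
  then have "partition_on {1..m} ((\<inter>) {1..m} ` P - {{}})"
    using partition_on_restrict[of "{1..n}" P "{1..m}"] assms(1) unfolding nc_partitions_iff by metis
  then show ?thesis
    using noncrossing_restrict[of P "{1..m}"] assms(1) by (simp add: nc_partitions_iff)
qed

lemma nc_unshift:
  assumes "partition_on {k + 1..k + l} R" "noncrossing_blocks R"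
  shows "\<exists>Q\<in>nc_partitions l. R = shift_blocks k Q"
proof
  let ?f = "\<lambda>x. x - k"
  let ?Q = "(`) ?f ` R"
  have inj: "inj_on ?f {k + 1..k + l}" by (rule inj_onI) auto
  have "?f ` {k + 1..k + l} = {1..l}"
  proof -
    have "?f ` ((\<lambda>x. x + k) ` {1..l}) = {1..l}" unfolding image_image by simp
    then show ?thesis unfolding shift_image_atLeastAtMost .
  qed
  moreover have "{} \<notin> R" using assms(1) by (rule partition_onD3)
  then have "?Q - {{}} = ?Q" by auto
  ultimately have part: "partition_on {1..l} ?Q"
    using partition_on_inj_image[OF assms(1) inj] by simp
  have ge: "k < x" if "A \<in> R" "x \<in> A" for A x
  proof -
    have "x \<in> {k + 1..k + l}" unfolding partition_onD1[OF assms(1)] using that by blast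
    then show ?thesis by simp
  qed
  have "noncrossing_blocks ?Q"
    unfolding noncrossing_blocks_def
  proof (intro ballI impI)
    fix A B a b c d
    assume AB: "A \<in> ?Q" "B \<in> ?Q" and mem: "a \<in> A" "b \<in> B" "c \<in> A" "d \<in> B"
      and ord: "a < b" "b < c" "c < d"
    then obtain A' B' where AB': "A' \<in> R" "B' \<in> R" "A = ?f ` A'" "B = ?f ` B'" by blast
    then obtain a' b' c' d' where "a' \<in> A'" "b' \<in> B'" "c' \<in> A'" "d' \<in> B'"
      "a = a' - k" "b = b' - k" "c = c' - k" "d = d' - k" using mem by blast
    moreover from this have "a' < b'" "b' < c'" "c' < d'" using ord by linarith+
    ultimately have "A' = B'"
      using noncrossing_blocksD[OF assms(2) AB'(1,2)] by blast
    then show "A = B" using AB' by simp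
  qed
  then show "?Q \<in> nc_partitions l" using part by (simp add: nc_partitions_iff)
  have "(\<lambda>x. x + k) ` (?f ` A) = A" if "A \<in> R" for A
    using ge[OF that] by (force simp: image_image)
  then show "R = shift_blocks k ?Q"
    unfolding shift_blocks_def by (simp add: image_image)
qed

text \<open>Let \<open>m\<close> be the maximum of the block \<open>B\<close> of 1. Since
  \<open>1\<close> and \<open>m\<close> lie in \<open>B\<close>, no block straddles
  \<open>m\<close>. The blocks up to \<open>m\<close> form \<open>ncp_lam u\<close>, where
  \<open>u\<close> arises by deleting \<open>m\<close>; the others form a shifted
  \<open>v\<close>.\<close>

lemma nc_decompose:
  assumes P: "P \<in> nc_partitions (Suc n)"
  shows "\<exists>k l. \<exists>u\<in>nc_partitions k. \<exists>v\<in>nc_partitions l. P = ncp_oplus (ncp_lam u) v"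
proof -
  obtain B where B: "B \<in> P" "1 \<in> B" using nc_block_of_1[OF P] by auto
  define m where "m = Max B"
  have finB: "finite B" "B \<noteq> {}" using nc_block[OF P B(1)] by auto
  have m: "m \<in> B" "\<And>x. x \<in> B \<Longrightarrow> x \<le> m" using finB by (simp_all add: m_def)
  have m_bound: "1 \<le> m" "m \<le> Suc n" using m(1) nc_block(1)[OF P B(1)] by auto
  have split: "A \<subseteq> {1..m} \<or> A \<subseteq> {m + 1..Suc n}" if A: "A \<in> P" for A
  proof (rule ccontr)
    assume *: "\<not> ?thesis"
    have sub: "A \<subseteq> {1..Suc n}" by (rule nc_block(1)[OF P A])
    obtain x where "x \<in> A" "x \<notin> {m + 1..Suc n}" using * by blast
    then have x: "x \<in> A" "x \<le> m" using sub by auto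
    obtain y where "y \<in> A" "y \<notin> {1..m}" using * by blast
    then have y: "y \<in> A" "m < y" using sub by auto
    have "A \<noteq> B" using m(2)[of y] y by auto
    then have "x \<noteq> 1" "x \<noteq> m" using nc_block_eq[OF P A B(1)] x B(2) m(1) by blast+
    moreover have "x \<ge> 1" using sub x by auto
    ultimately have "1 < x" "x < m" using x by auto
    \<comment> \<open>A straddling block would cross \<open>B\<close> in
      \<open>1 < x < m < y\<close>.\<close>
    then have "B = A"
      using noncrossing_blocksD[OF nc_blocks(5)[OF P] B(1) A B(2) x(1) m(1) y(1)] y(2) by blast
    then show False using \<open>A \<noteq> B\<close> by simp
  qed
  define P1 where "P1 = {A \<in> P. A \<subseteq> {1..m}}"
  define P2 where "P2 = {A \<in> P. A \<subseteq> {m + 1..Suc n}}"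
  have P12: "P = P1 \<union> P2" using split by (auto simp: P1_def P2_def)
  have "B \<in> P1" using B(1) m(2) nc_block(1)[OF P B(1)] by (auto simp: P1_def)
  have low: "{1..m - 1} \<inter> A = (if A = B then B - {m} else A)" if "A \<in> P1" for A
  proof (cases "A = B")
    case True
    have "x \<in> {1..m - 1} \<longleftrightarrow> x \<noteq> m" if "x \<in> B" for x
      using m(2)[OF that] that nc_block(1)[OF P B(1)] m_bound by auto
    then have "{1..m - 1} \<inter> B = B - {m}" by blast
    then show ?thesis using True by simp
  next
    case False
    then have "m \<notin> A" using nc_block_eq[OF P _ B(1) _ m(1)] \<open>A \<in> P1\<close> by (auto simp: P1_def)
    moreover have "A \<subseteq> {1..m}" using \<open>A \<in> P1\<close> by (simp add: P1_def)
    ultimately have "A \<subseteq> {1..m - 1}" by (force simp: subset_iff le_less)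
    then show ?thesis using False by auto
  qed
  have high: "{1..m - 1} \<inter> A = {}" "{m + 1..Suc n} \<inter> A = A" if "A \<in> P2" for A
  proof -
    have "A \<subseteq> {m + 1..Suc n}" using that by (simp add: P2_def)
    moreover have "{1..m - 1} \<inter> {m + 1..Suc n} = {}" by auto
    ultimately show "{1..m - 1} \<inter> A = {}" "{m + 1..Suc n} \<inter> A = A" by blast+
  qed
  \<comment> \<open>Restriction deletes \<open>m\<close> from \<open>B\<close>, keeps the other
    blocks of \<open>P1\<close> and empties those of \<open>P2\<close>. For \<open>m = 1\<close> it
    also empties \<open>B\<close>, hence the separate case below.\<close>
  define u where "u = (\<inter>) {1..m - 1} ` P - {{}}"
  have u: "u \<in> nc_partitions (m - 1)"
    unfolding u_def using nc_restrict[OF P] m_bound by simp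
  have ne: "{} \<notin> P1" using nc_blocks(2)[OF P] by (auto simp: P1_def)
  have u_eq: "u = insert (B - {m}) (P1 - {B}) - {{}}"
  proof -
    have "u = (\<inter>) {1..m - 1} ` P1 - {{}}" unfolding u_def P12 image_Un using high(1) by auto
    also have "(\<inter>) {1..m - 1} ` P1 = insert (B - {m}) (P1 - {B})" using low \<open>B \<in> P1\<close> by auto
    finally show ?thesis .
  qed
  have lam_u: "ncp_lam u = P1"
  proof (cases "m = 1")
    case True
    then have "B = {1}" using B(2) m(2) nc_block(1)[OF P B(1)] by force
    moreover have "P1 \<subseteq> {B}"
    proof
      fix A assume "A \<in> P1"
      then have "A \<subseteq> {1}" "A \<noteq> {}" using True ne by (auto simp: P1_def)
      then show "A \<in> {B}" using \<open>B = {1}\<close> by auto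
    qed
    ultimately have "P1 = {{1}}" using \<open>B \<in> P1\<close> by auto
    moreover have "u = {}" using u True nc_partitions_0 by simp
    ultimately show ?thesis by (simp add: ncp_lam_def)
  next
    case False
    then have B': "1 \<in> B - {m}" using B(2) by simp
    then have u_eq': "u = insert (B - {m}) (P1 - {B})" using u_eq ne by auto
    have "B - {m} \<notin> P1 - {B}" using nc_block_eq[OF P _ B(1) B' B(2)] unfolding P1_def by blast
    then have "ncp_lam u = insert (insert m (B - {m})) (P1 - {B})"
      using ncp_lam_eq[OF u _ B'] m_bound unfolding u_eq' by simp
    moreover have "insert m (B - {m}) = B" using m(1) by auto
    ultimately show ?thesis using \<open>B \<in> P1\<close> by auto
  qed
  have "P2 = (\<inter>) {m + 1..Suc n} ` P - {{}}"
  proof -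
    have "{m + 1..Suc n} \<inter> A = {}" if "A \<in> P1" for A
    proof -
      have "A \<subseteq> {1..m}" using that by (simp add: P1_def)
      moreover have "{m + 1..Suc n} \<inter> {1..m} = {}" by auto
      ultimately show ?thesis by blast
    qed
    moreover have "{} \<notin> P2" using nc_blocks(2)[OF P] by (auto simp: P2_def)
    ultimately show ?thesis unfolding P12 image_Un using high(2) by auto
  qed
  moreover have "{m + 1..Suc n} \<inter> {1..Suc n} = {m + 1..m + (Suc n - m)}" using m_bound by auto
  ultimately have "partition_on {m + 1..m + (Suc n - m)} P2" "noncrossing_blocks P2"
    using partition_on_restrict[of "{1..Suc n}" P "{m + 1..Suc n}"]
      noncrossing_restrict[of P "{m + 1..Suc n}"] P unfolding nc_partitions_iff by metis+
  then obtain v where v: "v \<in> nc_partitions (Suc n - m)" "P2 = shift_blocks m v"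
    using nc_unshift by blast
  have "ncp_lam u \<in> nc_partitions m" using ncp_lam_closed[OF u] m_bound by simp
  then have "ncp_oplus (ncp_lam u) v = P" using ncp_oplus_eq lam_u v(2) P12 by simp
  then show ?thesis using u v(1) by blast
qed

text \<open>For uniqueness: the maximum of the block of 1 reveals the size of \<open>u\<close>
  inside \<open>ncp_oplus (ncp_lam u) v\<close>.\<close>

lemma ncp_lam_block:
  assumes "u \<in> nc_partitions k" "B \<in> ncp_lam u" "1 \<in> B" shows "Max B = k + 1"
proof -
  have lam: "ncp_lam u \<in> nc_partitions (Suc k)" by (rule ncp_lam_closed[OF assms(1)])
  have "\<exists>B'\<in>ncp_lam u. 1 \<in> B' \<and> k + 1 \<in> B'"
  proof (cases "k = 0")
    case True
    then show ?thesis using assms(1) nc_partitions_0 by (simp add: ncp_lam_def)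
  next
    case False
    then obtain B where "B \<in> u" "1 \<in> B" using nc_block_of_1[OF assms(1)] by auto
    then show ?thesis using ncp_lam_eq[OF assms(1)] by auto
  qed
  then have "k + 1 \<in> B" using nc_block_eq[OF lam _ assms(2) _ assms(3)] by blast
  moreover have "x \<le> k + 1" if "x \<in> B" for x using nc_block(1)[OF lam assms(2)] that by auto
  ultimately show ?thesis using nc_block(2)[OF lam assms(2)] by (intro Max_eqI) auto
qed

text \<open>The empty set is removed for the case \<open>k = 0\<close>, where deleting 1 from
  \<open>{{1}}\<close> leaves an empty block.\<close>

lemma ncp_lam_inverse:
  assumes "u \<in> nc_partitions k" shows "u = (\<lambda>A. A - {k + 1}) ` ncp_lam u - {{}}"
proof (cases "k = 0")
  case True
  then show ?thesis using assms nc_partitions_0 by (simp add: ncp_lam_def)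
next
  case False
  then obtain B where B: "B \<in> u" "1 \<in> B" using nc_block_of_1[OF assms] by auto
  have "A - {k + 1} = A" if "A \<in> u" for A using nc_block(1)[OF assms that] by auto
  then have "(\<lambda>A. A - {k + 1}) ` ncp_lam u = u"
    unfolding ncp_lam_eq[OF assms B] using B(1) by auto
  then show ?thesis using nc_blocks(2)[OF assms] by auto
qed

lemma ncp_catalan: "catalan_structure nc_partitions {} ncp_lam ncp_oplus"
proof (rule catalan_structureI)
  show "m = n" if "P \<in> nc_partitions m" "P \<in> nc_partitions n" for P m n
    using that ncp_size_eq by blast
  show "ncp_oplus (ncp_oplus P Q) R = ncp_oplus P (ncp_oplus Q R)"
    if PQ: "P \<in> nc_partitions k" "Q \<in> nc_partitions m" "R \<in> nc_partitions n" for P Q R k m n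
    using PQ ncp_oplus_closed[OF PQ(1,2)]
    by (simp add: ncp_oplus_eq shift_blocks_def image_Un image_image Un_assoc add.assoc add.commute add.left_commute)
  show "ncp_oplus {} P = P" for P
    using ncp_oplus_eq[of "{}" 0 P] nc_partitions_0 by (simp add: shift_blocks_def)
  show "ncp_oplus P {} = P" for P
    by (simp add: ncp_oplus_def)
  show "u = u' \<and> v = v'"
    if uv: "u \<in> nc_partitions k" "v \<in> nc_partitions l" "u' \<in> nc_partitions k'" "v' \<in> nc_partitions l'"
      and eq: "ncp_oplus (ncp_lam u) v = ncp_oplus (ncp_lam u') v'" for k l k' l' u v u' v'
  proof -
    have parts: "\<exists>B\<in>P. 1 \<in> B \<and> Max B = k + 1" "ncp_lam u = {A \<in> P. A \<subseteq> {1..k + 1}}"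
      "shift_blocks (k + 1) v = {A \<in> P. \<not> A \<subseteq> {1..k + 1}}"
      if u: "u \<in> nc_partitions k" "v \<in> nc_partitions l" "P = ncp_oplus (ncp_lam u) v" for k l u v P
    proof -
      have lam: "ncp_lam u \<in> nc_partitions (k + 1)" using ncp_lam_closed[OF u(1)] by simp
      have P: "P = ncp_lam u \<union> shift_blocks (k + 1) v" using ncp_oplus_eq[OF lam] u(3) by simp
      obtain B where "B \<in> ncp_lam u" "1 \<in> B" using nc_block_of_1[OF lam] by auto
      then show "\<exists>B\<in>P. 1 \<in> B \<and> Max B = k + 1" using ncp_lam_block[OF u(1)] P by blast
      have *: "\<not> A \<subseteq> {1..k + 1}" if "A \<in> shift_blocks (k + 1) v" for A
        using shift_blocks_block[OF u(2) that] by fastforce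
      show "ncp_lam u = {A \<in> P. A \<subseteq> {1..k + 1}}"
        "shift_blocks (k + 1) v = {A \<in> P. \<not> A \<subseteq> {1..k + 1}}"
        using P * nc_block(1)[OF lam] by blast+
    qed
    define P where "P = ncp_oplus (ncp_lam u) v"
    have P: "P \<in> nc_partitions (Suc k + l)"
      unfolding P_def by (intro ncp_oplus_closed ncp_lam_closed uv)
    note 1 = parts[OF uv(1,2) P_def] and 2 = parts[OF uv(3,4) P_def[unfolded eq]]
    obtain B B' where "B \<in> P" "1 \<in> B" "Max B = k + 1" "B' \<in> P" "1 \<in> B'" "Max B' = k' + 1"
      using 1(1) 2(1) by blast
    moreover from this have "B = B'" using nc_block_eq[OF P] by blast
    ultimately have k: "k = k'" by simp
    have "ncp_lam u = ncp_lam u'" using 1(2) 2(2) k by simp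
    then have "u = u'" using ncp_lam_inverse[OF uv(1)] ncp_lam_inverse[OF uv(3)] k by simp
    moreover have "shift_blocks (k + 1) v = shift_blocks (k + 1) v'" using 1(3) 2(3) k by simp
    ultimately show ?thesis using shift_blocks_inj by blast
  qed
qed (use nc_partitions_0 ncp_lam_closed ncp_oplus_closed nc_decompose in auto)

section \<open>Summands, blocks and the flattened form\<close>

lemma (in catalan_structure) num_summands_lam_oplus:
  assumes "u \<in> carrier" "v \<in> carrier"
  shows "num_summands (lam u \<oplus> v) = Suc (num_summands v)" and "num_summands (lam u) = 1"
proof -
  have "\<exists>us. (\<forall>u\<in>set us. indecomposable u) \<and> v = foldr (\<oplus>) us e"
    using assms(2)
  proof (induction rule: carrier_induct)
    case e
    show ?case by (intro exI[of _ "[]"]) simp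
  next
    case (lam_oplus u v)
    then obtain us where "\<forall>u\<in>set us. indecomposable u" "v = foldr (\<oplus>) us e" by blast
    then show ?case
      using lam_oplus by (intro exI[of _ "lam u # us"]) (auto simp: indecomposable_def)
  qed
  then obtain us where us: "\<forall>u\<in>set us. indecomposable u" "v = foldr (\<oplus>) us e" by blast
  have u: "indecomposable (lam u)" using assms by (auto simp: indecomposable_def)
  show "num_summands (lam u \<oplus> v) = Suc (num_summands v)"
    using num_summands_foldr[of us] num_summands_foldr[of "lam u # us"] us u by simp
  show "num_summands (lam u) = 1"
    using num_summands_foldr[of "[lam u]"] u assms(1) by (simp add: oplus_e_right lam_carrier)
qed

text \<open>Lets \<open>ncp_flatten\<close> be computed from any listing of the blocks with strictly
  increasing minima.\<close>

lemma (in linorder) sorted_key_list_of_set_eq: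
  fixes f :: "'b \<Rightarrow> 'a"
  assumes "sorted_wrt (<) (map f xs)"
  shows "sorted_key_list_of_set f (set xs) = xs"
proof -
  have d: "distinct (map f xs)" "sorted (map f xs)" using assms by (auto simp: strict_sorted_iff)
  interpret folding_insort_key "(\<le>)" "(<)" "set xs" f
    by unfold_locales (use d in \<open>simp add: distinct_map\<close>)
  show ?thesis by (rule idem_if_sorted_distinct) (use d in \<open>auto simp: distinct_map\<close>)
qed

definition desc :: "nat set \<Rightarrow> nat list" where
  "desc B = rev (sorted_list_of_set B)"

lemma ncp_flatten_eq:
  "sorted_wrt (<) (map Min xs) \<Longrightarrow> ncp_flatten (set xs) = concat (map desc xs)"
  by (simp add: ncp_flatten_def sorted_key_list_of_set_eq desc_def[abs_def])

lemma nc_sorted_blocks: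
  assumes "P \<in> nc_partitions n"
  obtains xs where "P = set xs" "sorted_wrt (<) (map Min xs)"
proof -
  have "inj_on Min P"
  proof (rule inj_onI)
    fix A B assume AB: "A \<in> P" "B \<in> P" "Min A = Min B"
    then have "Min A \<in> A" "Min A \<in> B" using nc_block[OF assms] Min_in by metis+
    then show "A = B" using nc_block_eq[OF assms AB(1,2)] by blast
  qed
  then interpret folding_insort_key "(\<le>)" "(<)" P Min by unfold_locales
  show thesis using finite_set_strict_sorted[of P] nc_blocks(4)[OF assms] that by auto
qed

lemma set_ncp_flatten:
  assumes "P \<in> nc_partitions n" shows "set (ncp_flatten P) = {1..n}"
proof -
  obtain xs where xs: "P = set xs" "sorted_wrt (<) (map Min xs)" using nc_sorted_blocks[OF assms] .
  have "set (concat (map desc xs)) = \<Union>P"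
    using nc_block(2)[OF assms] by (auto simp: desc_def xs(1))
  then show ?thesis using nc_blocks(1)[OF assms] ncp_flatten_eq[OF xs(2)] xs(1) by simp
qed

lemma desc_insert_max:
  assumes "finite B" "\<forall>x\<in>B. x < m" shows "desc (insert m B) = m # desc B"
proof -
  have "sorted_list_of_set (set (sorted_list_of_set B @ [m])) = sorted_list_of_set B @ [m]"
    using assms by (intro sorted_list_of_set.idem_if_sorted_distinct) (auto simp: sorted_append less_imp_le)
  then show ?thesis using assms(1) by (simp add: desc_def)
qed

lemma desc_shift:
  assumes "finite B" shows "desc ((\<lambda>x. x + k) ` B) = map (\<lambda>x. x + k) (desc B)"
proof -
  have "sorted_list_of_set (set (map (\<lambda>x. x + k) (sorted_list_of_set B))) = map (\<lambda>x. x + k) (sorted_list_of_set B)"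
    by (intro sorted_list_of_set.idem_if_sorted_distinct) (auto simp: sorted_map distinct_map inj_on_def sorted_wrt_map[symmetric])
  then show ?thesis using assms by (simp add: desc_def rev_map)
qed

text \<open>The block of 1 has the least minimum and is listed first, and its new maximum heads its
  decreasing word. Thus flattening turns \<open>ncp_lam\<close> into \<open>lam_231\<close>, and
  \<open>ncp_oplus\<close> into the direct sum.\<close>

lemma ncp_flatten_lam:
  assumes P: "P \<in> nc_partitions n" shows "ncp_flatten (ncp_lam P) = Suc n # ncp_flatten P"
proof (cases "n = 0")
  case True
  then have "P = {}" using P nc_partitions_0 by simp
  then show ?thesis
    using ncp_flatten_eq[of "[{1}]"] ncp_flatten_eq[of "[]"] True by (simp add: ncp_lam_def desc_def)
next
  case False
  obtain xs where xs: "P = set xs" "sorted_wrt (<) (map Min xs)" using nc_sorted_blocks[OF P] .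
  obtain B where B: "B \<in> P" "1 \<in> B" using nc_block_of_1[OF P] False by auto
  have MinB: "Min B = 1"
    using nc_block[OF P B(1)] B(2) by (intro Min_eqI) auto
  have Min_ge: "Min A \<ge> 1" if "A \<in> P" for A using nc_block[OF P that] by (simp add: subset_iff)
  obtain A ys where A: "xs = A # ys" using B(1) xs(1) by (cases xs) auto
  have "A = B"
  proof (rule ccontr)
    assume "A \<noteq> B"
    then have "B \<in> set ys" using B(1) xs(1) A by auto
    then have "Min A < 1" using xs(2) A MinB by auto
    then show False using Min_ge[of A] xs(1) A by simp
  qed
  then have xs': "xs = B # ys" "B \<notin> set ys" using A xs(2) by auto
  have fin: "finite B" "\<forall>x\<in>B. x < Suc n" using nc_block[OF P B(1)] by auto
  have "Min (insert (Suc n) B) = Min B"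
    using fin(1) B(2) MinB by (subst Min_insert) auto
  then have "sorted_wrt (<) (map Min (insert (Suc n) B # ys))" using xs(2) xs' by simp
  moreover have "ncp_lam P = set (insert (Suc n) B # ys)"
    using ncp_lam_eq[OF P B] xs(1) xs' by simp
  ultimately have "ncp_flatten (ncp_lam P) = concat (map desc (insert (Suc n) B # ys))"
    using ncp_flatten_eq by metis
  then show ?thesis
    using desc_insert_max[OF fin] ncp_flatten_eq[OF xs(2)] xs(1) xs' by simp
qed

lemma ncp_flatten_oplus:
  assumes P: "P \<in> nc_partitions m" and Q: "Q \<in> nc_partitions n"
  shows "ncp_flatten (ncp_oplus P Q) = ncp_flatten P @ map (\<lambda>x. x + m) (ncp_flatten Q)"
proof -
  obtain xs where xs: "P = set xs" "sorted_wrt (<) (map Min xs)" using nc_sorted_blocks[OF P] .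
  obtain ys where ys: "Q = set ys" "sorted_wrt (<) (map Min ys)" using nc_sorted_blocks[OF Q] .
  define zs where "zs = map (\<lambda>B. (\<lambda>x. x + m) ` B) ys"
  have Min_shift: "Min ((\<lambda>x. x + m) ` B) = Min B + m" if "B \<in> set ys" for B
    using nc_block[OF Q] that ys(1) by (simp add: mono_Min_commute[symmetric] mono_def)
  then have Min_zs: "map Min zs = map (\<lambda>B. Min B + m) ys" by (simp add: zs_def)
  have "Min A \<in> A" if "A \<in> set xs" for A using nc_block[OF P] that xs(1) by simp
  then have "Min A \<le> m" if "A \<in> set xs" for A using nc_block(1)[OF P] that xs(1) by fastforce
  moreover have "Min B \<in> B" if "B \<in> set ys" for B using nc_block[OF Q] that ys(1) by simp
  then have "0 < Min B" if "B \<in> set ys" for B using nc_block(1)[OF Q] that ys(1) by fastforce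
  ultimately have "\<forall>A\<in>set xs. \<forall>B\<in>set ys. Min A < Min B + m" by fastforce
  then have "sorted_wrt (<) (map Min (xs @ zs))"
    using xs(2) ys(2) by (simp add: Min_zs sorted_wrt_append sorted_wrt_map)
  moreover have "ncp_oplus P Q = set (xs @ zs)"
    unfolding ncp_oplus_eq[OF P] by (simp add: shift_blocks_def zs_def xs(1) ys(1))
  ultimately have "ncp_flatten (ncp_oplus P Q) = concat (map desc (xs @ zs))"
    using ncp_flatten_eq by metis
  moreover have "map desc zs = map (map (\<lambda>x. x + m)) (map desc ys)"
    using nc_block(2)[OF Q] ys(1) by (simp add: zs_def desc_shift)
  ultimately show ?thesis
    using ncp_flatten_eq[OF xs(2)] ncp_flatten_eq[OF ys(2)] xs(1) ys(1) by (simp add: map_concat)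
qed

lemma ncp_blocks_lam:
  assumes P: "P \<in> nc_partitions n" "P \<noteq> {}" shows "ncp_blocks (ncp_lam P) = ncp_blocks P"
proof -
  have "n \<noteq> 0" using P nc_partitions_0 by auto
  then obtain B where B: "B \<in> P" "1 \<in> B" using nc_block_of_1[OF P(1)] by auto
  have "insert (n + 1) B \<notin> P - {B}" using nc_block(1)[OF P(1)] by fastforce
  then show ?thesis
    using nc_blocks(4)[OF P(1)] B(1) card_Suc_Diff1[of P B]
    by (simp add: ncp_blocks_def ncp_lam_eq[OF P(1) B])
qed

lemma ncp_blocks_oplus:
  assumes P: "P \<in> nc_partitions m" and Q: "Q \<in> nc_partitions n"
  shows "ncp_blocks (ncp_oplus P Q) = ncp_blocks P + ncp_blocks Q"
proof -
  have "P \<inter> shift_blocks m Q = {}"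
  proof -
    have False if A: "A \<in> P" "A \<in> shift_blocks m Q" for A
    proof -
      obtain x where "x \<in> A" using nc_block(3)[OF P A(1)] by blast
      then have "x \<le> m" "m + 1 \<le> x"
        using nc_block(1)[OF P A(1)] shift_blocks_block[OF Q A(2)] by auto
      then show False by simp
    qed
    then show ?thesis by blast
  qed
  moreover have "card (shift_blocks m Q) = card Q"
    unfolding shift_blocks_def by (rule card_image) (rule inj_on_subset[OF inj_shift_image], simp)
  ultimately show ?thesis
    using nc_blocks(4)[OF P] nc_blocks(4)[OF Q]
    by (simp add: ncp_blocks_def ncp_oplus_eq[OF P] card_Un_disjoint shift_blocks_def)
qed

lemma ncp_h_sends:
  assumes "n \<ge> 1"
  shows "catalan_data.h_sends nc_partitions {} ncp_lam ncp_oplus n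
    (ncp_comp, ncp_blocks) (ncp_rcomp, ncp_nonmin)"
proof -
  interpret catalan_structure nc_partitions "{}" ncp_lam ncp_oplus by (rule ncp_catalan)
  show ?thesis
  proof (rule h_sendsI[OF assms])
    show "ncp_comp (ncp_lam u) = 1" if "u \<in> carrier" for u
      using num_summands_lam_oplus(2)[OF that that] by (simp add: ncp_comp_def)
    show "ncp_comp (ncp_oplus (ncp_lam u) v) = Suc (ncp_comp v)" if "u \<in> carrier" "v \<in> carrier" for u v
      using num_summands_lam_oplus(1)[OF that] by (simp add: ncp_comp_def)
    have lam: "ncp_rcomp (ncp_lam u) = Suc (ncp_rcomp u)" if u: "u \<in> carrier" for u
    proof -
      obtain k where k: "u \<in> nc_partitions k" using u by (auto simp: carrier_def)
      then show ?thesis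
        using set_ncp_flatten[OF k] by (simp add: ncp_rcomp_def ncp_flatten_lam perm_rmax_Cons)
    qed
    then show "ncp_rcomp (ncp_lam u) = Suc (ncp_rcomp u)" if "u \<in> carrier" for u using that .
    show "ncp_rcomp (ncp_lam {}) = 1"
      using lam[OF e_carrier] ncp_flatten_eq[of "[]"] by (simp add: ncp_rcomp_def)
    show "ncp_blocks (ncp_lam {}) = 1" by (simp add: ncp_blocks_def ncp_lam_def)
    show "ncp_blocks (ncp_lam u) = ncp_blocks u" if "u \<in> carrier" "u \<noteq> {}" for u
      using that ncp_blocks_lam by (auto simp: carrier_def)
    show "ncp_rcomp (ncp_oplus t u) = ncp_rcomp u" "ncp_blocks (ncp_oplus t u) = ncp_blocks t + ncp_blocks u"
      if tu: "t \<in> carrier" "u \<in> carrier" "u \<noteq> {}" for t u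
    proof -
      obtain k l where kl: "t \<in> nc_partitions k" "u \<in> nc_partitions l"
        using tu by (auto simp: carrier_def)
      then have "l \<noteq> 0" using tu nc_partitions_0 by auto
      then have "ncp_flatten u \<noteq> []" using set_ncp_flatten[OF kl(2)] by auto
      then show "ncp_rcomp (ncp_oplus t u) = ncp_rcomp u"
        using set_ncp_flatten[OF kl(1)] set_ncp_flatten[OF kl(2)]
        unfolding ncp_rcomp_def ncp_flatten_oplus[OF kl]
        by (subst perm_rmax_append) (auto simp: perm_rmax_shift)
      show "ncp_blocks (ncp_oplus t u) = ncp_blocks t + ncp_blocks u" by (rule ncp_blocks_oplus[OF kl])
    qed
    show "ncp_nonmin t = n + 1 - ncp_blocks t" if "t \<in> nc_partitions n" for t
      by (simp add: ncp_nonmin_def ncp_size_eq[OF that])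
  qed
qed

section \<open>Triangulations\<close>

text \<open>Maximality among all non-crossing supersets amounts to the impossibility of adding a
  single chord; one orientation of crossing suffices inside \<open>T\<close> by symmetry.\<close>

lemma triangulations_iff:
  "T \<in> triangulations n \<longleftrightarrow>
    (\<forall>a b. (a, b) \<in> T \<longrightarrow> 1 \<le> a \<and> a < b \<and> b \<le> n + 2) \<and>
    (\<forall>a b c d. (a, b) \<in> T \<longrightarrow> (c, d) \<in> T \<longrightarrow> \<not> (a < c \<and> c < b \<and> b < d)) \<and>
    (\<forall>a b. 1 \<le> a \<longrightarrow> a < b \<longrightarrow> b \<le> n + 2 \<longrightarrow>
      (\<forall>c d. (c, d) \<in> T \<longrightarrow> \<not> (a < c \<and> c < b \<and> b < d) \<and> \<not> (c < a \<and> a < d \<and> d < b)) \<longrightarrow> (a, b) \<in> T)"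
    (is "_ \<longleftrightarrow> ?chords T \<and> ?nc T \<and> ?max T")
proof -
  have nc: "noncrossing_chords n T \<longleftrightarrow> ?chords T \<and> ?nc T" for T
    unfolding noncrossing_chords_def polygon_chords_def crossing_def by fastforce
  show ?thesis
  proof
    assume T: "T \<in> triangulations n"
    then have ncT: "?chords T" "?nc T" and max: "\<And>T'. noncrossing_chords n T' \<Longrightarrow> T \<subseteq> T' \<Longrightarrow> T' = T"
      unfolding triangulations_def using nc[of T] by auto
    have "(a, b) \<in> T" if ab: "1 \<le> a" "a < b" "b \<le> n + 2"
      "\<forall>c d. (c, d) \<in> T \<longrightarrow> \<not> (a < c \<and> c < b \<and> b < d) \<and> \<not> (c < a \<and> a < d \<and> d < b)" for a b
    proof -
      have "?chords (insert (a, b) T)" using ncT(1) ab by simp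
      moreover have "?nc (insert (a, b) T)" using ncT(2) ab(4) by auto
      ultimately have "insert (a, b) T = T" using max[of "insert (a, b) T"] nc by blast
      then show ?thesis by blast
    qed
    then show "?chords T \<and> ?nc T \<and> ?max T" using ncT by blast
  next
    assume *: "?chords T \<and> ?nc T \<and> ?max T"
    have "T' = T" if T': "noncrossing_chords n T'" "T \<subseteq> T'" for T'
    proof -
      have T'': "?chords T' \<and> ?nc T'" using T'(1) unfolding nc .
      note chords = T''[THEN conjunct1, rule_format] and nc' = T''[THEN conjunct2, rule_format]
      have "(a, b) \<in> T" if ab: "(a, b) \<in> T'" for a b
      proof (rule *[THEN conjunct2, THEN conjunct2, rule_format])
        show "1 \<le> a" "a < b" "b \<le> n + 2" using chords[OF ab] by simp_all
        show "\<not> (a < c \<and> c < b \<and> b < d) \<and> \<not> (c < a \<and> a < d \<and> d < b)" if "(c, d) \<in> T" for c d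
        proof -
          have "(c, d) \<in> T'" using that T'(2) by (rule subsetD[rotated])
          then show ?thesis using nc'[OF ab] nc'[OF _ ab] by simp
        qed
      qed
      then show ?thesis using T'(2) by auto
    qed
    moreover have "noncrossing_chords n T"
      unfolding nc using *[THEN conjunct1] *[THEN conjunct2, THEN conjunct1] by (rule conjI)
    ultimately show "T \<in> triangulations n" unfolding triangulations_def by blast
  qed
qed

lemma tri_bounds:
  assumes "T \<in> triangulations n" "(a, b) \<in> T" shows "1 \<le> a" "a < b" "b \<le> n + 2"
  using assms unfolding triangulations_iff by blast+

lemma tri_noncrossing:
  "T \<in> triangulations n \<Longrightarrow> (a, b) \<in> T \<Longrightarrow> (c, d) \<in> T \<Longrightarrow> a < c \<Longrightarrow> c < b \<Longrightarrow> b < d \<Longrightarrow> False"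
  unfolding triangulations_iff by blast

lemma tri_maximal:
  assumes "T \<in> triangulations n" "1 \<le> a" "a < b" "b \<le> n + 2"
    and "\<And>c d. (c, d) \<in> T \<Longrightarrow> a < c \<Longrightarrow> c < b \<Longrightarrow> b < d \<Longrightarrow> False"
    and "\<And>c d. (c, d) \<in> T \<Longrightarrow> c < a \<Longrightarrow> a < d \<Longrightarrow> d < b \<Longrightarrow> False"
  shows "(a, b) \<in> T"
  using assms unfolding triangulations_iff by blast

lemma triangulationsI:
  assumes "\<And>a b. (a, b) \<in> T \<Longrightarrow> 1 \<le> a \<and> a < b \<and> b \<le> n + 2"
    and "\<And>a b c d. (a, b) \<in> T \<Longrightarrow> (c, d) \<in> T \<Longrightarrow> a < c \<Longrightarrow> c < b \<Longrightarrow> b < d \<Longrightarrow> False"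
    and "\<And>a b. 1 \<le> a \<Longrightarrow> a < b \<Longrightarrow> b \<le> n + 2
      \<Longrightarrow> (\<And>c d. (c, d) \<in> T \<Longrightarrow> a < c \<Longrightarrow> c < b \<Longrightarrow> b < d \<Longrightarrow> False)
      \<Longrightarrow> (\<And>c d. (c, d) \<in> T \<Longrightarrow> c < a \<Longrightarrow> a < d \<Longrightarrow> d < b \<Longrightarrow> False) \<Longrightarrow> (a, b) \<in> T"
  shows "T \<in> triangulations n"
  unfolding triangulations_iff using assms by blast

lemma tri_outer: "T \<in> triangulations n \<Longrightarrow> (1, n + 2) \<in> T"
  using tri_bounds by (intro tri_maximal) fastforce+

lemma tri_side: "T \<in> triangulations n \<Longrightarrow> 1 \<le> i \<Longrightarrow> i \<le> n + 1 \<Longrightarrow> (i, i + 1) \<in> T"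
  by (rule tri_maximal) auto

lemma tri_12: "T \<in> triangulations n \<Longrightarrow> (1, 2) \<in> T"
  using tri_side[of T n 1] by (simp add: numeral_2_eq_2)

lemma tri_finite: assumes "T \<in> triangulations n" shows "finite T"
proof (rule finite_subset)
  show "T \<subseteq> {..n + 2} \<times> {..n + 2}"
  proof (rule subrelI)
    fix a b assume "(a, b) \<in> T"
    then show "(a, b) \<in> {..n + 2} \<times> {..n + 2}" using tri_bounds[OF assms, of a b] by simp
  qed
qed simp

lemma tri_size_eq: assumes "T \<in> triangulations n" shows "tri_size T = n"
proof -
  have "Max (snd ` T) = n + 2"
  proof (rule Max_eqI)
    show "finite (snd ` T)" using tri_finite[OF assms] by simp
    show "y \<le> n + 2" if "y \<in> snd ` T" for y using tri_bounds(3)[OF assms] that by auto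
    show "n + 2 \<in> snd ` T" using tri_outer[OF assms] by force
  qed
  then show ?thesis by (simp add: tri_size_def)
qed

lemma triangulations_0: "triangulations 0 = {tri_e}"
proof -
  have "T = tri_e" if T: "T \<in> triangulations 0" for T
  proof
    show "T \<subseteq> tri_e"
    proof (rule subrelI)
      fix a b assume "(a, b) \<in> T"
      from tri_bounds[OF T this] show "(a, b) \<in> tri_e" by (auto simp: tri_e_def)
    qed
    show "tri_e \<subseteq> T" using tri_12[OF T] by (simp add: tri_e_def)
  qed
  moreover have "tri_e \<in> triangulations 0" by (rule triangulationsI) (auto simp: tri_e_def)
  ultimately show ?thesis by blast
qed

text \<open>Truncated subtraction creates no spurious members, because no chord of \<open>T\<close>
  involves a vertex 0.\<close>

lemma mem_tri_lam:
  assumes "T \<in> triangulations n"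
  shows "(a, b) \<in> tri_lam T \<longleftrightarrow> (a - 1, b - 1) \<in> T \<or> a = 1 \<and> (b = 2 \<or> b = n + 3)"
proof -
  have "(a - 1, b - 1) \<in> T" if "(a, b) \<in> map_prod Suc Suc ` T" using that by auto
  moreover have "(a, b) \<in> map_prod Suc Suc ` T" if "(a - 1, b - 1) \<in> T"
  proof -
    have "a = Suc (a - 1)" "b = Suc (b - 1)" using tri_bounds[OF assms that] by auto
    then show ?thesis using that by (metis map_prod_imageI)
  qed
  ultimately show ?thesis unfolding tri_lam_def tri_size_eq[OF assms] by auto
qed

text \<open>Relabelling fixes vertex 1 and shifts all others, so the condition
  \<open>2 \<le> a - m\<close> keeps the shifted vertices apart from 1.\<close>

lemma mem_tri_oplus:
  assumes S: "S \<in> triangulations m" and T: "T \<in> triangulations n"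
  shows "(a, b) \<in> tri_oplus S T \<longleftrightarrow>
    (a, b) \<in> S \<or> a = 1 \<and> (1, b - m) \<in> T \<or> 2 \<le> a - m \<and> (a - m, b - m) \<in> T"
proof -
  have "a = 1 \<and> (1, b - m) \<in> T \<or> 2 \<le> a - m \<and> (a - m, b - m) \<in> T"
    if image: "(a, b) \<in> map_prod (tri_relabel m) (tri_relabel m) ` T"
  proof -
    obtain c d where cd: "(c, d) \<in> T" "a = tri_relabel m c" "b = tri_relabel m d" using image by auto
    have "b = m + d" "c = 1 \<Longrightarrow> a = 1" "c \<noteq> 1 \<Longrightarrow> a = m + c \<and> 2 \<le> c"
      using tri_bounds[OF T cd(1)] cd(2,3) by (auto simp: tri_relabel_def)
    then show ?thesis using cd(1) by (cases "c = 1") auto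
  qed
  moreover have "(a, b) \<in> map_prod (tri_relabel m) (tri_relabel m) ` T" if "a = 1" "(1, b - m) \<in> T"
  proof -
    have "b = tri_relabel m (b - m)" using tri_bounds[OF T that(2)] by (simp add: tri_relabel_def)
    moreover have "a = tri_relabel m 1" using that(1) by (simp add: tri_relabel_def)
    ultimately show ?thesis using that(2) by (metis map_prod_imageI)
  qed
  moreover have "(a, b) \<in> map_prod (tri_relabel m) (tri_relabel m) ` T"
    if "2 \<le> a - m" "(a - m, b - m) \<in> T"
  proof -
    have "b = tri_relabel m (b - m)" "a = tri_relabel m (a - m)"
      using tri_bounds[OF T that(2)] that(1) by (simp_all add: tri_relabel_def)
    then show ?thesis using that(2) by (metis map_prod_imageI)
  qed
  ultimately show ?thesis unfolding tri_oplus_def tri_size_eq[OF S] by blast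
qed

lemma tri_lam_closed:
  assumes T: "T \<in> triangulations n" shows "tri_lam T \<in> triangulations (Suc n)"
proof (rule triangulationsI)
  fix a b assume "(a, b) \<in> tri_lam T"
  then consider "(a - 1, b - 1) \<in> T" | "a = 1" "b = 2 \<or> b = n + 3" unfolding mem_tri_lam[OF T] by blast
  then show "1 \<le> a \<and> a < b \<and> b \<le> Suc n + 2"
  proof cases
    case 1
    from tri_bounds[OF T this] show ?thesis by linarith
  qed auto
next
  fix a b c d assume ab: "(a, b) \<in> tri_lam T" and cd: "(c, d) \<in> tri_lam T" and ord: "a < c" "c < b" "b < d"
  have "(c - 1, d - 1) \<in> T"
  proof (rule ccontr)
    assume "(c - 1, d - 1) \<notin> T"
    then have "c = 1" using cd unfolding mem_tri_lam[OF T] by blast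
    then have "a = 0" using ord by simp
    then have "(0, b - 1) \<in> T" using ab unfolding mem_tri_lam[OF T] by simp
    from tri_bounds[OF T this] show False by simp
  qed
  note cd' = this tri_bounds[OF T this]
  have "(a - 1, b - 1) \<in> T"
    using ab cd'(2-) ord unfolding mem_tri_lam[OF T] by auto
  note ab' = tri_bounds[OF T this]
  show False by (rule tri_noncrossing[OF T \<open>(a - 1, b - 1) \<in> T\<close> cd'(1)]) (use ord cd'(2-) ab' in linarith)+
next
  fix a b
  assume ab: "1 \<le> a" "a < b" "b \<le> Suc n + 2"
    and nc1: "\<And>c d. (c, d) \<in> tri_lam T \<Longrightarrow> a < c \<Longrightarrow> c < b \<Longrightarrow> b < d \<Longrightarrow> False"
    and nc2: "\<And>c d. (c, d) \<in> tri_lam T \<Longrightarrow> c < a \<Longrightarrow> a < d \<Longrightarrow> d < b \<Longrightarrow> False"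
  have shift: "(c + 1, d + 1) \<in> tri_lam T" if "(c, d) \<in> T" for c d
    using that unfolding mem_tri_lam[OF T] by simp
  show "(a, b) \<in> tri_lam T"
  proof (cases "a = 1")
    case True
    \<comment> \<open>The old outer edge cuts off vertex 1, so any other chord from 1 would cross
      it.\<close>
    have "(2, n + 3) \<in> tri_lam T" using shift[OF tri_outer[OF T]] by (simp add: numeral_eq_Suc)
    then have "b = 2 \<or> b = n + 3" using nc1[of 2 "n + 3"] True ab by fastforce
    then show ?thesis unfolding mem_tri_lam[OF T] using True by blast
  next
    case False
    have "(a - 1, b - 1) \<in> T"
    proof (rule tri_maximal[OF T])
      show "1 \<le> a - 1" "a - 1 < b - 1" "b - 1 \<le> n + 2" using ab False by linarith+
      show False if "(c, d) \<in> T" "a - 1 < c" "c < b - 1" "b - 1 < d" for c d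
        by (rule nc1[OF shift[OF that(1)]]) (use that(2-) in linarith)+
      show False if "(c, d) \<in> T" "c < a - 1" "a - 1 < d" "d < b - 1" for c d
        by (rule nc2[OF shift[OF that(1)]]) (use that(2-) in linarith)+
    qed
    then show ?thesis unfolding mem_tri_lam[OF T] by blast
  qed
qed

lemma tri_oplus_closed:
  assumes S: "S \<in> triangulations m" and T: "T \<in> triangulations n"
  shows "tri_oplus S T \<in> triangulations (m + n)"
proof -
  note mem = mem_tri_oplus[OF S T]
  have cases: "(a, b) \<in> S \<and> 1 \<le> a \<and> a < b \<and> b \<le> m + 2 \<or>
      a = 1 \<and> (1, b - m) \<in> T \<and> m + 2 \<le> b \<and> b \<le> m + n + 2 \<or>
      m + 2 \<le> a \<and> a < b \<and> (a - m, b - m) \<in> T \<and> b \<le> m + n + 2"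
    if "(a, b) \<in> tri_oplus S T" for a b
  proof -
    consider "(a, b) \<in> S" | "a = 1" "(1, b - m) \<in> T" | "2 \<le> a - m" "(a - m, b - m) \<in> T"
      using \<open>(a, b) \<in> tri_oplus S T\<close> unfolding mem by blast
    then show ?thesis
    proof cases
      case 1
      then show ?thesis using tri_bounds[OF S 1] by blast
    next
      case 2
      moreover have "m + 2 \<le> b" "b \<le> m + n + 2" using tri_bounds[OF T 2(2)] by linarith+
      ultimately show ?thesis by blast
    next
      case 3
      moreover have "m + 2 \<le> a" "a < b" "b \<le> m + n + 2" using tri_bounds[OF T 3(2)] 3(1) by linarith+
      ultimately show ?thesis by blast
    qed
  qed
  have from_T: "(1, m + d) \<in> tri_oplus S T" if "(1, d) \<in> T" for d
    unfolding mem using that by simp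
  have from_T': "(m + c, m + d) \<in> tri_oplus S T" if "(c, d) \<in> T" "2 \<le> c" for c d
    unfolding mem using that by simp
  have from_S: "(c, d) \<in> tri_oplus S T" if "(c, d) \<in> S" for c d
    unfolding mem using that by simp
  show ?thesis
  proof (rule triangulationsI)
    fix a b assume "(a, b) \<in> tri_oplus S T"
    from cases[OF this] show "1 \<le> a \<and> a < b \<and> b \<le> m + n + 2" by auto
  next
    fix a b c d
    assume ab: "(a, b) \<in> tri_oplus S T" and cd: "(c, d) \<in> tri_oplus S T" and ord: "a < c" "c < b" "b < d"
    from cases[OF ab] show False
    proof (elim disjE conjE)
      assume S': "(a, b) \<in> S" "1 \<le> a" "b \<le> m + 2"
      then have "(c, d) \<in> S" using cases[OF cd] ord by auto
      then show False using tri_noncrossing[OF S S'(1) _ ord] by blast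
    next
      assume T': "a = 1" "(1, b - m) \<in> T" "m + 2 \<le> b"
      then have c: "m + 2 \<le> c" "(c - m, d - m) \<in> T" using cases[OF cd] ord by auto
      show False by (rule tri_noncrossing[OF T T'(2) c(2)]) (use ord c(1) in linarith)+
    next
      assume T': "m + 2 \<le> a" "(a - m, b - m) \<in> T"
      then have c: "m + 2 \<le> c" "(c - m, d - m) \<in> T" using cases[OF cd] ord by auto
      show False by (rule tri_noncrossing[OF T T'(2) c(2)]) (use ord T'(1) in linarith)+
    qed
  next
    fix a b
    assume ab: "1 \<le> a" "a < b" "b \<le> m + n + 2"
      and nc1: "\<And>c d. (c, d) \<in> tri_oplus S T \<Longrightarrow> a < c \<Longrightarrow> c < b \<Longrightarrow> b < d \<Longrightarrow> False"
      and nc2: "\<And>c d. (c, d) \<in> tri_oplus S T \<Longrightarrow> c < a \<Longrightarrow> a < d \<Longrightarrow> d < b \<Longrightarrow> False"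
    \<comment> \<open>This is the glued edge: a chord that does not cross it lies in one of the two
      polygons, where maximality of \<open>S\<close> or \<open>T\<close> applies.\<close>
    have "(1, m + 2) \<in> tri_oplus S T" by (rule from_S[OF tri_outer[OF S]])
    then have "\<not> (1 < a \<and> a < m + 2 \<and> m + 2 < b)" using nc2[of 1 "m + 2"] by blast
    then have "b \<le> m + 2 \<or> a = 1 \<and> m + 2 < b \<or> m + 2 \<le> a" using ab(1) by linarith
    then consider "b \<le> m + 2" | "a = 1" "m + 2 < b" | "m + 2 \<le> a" by blast
    then show "(a, b) \<in> tri_oplus S T"
    proof cases
      case 1
      have "(a, b) \<in> S"
        by (rule tri_maximal[OF S ab(1,2) 1]) (use nc1 nc2 from_S in blast)+
      then show ?thesis by (rule from_S)
    next
      case 2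
      have "(1, b - m) \<in> T"
      proof (rule tri_maximal[OF T])
        show False if "(c, d) \<in> T" "1 < c" "c < b - m" "b - m < d" for c d
          by (rule nc1[OF from_T'[OF that(1)]]) (use that(2-) 2 in linarith)+
        show False if "(c, d) \<in> T" "c < 1" for c d using tri_bounds(1)[OF T that(1)] that(2) by simp
      qed (use 2 ab in linarith)+
      then show ?thesis unfolding mem using 2 by blast
    next
      case 3
      have "(a - m, b - m) \<in> T"
      proof (rule tri_maximal[OF T])
        show False if "(c, d) \<in> T" "a - m < c" "c < b - m" "b - m < d" for c d
          by (rule nc1[OF from_T'[OF that(1)]]) (use that(2-) 3 in linarith)+
        show False if cd: "(c, d) \<in> T" "c < a - m" "a - m < d" "d < b - m" for c d
        proof (cases "c = 1")
          case True
          then have "(1, m + d) \<in> tri_oplus S T" using from_T cd(1) by blast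
          then show False by (rule nc2) (use cd(2-) 3 in linarith)+
        next
          case False
          then have "2 \<le> c" using tri_bounds(1)[OF T cd(1)] by simp
          show False by (rule nc2[OF from_T'[OF cd(1)]]) (use \<open>2 \<le> c\<close> cd(2-) in linarith)+
        qed
      qed (use 3 ab in linarith)+
      moreover have "2 \<le> a - m" using 3 by linarith
      ultimately show ?thesis unfolding mem by blast
    qed
  qed
qed

text \<open>In \<open>lam u \<oplus> v\<close> with \<open>u\<close> of size \<open>k\<close>, the neighbour of vertex \<open>1\<close> following \<open>2\<close> is \<open>k + 3\<close>.
  The two parts below recover \<open>u\<close> and \<open>v\<close> once \<open>k\<close> is known.\<close>

definition tri_inner :: "nat \<Rightarrow> (nat \<times> nat) set \<Rightarrow> (nat \<times> nat) set" where
  "tri_inner k T = {(a, b). 1 \<le> a \<and> b \<le> k + 2 \<and> (a + 1, b + 1) \<in> T}"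

definition tri_rest :: "nat \<Rightarrow> (nat \<times> nat) set \<Rightarrow> (nat \<times> nat) set" where
  "tri_rest k T = {(a, b). 2 \<le> b \<and> (a = 1 \<and> (1, b + k + 1) \<in> T \<or> 2 \<le> a \<and> (a + k + 1, b + k + 1) \<in> T)}"

lemma mem_tri_lam_oplus:
  assumes u: "u \<in> triangulations k" and v: "v \<in> triangulations l"
  shows "(a, b) \<in> tri_oplus (tri_lam u) v \<longleftrightarrow>
    (a - 1, b - 1) \<in> u \<or> a = 1 \<and> b = 2 \<or> a = 1 \<and> (1, b - (k + 1)) \<in> v \<or>
    2 \<le> a - (k + 1) \<and> (a - (k + 1), b - (k + 1)) \<in> v"
proof -
  have "b - (k + 1) = 2" if "b = k + 3" using that by simp
  then show ?thesis
    unfolding mem_tri_oplus[OF tri_lam_closed[OF u] v] mem_tri_lam[OF u]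
    using tri_12[OF v] by auto
qed

lemma tri_parts:
  assumes u: "u \<in> triangulations k" and v: "v \<in> triangulations l"
    and T: "T = tri_oplus (tri_lam u) v"
  shows "(1, k + 3) \<in> T" "(1, j) \<in> T \<Longrightarrow> 2 < j \<Longrightarrow> k + 3 \<le> j"
    and "tri_inner k T = u" "tri_rest k T = v"
proof -
  note mem = mem_tri_lam_oplus[OF u v, folded T]
  have "k + 3 - (k + 1) = 2" by simp
  then show "(1, k + 3) \<in> T" unfolding mem using tri_12[OF v] by simp
  show "k + 3 \<le> j" if j: "(1, j) \<in> T" "2 < j"
  proof -
    have "(0, j - 1) \<notin> u" using tri_bounds(1)[OF u, of 0] by auto
    then have "(1, j - (k + 1)) \<in> v" using j unfolding mem by simp
    from tri_bounds(2)[OF v this] show ?thesis by simp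
  qed
  show "tri_inner k T = u"
  proof (intro set_eqI, clarify)
    fix a b
    show "(a, b) \<in> tri_inner k T \<longleftrightarrow> (a, b) \<in> u"
    proof
      assume "(a, b) \<in> u"
      then show "(a, b) \<in> tri_inner k T"
        using tri_bounds[OF u] unfolding tri_inner_def mem by auto
    next
      assume "(a, b) \<in> tri_inner k T"
      then have ab: "1 \<le> a" "b \<le> k + 2" "(a + 1, b + 1) \<in> T" by (auto simp: tri_inner_def)
      have "\<not> (2 \<le> a + 1 - (k + 1) \<and> (a + 1 - (k + 1), b + 1 - (k + 1)) \<in> v)"
      proof
        assume *: "2 \<le> a + 1 - (k + 1) \<and> (a + 1 - (k + 1), b + 1 - (k + 1)) \<in> v"
        then show False using tri_bounds(2)[OF v conjunct2[OF *]] conjunct1[OF *] ab(2) by linarith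
      qed
      then show "(a, b) \<in> u" using ab unfolding mem by auto
    qed
  qed
  show "tri_rest k T = v"
  proof (intro set_eqI, clarify)
    fix a b
    show "(a, b) \<in> tri_rest k T \<longleftrightarrow> (a, b) \<in> v"
    proof
      assume ab: "(a, b) \<in> v"
      have "1 \<le> a" "a < b" using tri_bounds[OF v ab] by auto
      then show "(a, b) \<in> tri_rest k T"
        using ab unfolding tri_rest_def mem by (cases "a = 1") auto
    next
      assume ab: "(a, b) \<in> tri_rest k T"
      show "(a, b) \<in> v"
      proof (cases "a = 1")
        case True
        then have "2 \<le> b" "(1, b + k + 1) \<in> T" using ab by (auto simp: tri_rest_def)
        moreover have "(0, b + k) \<notin> u" using tri_bounds(1)[OF u, of 0] by auto
        ultimately show ?thesis using True unfolding mem by auto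
      next
        case False
        then have ab': "2 \<le> b" "2 \<le> a" "(a + k + 1, b + k + 1) \<in> T" using ab by (auto simp: tri_rest_def)
        have "(a + k, b + k) \<notin> u"
        proof
          assume "(a + k, b + k) \<in> u"
          from tri_bounds[OF u this] show False using ab'(2) by linarith
        qed
        then show ?thesis using ab' unfolding mem by auto
      qed
    qed
  qed
qed

text \<open>The triangle on the side \<open>(1, 2)\<close> has as its third vertex \<open>m\<close>,
  the least neighbour of 1 beyond 2. Its sides \<open>(2, m)\<close> and \<open>(1, m)\<close> bound
  the polygons of \<open>u\<close> and \<open>v\<close>.\<close>

lemma tri_decompose:
  assumes T: "T \<in> triangulations (Suc n)"
  shows "\<exists>k l. \<exists>u\<in>triangulations k. \<exists>v\<in>triangulations l. T = tri_oplus (tri_lam u) v"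
proof -
  define m where "m = (LEAST j. 2 < j \<and> (1, j) \<in> T)"
  have "2 < n + 3 \<and> (1, n + 3) \<in> T" using tri_outer[OF T] by (simp add: numeral_eq_Suc)
  then have m: "2 < m" "(1, m) \<in> T" and m_le: "\<And>j. 2 < j \<Longrightarrow> (1, j) \<in> T \<Longrightarrow> m \<le> j"
    unfolding m_def using LeastI[of "\<lambda>j. 2 < j \<and> (1, j) \<in> T"] Least_le[of "\<lambda>j. 2 < j \<and> (1, j) \<in> T"]
    by blast+
  \<comment> \<open>The polygon on the vertices \<open>2, ..., m\<close> has
    \<open>m - 1 = k + 2\<close> vertices.\<close>
  define k where "k = m - 3"
  have mk: "m = k + 3" using m(1) by (simp add: k_def)
  have mn: "m \<le> n + 3" using tri_bounds(3)[OF T m(2)] by simp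
  define l where "l = n - k"
  have nkl: "n = k + l" using mn mk by (simp add: l_def)
  \<comment> \<open>A chord crossing \<open>(2, m)\<close> would either cross \<open>(1, m)\<close>
    as well or join 1 to a vertex strictly between 2 and \<open>m\<close>, against the choice of
    \<open>m\<close>.\<close>
  have m2: "(2, m) \<in> T"
  proof (rule tri_maximal[OF T])
    show False if "(c, d) \<in> T" "2 < c" "c < m" "m < d" for c d
      using tri_noncrossing[OF T m(2) that(1)] that(2-) by simp
    show False if "(c, d) \<in> T" "c < 2" "2 < d" "d < m" for c d
    proof -
      have "c = 1" using tri_bounds(1)[OF T that(1)] that(2) by simp
      then show False using m_le[of d] that by simp
    qed
  qed (use m mn in auto)
  have cross_1m: False if "(c, d) \<in> T" "1 < c" "c < m" "m < d" for c d
    using tri_noncrossing[OF T m(2) that(1)] that(2-) by simp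
  define u where "u = tri_inner k T"
  define v where "v = tri_rest k T"
  have u: "u \<in> triangulations k"
  proof (rule triangulationsI)
    show "1 \<le> a \<and> a < b \<and> b \<le> k + 2" if "(a, b) \<in> u" for a b
      using that tri_bounds(2)[OF T, of "a + 1" "b + 1"] by (auto simp: u_def tri_inner_def)
    show False if "(a, b) \<in> u" "(c, d) \<in> u" "a < c" "c < b" "b < d" for a b c d
      using that tri_noncrossing[OF T, of "a + 1" "b + 1" "c + 1" "d + 1"]
      by (auto simp: u_def tri_inner_def)
    fix a b assume ab: "1 \<le> a" "a < b" "b \<le> k + 2"
      and nc1: "\<And>c d. (c, d) \<in> u \<Longrightarrow> a < c \<Longrightarrow> c < b \<Longrightarrow> b < d \<Longrightarrow> False"
      and nc2: "\<And>c d. (c, d) \<in> u \<Longrightarrow> c < a \<Longrightarrow> a < d \<Longrightarrow> d < b \<Longrightarrow> False"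
    have mem_u: "(c - 1, d - 1) \<in> u" if "(c, d) \<in> T" "2 \<le> c" "d \<le> m" for c d
    proof -
      have "c - 1 + 1 = c" "d - 1 + 1 = d" using tri_bounds(2)[OF T that(1)] that(2) by linarith+
      then show ?thesis using that mk by (simp add: u_def tri_inner_def)
    qed
    have "(a + 1, b + 1) \<in> T"
    proof (rule tri_maximal[OF T])
      show False if cd: "(c, d) \<in> T" "a + 1 < c" "c < b + 1" "b + 1 < d" for c d
      proof (cases "d \<le> m")
        case True
        show False by (rule nc1[OF mem_u[OF cd(1)]]) (use True cd(2-) in linarith)+
      next
        case False
        show False by (rule tri_noncrossing[OF T m2 cd(1)]) (use False cd(2-) ab mk in linarith)+
      qed
      show False if cd: "(c, d) \<in> T" "c < a + 1" "a + 1 < d" "d < b + 1" for c d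
      proof (cases "c = 1")
        case True
        then show False using m_le[of d] cd ab mk by simp
      next
        case False
        then have "2 \<le> c" using tri_bounds(1)[OF T cd(1)] by simp
        show False by (rule nc2[OF mem_u[OF cd(1)]]) (use \<open>2 \<le> c\<close> cd(2-) ab mk in linarith)+
      qed
    qed (use ab mk mn in linarith)+
    then show "(a, b) \<in> u" using ab by (simp add: u_def tri_inner_def)
  qed
  have v: "v \<in> triangulations l"
  proof (rule triangulationsI)
    show "1 \<le> a \<and> a < b \<and> b \<le> l + 2" if ab: "(a, b) \<in> v" for a b
    proof -
      have "2 \<le> b" "a = 1 \<and> (1, b + k + 1) \<in> T \<or> 2 \<le> a \<and> (a + k + 1, b + k + 1) \<in> T"
        using ab by (auto simp: v_def tri_rest_def)
      then show ?thesis
        using tri_bounds[OF T, of 1 "b + k + 1"] tri_bounds[OF T, of "a + k + 1" "b + k + 1"] nkl by auto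
    qed
    show False if ab: "(a, b) \<in> v" and cd: "(c, d) \<in> v" and ord: "a < c" "c < b" "b < d" for a b c d
    proof -
      have "2 \<le> c" using ab ord by (auto simp: v_def tri_rest_def)
      then have "(c + k + 1, d + k + 1) \<in> T" using cd by (auto simp: v_def tri_rest_def)
      moreover have "a = 1 \<and> (1, b + k + 1) \<in> T \<or> 2 \<le> a \<and> (a + k + 1, b + k + 1) \<in> T"
        using ab by (auto simp: v_def tri_rest_def)
      ultimately show False
        using tri_noncrossing[OF T, of 1 "b + k + 1" "c + k + 1" "d + k + 1"]
          tri_noncrossing[OF T, of "a + k + 1" "b + k + 1" "c + k + 1" "d + k + 1"] ord by auto
    qed
    fix a b assume ab: "1 \<le> a" "a < b" "b \<le> l + 2"
      and nc1: "\<And>c d. (c, d) \<in> v \<Longrightarrow> a < c \<Longrightarrow> c < b \<Longrightarrow> b < d \<Longrightarrow> False"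
      and nc2: "\<And>c d. (c, d) \<in> v \<Longrightarrow> c < a \<Longrightarrow> a < d \<Longrightarrow> d < b \<Longrightarrow> False"
    have mem_v: "(c - (k + 1), d - (k + 1)) \<in> v" if "(c, d) \<in> T" "m \<le> c" for c d
    proof -
      have "c - (k + 1) + k + 1 = c" "d - (k + 1) + k + 1 = d" "2 \<le> c - (k + 1)" "2 \<le> d - (k + 1)"
        using tri_bounds(2)[OF T that(1)] that(2) mk by linarith+
      then show ?thesis using that by (simp add: v_def tri_rest_def)
    qed
    have mem_v1: "(1, d - (k + 1)) \<in> v" if "(1, d) \<in> T" "m \<le> d" for d
    proof -
      have "d - (k + 1) + k + 1 = d" "2 \<le> d - (k + 1)" using that(2) mk by linarith+
      then show ?thesis using that by (simp add: v_def tri_rest_def)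
    qed
    show "(a, b) \<in> v"
    proof (cases "a = 1")
      case True
      have "(1, b + k + 1) \<in> T"
      proof (rule tri_maximal[OF T])
        show False if cd: "(c, d) \<in> T" "1 < c" "c < b + k + 1" "b + k + 1 < d" for c d
        proof (cases "m \<le> c")
          case True
          show False by (rule nc1[OF mem_v[OF cd(1) True]]) (use True cd(2-) \<open>a = 1\<close> mk in linarith)+
        next
          case False
          show False by (rule cross_1m[OF cd(1)]) (use False cd(2-) ab mk in linarith)+
        qed
        show False if "(c, d) \<in> T" "c < 1" for c d using tri_bounds(1)[OF T that(1)] that(2) by simp
      qed (use ab nkl in linarith)+
      then show ?thesis using True ab by (simp add: v_def tri_rest_def)
    next
      case False
      have "(a + k + 1, b + k + 1) \<in> T"
      proof (rule tri_maximal[OF T])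
        show False if cd: "(c, d) \<in> T" "a + k + 1 < c" "c < b + k + 1" "b + k + 1 < d" for c d
          by (rule nc1[OF mem_v[OF cd(1)]]) (use cd(2-) False ab mk in linarith)+
        show False if cd: "(c, d) \<in> T" "c < a + k + 1" "a + k + 1 < d" "d < b + k + 1" for c d
        proof -
          have "m < d" using cd(3) False ab mk by linarith
          \<comment> \<open>A chord ending beyond \<open>m\<close> cannot start strictly between 1
            and \<open>m\<close>, so it already belongs to the polygon of \<open>v\<close>.\<close>
          then have "\<not> (1 < c \<and> c < m)" using cross_1m[OF cd(1)] by blast
          then have "c = 1 \<or> m \<le> c" using tri_bounds(1)[OF T cd(1)] by linarith
          then consider "c = 1" | "m \<le> c" by blast
          then show False
          proof cases
            case 1
            then have "(1, d - (k + 1)) \<in> v" using mem_v1[of d] cd(1) \<open>m < d\<close> by simp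
            then show False by (rule nc2) (use cd(3,4) False ab in linarith)+
          next
            case 2
            show False by (rule nc2[OF mem_v[OF cd(1) 2]]) (use 2 cd(2-) mk in linarith)+
          qed
        qed
      qed (use ab nkl in linarith)+
      then show ?thesis using False ab by (simp add: v_def tri_rest_def)
    qed
  qed
  have "T = tri_oplus (tri_lam u) v"
  proof (intro set_eqI, clarify)
    fix a b
    note mem = mem_tri_lam_oplus[OF u v, of a b]
    show "(a, b) \<in> T \<longleftrightarrow> (a, b) \<in> tri_oplus (tri_lam u) v"
    proof
      assume ab: "(a, b) \<in> T"
      note bd = tri_bounds[OF T ab]
      consider "b \<le> m" "a \<noteq> 1" | "a = 1" "b = 2" | "a = 1" "m \<le> b" | "m \<le> a"
        using bd m_le[of b] cross_1m[OF ab] ab by (cases "a = 1") force+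
      then show "(a, b) \<in> tri_oplus (tri_lam u) v"
      proof cases
        case 1
        then have "a - 1 + 1 = a" "b - 1 + 1 = b" "1 \<le> a - 1" using bd by linarith+
        then have "(a - 1, b - 1) \<in> u" using ab 1 mk by (simp add: u_def tri_inner_def)
        then show ?thesis unfolding mem by blast
      next
        case 2
        then show ?thesis unfolding mem by blast
      next
        case 3
        then have "b - (k + 1) + k + 1 = b" "2 \<le> b - (k + 1)" using mk by linarith+
        then have "(1, b - (k + 1)) \<in> v" using ab 3 by (simp add: v_def tri_rest_def)
        then show ?thesis unfolding mem using 3 by blast
      next
        case 4
        then have "a - (k + 1) + k + 1 = a" "b - (k + 1) + k + 1 = b" "2 \<le> b - (k + 1)" "2 \<le> a - (k + 1)"
          using mk bd by linarith+
        then have "(a - (k + 1), b - (k + 1)) \<in> v" using ab by (simp add: v_def tri_rest_def)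
        then show ?thesis unfolding mem using \<open>2 \<le> a - (k + 1)\<close> by blast
      qed
    next
      assume "(a, b) \<in> tri_oplus (tri_lam u) v"
      then consider "(a - 1, b - 1) \<in> u" | "a = 1" "b = 2" | "a = 1" "(1, b - (k + 1)) \<in> v"
        | "2 \<le> a - (k + 1)" "(a - (k + 1), b - (k + 1)) \<in> v" unfolding mem by blast
      then show "(a, b) \<in> T"
      proof cases
        case 1
        have "a - 1 + 1 = a" "b - 1 + 1 = b" using tri_bounds[OF u 1] by linarith+
        then show ?thesis using 1 by (simp add: u_def tri_inner_def)
      next
        case 2
        then show ?thesis using tri_12[OF T] by simp
      next
        case 3
        have "b - (k + 1) + k + 1 = b" using tri_bounds[OF v 3(2)] by linarith
        then show ?thesis using 3 by (simp add: v_def tri_rest_def)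
      next
        case 4
        have "a - (k + 1) + k + 1 = a" "b - (k + 1) + k + 1 = b" using tri_bounds[OF v 4(2)] 4(1) by linarith+
        then show ?thesis using 4 by (simp add: v_def tri_rest_def)
      qed
    qed
  qed
  then show ?thesis using u v by blast
qed

lemma tri_catalan: "catalan_structure triangulations tri_e tri_lam tri_oplus"
proof (rule catalan_structureI)
  show "m = n" if "T \<in> triangulations m" "T \<in> triangulations n" for T m n
    using that tri_size_eq by blast
  have e: "tri_e \<in> triangulations 0" using triangulations_0 by simp
  show "tri_oplus (tri_oplus S T) R = tri_oplus S (tri_oplus T R)"
    if STR: "S \<in> triangulations k" "T \<in> triangulations m" "R \<in> triangulations n" for S T R k m n
  proof (intro set_eqI, clarify)
    fix a b
    have "(0, x) \<notin> R" for x using tri_bounds(1)[OF STR(3), of 0] by auto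
    then show "(a, b) \<in> tri_oplus (tri_oplus S T) R \<longleftrightarrow> (a, b) \<in> tri_oplus S (tri_oplus T R)"
      unfolding mem_tri_oplus[OF tri_oplus_closed[OF STR(1,2)] STR(3)] mem_tri_oplus[OF STR(1,2)]
        mem_tri_oplus[OF STR(1) tri_oplus_closed[OF STR(2,3)]] mem_tri_oplus[OF STR(2,3)]
      by auto
  qed
  show "tri_oplus tri_e T = T" if T: "T \<in> triangulations n" for T n
  proof (intro set_eqI, clarify)
    fix a b
    show "(a, b) \<in> tri_oplus tri_e T \<longleftrightarrow> (a, b) \<in> T"
      unfolding mem_tri_oplus[OF e T] using tri_12[OF T] tri_bounds(1)[OF T, of a b]
      by (cases "a = 1") (auto simp: tri_e_def)
  qed
  show "tri_oplus T tri_e = T" if T: "T \<in> triangulations n" for T n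
  proof (intro set_eqI, clarify)
    fix a b
    have "b = n + 2" if "b - n = 2" using that by simp
    then show "(a, b) \<in> tri_oplus T tri_e \<longleftrightarrow> (a, b) \<in> T"
      unfolding mem_tri_oplus[OF T e] using tri_outer[OF T] by (auto simp: tri_e_def)
  qed
  show "u = u' \<and> v = v'"
    if uv: "u \<in> triangulations k" "v \<in> triangulations l" "u' \<in> triangulations k'" "v' \<in> triangulations l'"
      and eq: "tri_oplus (tri_lam u) v = tri_oplus (tri_lam u') v'" for k l k' l' u v u' v'
  proof -
    define T where "T = tri_oplus (tri_lam u) v"
    note 1 = tri_parts[OF uv(1,2) T_def] and 2 = tri_parts[OF uv(3,4) T_def[unfolded eq]]
    \<comment> \<open>Both \<open>k + 3\<close> and \<open>k' + 3\<close> are the neighbour of 1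
      that follows 2; once the sizes agree, the two parts are read off from
      \<open>T\<close>.\<close>
    have "k + 3 \<le> k' + 3" using 1(2)[OF 2(1)] by simp
    moreover have "k' + 3 \<le> k + 3" using 2(2)[OF 1(1)] by simp
    ultimately have "k = k'" by simp
    then show ?thesis using 1(3,4) 2(3,4) by metis
  qed
qed (use triangulations_0 tri_lam_closed tri_oplus_closed tri_decompose in auto)

section \<open>Statistics of triangulations\<close>

lemma tri_comp_eq:
  assumes T: "T \<in> triangulations n" shows "tri_comp T = card {j. (1, j) \<in> T} - 1"
proof -
  have "{x \<in> T. fst x = 1 \<or> snd x = 1} = Pair 1 ` {j. (1, j) \<in> T}"
    using tri_bounds[OF T] by force
  then show ?thesis by (simp add: tri_comp_def tri_degree_def card_image inj_on_def)
qed

lemma tri_rcomp_eq: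
  assumes T: "T \<in> triangulations n" shows "tri_rcomp T = card {i. (i, n + 2) \<in> T} - 1"
proof -
  have "{x \<in> T. fst x = n + 2 \<or> snd x = n + 2} = (\<lambda>i. (i, n + 2)) ` {i. (i, n + 2) \<in> T}"
    using tri_bounds[OF T] by force
  then show ?thesis
    unfolding tri_rcomp_def tri_degree_def tri_size_eq[OF T] by (simp add: card_image inj_on_def)
qed

lemma tri_neighbours_finite:
  assumes T: "T \<in> triangulations n"
  shows "finite {j. (i, j) \<in> T}" "finite {j. (j, i) \<in> T}"
proof -
  have "{j. (i, j) \<in> T} \<subseteq> snd ` T" "{j. (j, i) \<in> T} \<subseteq> fst ` T" by force+
  then show "finite {j. (i, j) \<in> T}" "finite {j. (j, i) \<in> T}"
    using tri_finite[OF T] finite_surj by blast+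
qed

lemma tri_comp_lam:
  assumes u: "u \<in> triangulations k" shows "tri_comp (tri_lam u) = 1"
proof -
  have "(0, x) \<notin> u" for x using tri_bounds(1)[OF u, of 0] by auto
  then have "{j. (1, j) \<in> tri_lam u} = {2, k + 3}" unfolding mem_tri_lam[OF u] by auto
  then show ?thesis by (simp add: tri_comp_eq[OF tri_lam_closed[OF u]])
qed

lemma tri_comp_lam_oplus:
  assumes u: "u \<in> triangulations k" and v: "v \<in> triangulations l"
  shows "tri_comp (tri_oplus (tri_lam u) v) = Suc (tri_comp v)"
proof -
  have 0: "(0, x) \<notin> u" for x using tri_bounds(1)[OF u, of 0] by auto
  have "{j. (1, j) \<in> tri_oplus (tri_lam u) v} = insert 2 ((\<lambda>j. j + (k + 1)) ` {j. (1, j) \<in> v})"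
  proof (rule set_eqI)
    fix j
    have "(1, j - (k + 1)) \<in> v \<longleftrightarrow> j \<in> (\<lambda>j. j + (k + 1)) ` {j. (1, j) \<in> v}"
    proof
      assume *: "(1, j - (k + 1)) \<in> v"
      have "j = j - (k + 1) + (k + 1)" using tri_bounds[OF v *] by linarith
      then show "j \<in> (\<lambda>j. j + (k + 1)) ` {j. (1, j) \<in> v}" using * by blast
    qed auto
    then show "j \<in> {j. (1, j) \<in> tri_oplus (tri_lam u) v} \<longleftrightarrow>
        j \<in> insert 2 ((\<lambda>j. j + (k + 1)) ` {j. (1, j) \<in> v})"
      using 0 unfolding mem_Collect_eq mem_tri_lam_oplus[OF u v] by simp
  qed
  moreover have "2 \<notin> (\<lambda>j. j + (k + 1)) ` {j. (1, j) \<in> v}" using tri_bounds[OF v] by force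
  moreover have "card ((\<lambda>j. j + (k + 1)) ` {j. (1, j) \<in> v}) = card {j. (1, j) \<in> v}"
    by (rule card_image) (simp add: inj_on_def)
  ultimately have "card {j. (1, j) \<in> tri_oplus (tri_lam u) v} = Suc (card {j. (1, j) \<in> v})"
    using tri_neighbours_finite[OF v] by simp
  \<comment> \<open>Positivity ensures that the \<open>- 1\<close> in \<open>tri_comp\<close> is not
    truncated.\<close>
  moreover have "card {j. (1, j) \<in> v} > 0"
    using tri_12[OF v] tri_neighbours_finite[OF v] by (auto simp: card_gt_0_iff)
  ultimately show ?thesis
    unfolding tri_comp_eq[OF tri_oplus_closed[OF tri_lam_closed[OF u] v]] tri_comp_eq[OF v] by simp
qed

lemma tri_rcomp_lam:
  assumes u: "u \<in> triangulations k" shows "tri_rcomp (tri_lam u) = Suc (tri_rcomp u)"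
proof -
  have "{i. (i, Suc k + 2) \<in> tri_lam u} = insert 1 (Suc ` {i. (i, k + 2) \<in> u})"
  proof (rule set_eqI)
    fix i
    have "(i - 1, k + 2) \<in> u \<longleftrightarrow> i \<in> Suc ` {i. (i, k + 2) \<in> u}"
      using tri_bounds(1)[OF u, of "i - 1" "k + 2"] by (cases i) auto
    then show "i \<in> {i. (i, Suc k + 2) \<in> tri_lam u} \<longleftrightarrow> i \<in> insert 1 (Suc ` {i. (i, k + 2) \<in> u})"
      unfolding mem_Collect_eq mem_tri_lam[OF u] by auto
  qed
  moreover have "1 \<notin> Suc ` {i. (i, k + 2) \<in> u}" using tri_bounds(1)[OF u] by force
  ultimately have "card {i. (i, Suc k + 2) \<in> tri_lam u} = Suc (card {i. (i, k + 2) \<in> u})"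
    using tri_neighbours_finite[OF u] by (simp add: card_image)
  moreover have "card {i. (i, k + 2) \<in> u} > 0"
    using tri_outer[OF u] tri_neighbours_finite[OF u] by (auto simp: card_gt_0_iff)
  ultimately show ?thesis
    unfolding tri_rcomp_eq[OF tri_lam_closed[OF u]] tri_rcomp_eq[OF u] by simp
qed

lemma tri_rcomp_oplus:
  assumes S: "S \<in> triangulations m" and T: "T \<in> triangulations n" and "n \<ge> 1"
  shows "tri_rcomp (tri_oplus S T) = tri_rcomp T"
proof -
  let ?r = "\<lambda>i. if i = 1 then 1 else m + i"
  have "{i. (i, m + n + 2) \<in> tri_oplus S T} = ?r ` {i. (i, n + 2) \<in> T}"
  proof (rule set_eqI)
    fix i
    \<comment> \<open>For \<open>n \<ge> 1\<close> the last vertex lies outside the polygon of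
      \<open>S\<close>, so all its edges come from \<open>T\<close>.\<close>
    have "(i, m + n + 2) \<notin> S" using tri_bounds(3)[OF S, of i "m + n + 2"] assms(3) by auto
    then have "(i, m + n + 2) \<in> tri_oplus S T \<longleftrightarrow>
        i = 1 \<and> (1, n + 2) \<in> T \<or> 2 \<le> i - m \<and> (i - m, n + 2) \<in> T"
      unfolding mem_tri_oplus[OF S T] by (simp add: add.assoc)
    also have "\<dots> \<longleftrightarrow> i \<in> ?r ` {i. (i, n + 2) \<in> T}"
    proof
      assume "i = 1 \<and> (1, n + 2) \<in> T \<or> 2 \<le> i - m \<and> (i - m, n + 2) \<in> T"
      then show "i \<in> ?r ` {i. (i, n + 2) \<in> T}"
      proof (elim disjE conjE)
        assume "i = 1" "(1, n + 2) \<in> T"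
        then show ?thesis by (intro image_eqI[of _ _ 1]) simp_all
      next
        assume "2 \<le> i - m" "(i - m, n + 2) \<in> T"
        then show ?thesis by (intro image_eqI[of _ _ "i - m"]) simp_all
      qed
    next
      assume "i \<in> ?r ` {i. (i, n + 2) \<in> T}"
      then obtain j where j: "(j, n + 2) \<in> T" "i = ?r j" by blast
      show "i = 1 \<and> (1, n + 2) \<in> T \<or> 2 \<le> i - m \<and> (i - m, n + 2) \<in> T"
        using j tri_bounds(1)[OF T j(1)] by (cases "j = 1") simp_all
    qed
    finally show "i \<in> {i. (i, m + n + 2) \<in> tri_oplus S T} \<longleftrightarrow> i \<in> ?r ` {i. (i, n + 2) \<in> T}" by simp
  qed
  moreover have "inj_on ?r {i. (i, n + 2) \<in> T}"
  proof (rule inj_onI)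
    fix i j assume "i \<in> {i. (i, n + 2) \<in> T}" "j \<in> {i. (i, n + 2) \<in> T}" and eq: "?r i = ?r j"
    then have "1 \<le> i" "1 \<le> j" using tri_bounds(1)[OF T, of _ "n + 2"] by blast+
    then show "i = j" using eq by (cases "i = 1"; cases "j = 1") simp_all
  qed
  ultimately have "card {i. (i, m + n + 2) \<in> tri_oplus S T} = card {i. (i, n + 2) \<in> T}"
    by (simp only: card_image)
  then show ?thesis
    unfolding tri_rcomp_eq[OF tri_oplus_closed[OF S T]] tri_rcomp_eq[OF T] by simp
qed

lemma tri_tr_lam_e: "tri_tr (tri_lam tri_e) = 1"
proof -
  have e: "tri_e \<in> triangulations 0" using triangulations_0 by simp
  have "{i \<in> {2..1 + 1}. \<exists>j<i. (j, i) \<in> tri_lam tri_e \<and> (j, i + 1) \<in> tri_lam tri_e} = {2}"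
    unfolding mem_tri_lam[OF e] by (auto simp: tri_e_def intro!: exI[of _ 1])
  then show ?thesis
    using tri_size_eq[OF tri_lam_closed[OF e]] by (simp add: tri_tr_def)
qed

text \<open>In \<open>tri_lam u\<close> the vertex 1 has only the neighbours 2 and
  \<open>n + 3\<close>, which are consecutive only for \<open>n = 0\<close>; so for
  \<open>n \<ge> 1\<close> every counted triangle comes from \<open>u\<close>.\<close>

lemma tri_tr_lam:
  assumes u: "u \<in> triangulations n" and "n \<ge> 1" shows "tri_tr (tri_lam u) = tri_tr u"
proof -
  let ?A = "{i \<in> {2..Suc n + 1}. \<exists>j<i. (j, i) \<in> tri_lam u \<and> (j, i + 1) \<in> tri_lam u}"
  let ?B = "{i \<in> {2..n + 1}. \<exists>j<i. (j, i) \<in> u \<and> (j, i + 1) \<in> u}"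
  have "?A = Suc ` ?B"
  proof (rule set_eqI, rule iffI)
    fix i assume "i \<in> ?A"
    then obtain j where i: "2 \<le> i" "i \<le> n + 2" "j < i" and mem: "(j, i) \<in> tri_lam u" "(j, i + 1) \<in> tri_lam u"
      by auto
    have "(j - 1, i - 1) \<in> u \<and> (j - 1, i) \<in> u"
    proof (cases "j = 1")
      case True
      have "(0, x) \<notin> u" for x using tri_bounds(1)[OF u, of 0] by auto
      then have "i = 2 \<or> i = n + 3" "i + 1 = 2 \<or> i + 1 = n + 3"
        using mem True unfolding mem_tri_lam[OF u] by auto
      then show ?thesis using i assms(2) by linarith
    next
      case False
      then show ?thesis using mem unfolding mem_tri_lam[OF u] by auto
    qed
    moreover from this have "1 \<le> j - 1" "j - 1 < i - 1" using tri_bounds[OF u] by blast+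
    ultimately have "i - 1 \<in> ?B" using i by (auto intro!: exI[of _ "j - 1"])
    moreover have "i = Suc (i - 1)" using i by simp
    ultimately show "i \<in> Suc ` ?B" by blast
  next
    fix i assume "i \<in> Suc ` ?B"
    then obtain i' j where "i = Suc i'" "2 \<le> i'" "i' \<le> n + 1" "j < i'" "(j, i') \<in> u" "(j, i' + 1) \<in> u"
      by auto
    then show "i \<in> ?A" unfolding mem_tri_lam[OF u] by (auto intro!: exI[of _ "Suc j"])
  qed
  then show ?thesis
    unfolding tri_tr_def tri_size_eq[OF u] tri_size_eq[OF tri_lam_closed[OF u]] by (simp add: card_image)
qed

text \<open>A counted side \<open>(i, i + 1)\<close> lies in the polygon of \<open>S\<close> for
  \<open>i \<le> m + 1\<close> and in that of \<open>T\<close> beyond. Care is needed only near the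
  glued edge \<open>(1, m + 2)\<close>, which belongs to both.\<close>

lemma tri_tr_oplus:
  assumes S: "S \<in> triangulations m" and T: "T \<in> triangulations n"
  shows "tri_tr (tri_oplus S T) = tri_tr S + tri_tr T"
proof -
  note mem = mem_tri_oplus[OF S T]
  let ?P = "\<lambda>R i. \<exists>j<i. (j, i) \<in> R \<and> (j, i + 1) \<in> R"
  have low: "?P (tri_oplus S T) i \<longleftrightarrow> ?P S i" if i: "i \<le> m + 1" for i
  proof -
    have "(j, i) \<in> tri_oplus S T \<longleftrightarrow> (j, i) \<in> S" for j
      using tri_bounds(2)[OF T, of 1 "i - m"] tri_bounds(2)[OF T, of "j - m" "i - m"] i unfolding mem by auto
    moreover have "(j, i + 1) \<in> tri_oplus S T \<longleftrightarrow> (j, i + 1) \<in> S" for j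
    proof -
      have "(1, i + 1) \<in> S" if "(1, i + 1 - m) \<in> T"
      proof -
        have "i + 1 = m + 2" using tri_bounds(2)[OF T that] i by linarith
        then show ?thesis using tri_outer[OF S] by simp
      qed
      moreover have "\<not> (2 \<le> j - m \<and> (j - m, i + 1 - m) \<in> T)"
        using tri_bounds(2)[OF T, of "j - m" "i + 1 - m"] i by auto
      ultimately show ?thesis unfolding mem by auto
    qed
    ultimately show ?thesis by blast
  qed
  have high: "?P (tri_oplus S T) (i + m) \<longleftrightarrow> ?P T i" if i: "2 \<le> i" for i
  proof
    assume "?P (tri_oplus S T) (i + m)"
    then obtain j where j: "j < i + m" "(j, i + m) \<in> tri_oplus S T" "(j, i + m + 1) \<in> tri_oplus S T" by blast
    have "(j, i + m + 1) \<notin> S" using tri_bounds(3)[OF S, of j "i + m + 1"] i by auto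
    moreover have "i + m + 1 - m = i + 1" by simp
    ultimately have "j = 1 \<and> (1, i + 1) \<in> T \<or> 2 \<le> j - m \<and> (j - m, i + 1) \<in> T"
      using j(3) unfolding mem by simp
    then show "?P T i"
    proof (elim disjE conjE)
      assume *: "j = 1" "(1, i + 1) \<in> T"
      have "(1, i) \<in> T"
      \<comment> \<open>The chord may come from \<open>S\<close> only as the glued edge, which is
        the side \<open>(1, 2)\<close> of \<open>T\<close>.\<close>
      proof (cases "(1, i + m) \<in> S")
        case True
        then have "i = 2" using tri_bounds(3)[OF S True] i by simp
        then show ?thesis using tri_12[OF T] by simp
      next
        case False
        then show ?thesis using j(2) * unfolding mem by auto
      qed
      then show ?thesis using * i by (intro exI[of _ 1]) simp
    next
      assume *: "2 \<le> j - m" "(j - m, i + 1) \<in> T"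
      have "(j, i + m) \<notin> S" using tri_bounds[OF S, of j "i + m"] * by auto
      then have "(j - m, i) \<in> T" using j(2) * unfolding mem by auto
      then show ?thesis using * tri_bounds(2)[OF T, of "j - m" i] by blast
    qed
  next
    assume "?P T i"
    then obtain j where j: "j < i" "(j, i) \<in> T" "(j, i + 1) \<in> T" by blast
    show "?P (tri_oplus S T) (i + m)"
    proof (cases "j = 1")
      case True
      then show ?thesis using j unfolding mem by (intro exI[of _ 1]) auto
    next
      case False
      then have "2 \<le> j" using tri_bounds(1)[OF T j(2)] by simp
      then show ?thesis using j unfolding mem by (intro exI[of _ "j + m"]) auto
    qed
  qed
  have "{i \<in> {2..m + n + 1}. ?P (tri_oplus S T) i} =
      {i \<in> {2..m + 1}. ?P S i} \<union> (\<lambda>i. i + m) ` {i \<in> {2..n + 1}. ?P T i}" (is "?L = ?A \<union> ?B")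
  proof (rule set_eqI)
    fix i
    show "i \<in> ?L \<longleftrightarrow> i \<in> ?A \<union> ?B"
    proof (cases "i \<le> m + 1")
      case True
      then have "i \<notin> ?B" by auto
      then show ?thesis using True low[OF True] by simp
    next
      case False
      define i' where "i' = i - m"
      have i': "i = i' + m" "2 \<le> i'" using False by (auto simp: i'_def)
      have "i \<in> ?B \<longleftrightarrow> i' \<in> {i \<in> {2..n + 1}. ?P T i}" 
        unfolding i'(1) by (rule inj_image_mem_iff) (simp add: inj_on_def)
      moreover have "i \<in> ?L \<longleftrightarrow> i' \<le> n + 1 \<and> ?P T i'"
        using high[OF i'(2)] i' by simp
      ultimately show ?thesis using False i'(2) by auto
    qed
  qed
  moreover have "?A \<inter> ?B = {}" by auto
  ultimately show ?thesis
    unfolding tri_tr_def tri_size_eq[OF S] tri_size_eq[OF T] tri_size_eq[OF tri_oplus_closed[OF S T]]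
    by (simp add: card_Un_disjoint card_image)
qed

lemma tri_h_sends:
  assumes "n \<ge> 1"
  shows "catalan_data.h_sends triangulations tri_e tri_lam tri_oplus n
    (tri_comp, tri_tr) (tri_rcomp, tri_nontr)"
proof -
  interpret catalan_structure triangulations tri_e tri_lam tri_oplus by (rule tri_catalan)
  have pos: "\<exists>n\<ge>1. T \<in> triangulations n" if T: "T \<in> carrier" "T \<noteq> tri_e" for T
  proof -
    obtain n where n: "T \<in> triangulations n" using T by (auto simp: carrier_def)
    moreover have "n \<noteq> 0"
    proof
      assume "n = 0"
      then show False using n T(2) triangulations_0 by simp
    qed
    ultimately show ?thesis by (intro exI[of _ n]) simp
  qed
  have e: "tri_e \<in> triangulations 0" using triangulations_0 by simp
  show ?thesis
  proof (rule h_sendsI[OF assms])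
    show "tri_comp (tri_lam u) = 1" if "u \<in> carrier" for u
      using that tri_comp_lam by (auto simp: carrier_def)
    show "tri_comp (tri_oplus (tri_lam u) v) = Suc (tri_comp v)" if "u \<in> carrier" "v \<in> carrier" for u v
      using that tri_comp_lam_oplus by (auto simp: carrier_def)
    have "{i. (i, 0 + 2) \<in> tri_e} = {1}" by (auto simp: tri_e_def)
    then show "tri_rcomp (tri_lam tri_e) = 1"
      unfolding tri_rcomp_lam[OF e] tri_rcomp_eq[OF e] by simp
    show "tri_rcomp (tri_lam u) = Suc (tri_rcomp u)" if "u \<in> carrier" for u
      using that tri_rcomp_lam by (auto simp: carrier_def)
    show "tri_rcomp (tri_oplus t u) = tri_rcomp u" if "t \<in> carrier" "u \<in> carrier" "u \<noteq> tri_e" for t u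
      using that(1) pos[OF that(2,3)] tri_rcomp_oplus by (auto simp: carrier_def)
    show "tri_tr (tri_lam tri_e) = 1" by (rule tri_tr_lam_e)
    show "tri_tr (tri_lam u) = tri_tr u" if "u \<in> carrier" "u \<noteq> tri_e" for u
      using pos[OF that] tri_tr_lam by auto
    show "tri_tr (tri_oplus t u) = tri_tr t + tri_tr u" if "t \<in> carrier" "u \<in> carrier" for t u
      using that tri_tr_oplus by (auto simp: carrier_def)
    show "tri_nontr t = n + 1 - tri_tr t" if "t \<in> triangulations n" for t
      by (simp add: tri_nontr_def tri_size_eq[OF that])
  qed
qed

section \<open>The seven families\<close>

theorem mainTheorem2:
  fixes n :: nat
  assumes "n \<ge> 1"
  shows
    "(catalan_structure dyck_paths [] dyck_lam (@) \<and>
      catalan_data.h_sends dyck_paths [] dyck_lam (@) n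
        (dyck_comp, dyck_peak) (dyck_rcomp, dyck_nonpeak)) \<and>
     (catalan_structure triangulations tri_e tri_lam tri_oplus \<and>
      catalan_data.h_sends triangulations tri_e tri_lam tri_oplus n
        (tri_comp, tri_tr) (tri_rcomp, tri_nontr)) \<and>
     (catalan_structure perms_231 [] lam_231 perm_oplus \<and>
      catalan_data.h_sends perms_231 [] lam_231 perm_oplus n
        (perm_comp, perm_rmin) (perm_rmax, perm_nonrmin)) \<and>
     (catalan_structure perms_321 [] lam_321 perm_oplus \<and>
      catalan_data.h_sends perms_321 [] lam_321 perm_oplus n
        (perm_comp, perm_rmin) (perm_rcomp, perm_nonrmin)) \<and>
     (catalan_structure btrees Empty btree_lam btree_oplus \<and>
      catalan_data.h_sends btrees Empty btree_lam btree_oplus n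
        (btree_comp, btree_redge) (btree_rcomp, btree_ledge)) \<and>
     (catalan_structure syts ([], []) syt_lam syt_oplus \<and>
      catalan_data.h_sends syts ([], []) syt_lam syt_oplus n
        (syt_comp, syt_noncons) (syt_rcomp, syt_cons)) \<and>
     (catalan_structure nc_partitions {} ncp_lam ncp_oplus \<and>
      catalan_data.h_sends nc_partitions {} ncp_lam ncp_oplus n
        (ncp_comp, ncp_blocks) (ncp_rcomp, ncp_nonmin))"
  using assms dyck_catalan dyck_h_sends tri_catalan tri_h_sends perms_231_catalan perms_231_h_sends
    perms_321_catalan perms_321_h_sends btree_catalan btree_h_sends syt_catalan syt_h_sends
    ncp_catalan ncp_h_sends
  by (intro conjI)

end
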